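(* Let $\kappa_0=-\frac{m}{n}$ with $m,n$ positive integers, $\gcd(m,n)=1$ and $2\le n\le N$, and let $\tau$ be a partition of $N$. Suppose there exist singular polynomials for $\kappa_0$ of isotype $\tau$. Then $n\mid(\tau_i+1)$ for $1\le i<\ell(\tau)$, and there is a unique singular polynomial (for $\kappa_0$) of isotype $\tau$ of the form $g_\lambda=x^\lambda+\sum_{\beta\vartriangleleft\lambda}A_\beta x^\beta$ (with $A_\beta\in\mathbb Q$) such that $\mathcal U_i(\kappa_0)g_\lambda=\xi_i(\lambda;\kappa_0)g_\lambda$ for $1\le i\le N$, where $\lambda\in\mathbb N_0^N$ is the partition given by $$\lambda_{N+1-i}=-\kappa_0\sum_{j=1}^{s-1}(\tau_j+1)\quad\text{for}\quad \sum_{j=1}^{s-1}\tau_j<i\le\sum_{j=1}^{s}\tau_j,\quad 1\le s\le\ell(\tau).$$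
   Context: $S_N$ acts on polynomials in $x=(x_1,\ldots,x_N)$ by $(wf)(x)=f(xw)$, $(xw)_i=x_{w(i)}$; $(i,j)$ is the transposition. Dunkl operators: $\mathcal D_i(\kappa)f=\frac{\partial f}{\partial x_i}+\kappa\sum_{j\ne i}\frac{f-(i,j)f}{x_i-x_j}$. Also $\mathcal U_i(\kappa)f=\mathcal D_i(\kappa)(x_if)-\kappa\sum_{j=1}^{i-1}(j,i)f$, $1\le i\le N$. A singular polynomial for $\kappa_0\in\mathbb Q$ is a nonzero polynomial $p$ with rational coefficients such that $\mathcal D_i(\kappa_0)p=0$ for all $1\le i\le N$. Irreducible representations of $S_N$ are labeled in the standard way by partitions $\tau$ of $N$ (with $(N)$ trivial); a polynomial is of isotype $\tau$ if it lies in an irreducible $S_N$-submodule, corresponding to $\tau$, of the space of homogeneous polynomials of some degree. $\ell(\tau)=\max\{j:\tau_j\ge1\}$. For $\alpha\in\mathbb N_0^N$: $x^\alpha=\prod x_i^{\alpha_i}$, $|\alpha|=\sum\alpha_i$, and $\alpha^+$ is the nonincreasing rearrangement of $\alpha$. $\alpha\succ\beta$ means $\alpha\ne\beta$ and $\sum_{i=1}^j\alpha_i\ge\sum_{i=1}^j\beta_i$ for $1\le j\le N$. $\alpha\vartriangleright\beta$ (equivalently $\beta\vartriangleleft\alpha$) means $|\alpha|=|\beta|$ and either $\alpha^+\succ\beta^+$, or $\alpha^+=\beta^+$ and $\alpha\succ\beta$. Rank: $r(\alpha,i)=\#\{j:\alpha_j>\alpha_i\}+\#\{j:1\le j\le i,\alpha_j=\alpha_i\}$;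 $\xi_i(\alpha;\kappa)=(N-r(\alpha,i))\kappa+\alpha_i+1$. *)

theory Defs
  imports
    Complex_Main
    "HOL-Library.Poly_Mapping"
    "HOL-Combinatorics.Permutations"
begin

section \<open>Polynomials over the rationals\<close>

text \<open>
  Exponent vectors are finitely supported functions of type \<open>nat \<Rightarrow>\<^sub>0 nat\<close>. The indices in use
  are \<open>1, \<dots>, N\<close>, so \<open>\<nat>\<^sub>0\<^sup>N\<close> is the set of exponent vectors supported on \<open>{1..N}\<close>, and the
  polynomials in \<open>x\<^sub>1, \<dots>, x\<^sub>N\<close> are the elements of the monoid algebra whose exponents all lie in
  that set. Multiplication in the monoid algebra is polynomial multiplication.
\<close>

type_synonym expo = "nat \<Rightarrow>\<^sub>0 nat"
type_synonym rpoly = "expo \<Rightarrow>\<^sub>0 rat"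

abbreviation "lookup \<equiv> Poly_Mapping.lookup"
abbreviation "keys \<equiv> Poly_Mapping.keys"

definition expos :: "nat \<Rightarrow> expo set" where
  "expos N = {\<alpha>. keys \<alpha> \<subseteq> {1..N}}"

definition polys :: "nat \<Rightarrow> rpoly set" where
  "polys N = {f. keys f \<subseteq> expos N}"

definition weight :: "nat \<Rightarrow> expo \<Rightarrow> nat" where
  "weight N \<alpha> = (\<Sum>i=1..N. lookup \<alpha> i)"

definition homogeneous :: "nat \<Rightarrow> nat \<Rightarrow> rpoly set" where
  "homogeneous N d = {f \<in> polys N. \<forall>\<alpha>\<in>keys f. weight N \<alpha> = d}"

definition monomial :: "expo \<Rightarrow> rpoly" where
  "monomial \<alpha> = Poly_Mapping.single \<alpha> 1"

definition X :: "nat \<Rightarrow> rpoly" where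
  "X i = monomial (Poly_Mapping.single i 1)"

definition smul :: "rat \<Rightarrow> rpoly \<Rightarrow> rpoly" where
  "smul c f = Poly_Mapping.single 0 c * f"

interpretation rpoly: vector_space smul
proof
  fix a b :: rat and x y :: rpoly
  show "smul a (x + y) = smul a x + smul a y" "smul (a + b) x = smul a x + smul b x"
    by (simp_all add: smul_def algebra_simps single_add)
  show "smul a (smul b x) = smul (a * b) x"
    by (simp add: smul_def mult.assoc[symmetric] mult_single)
  show "smul 1 x = x"
    by (simp add: smul_def)
qed

definition subst :: "(nat \<Rightarrow> rpoly) \<Rightarrow> rpoly \<Rightarrow> rpoly" where
  "subst s f = (\<Sum>\<alpha>\<in>keys f. smul (lookup f \<alpha>) (\<Prod>i\<in>keys \<alpha>. s i ^ lookup \<alpha> i))"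

definition act :: "(nat \<Rightarrow> nat) \<Rightarrow> rpoly \<Rightarrow> rpoly" where
  "act w f = subst (\<lambda>i. X (w i)) f"

definition partial_deriv :: "nat \<Rightarrow> rpoly \<Rightarrow> rpoly" where
  "partial_deriv i f =
     (\<Sum>\<alpha>\<in>keys f. smul (lookup f \<alpha> * of_nat (lookup \<alpha> i))
                         (monomial (\<alpha> - Poly_Mapping.single i 1)))"


section \<open>Dunkl operators\<close>

text \<open>
  The description below determines a unique polynomial when \<open>i \<noteq> j\<close>; see \<open>divdiff_ex1\<close>.
\<close>

definition divdiff :: "nat \<Rightarrow> nat \<Rightarrow> rpoly \<Rightarrow> rpoly" where
  "divdiff i j f = (THE q. (X i - X j) * q = f - act (transpose i j) f)"

definition dunkl :: "nat \<Rightarrow> rat \<Rightarrow> nat \<Rightarrow> rpoly \<Rightarrow> rpoly" where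
  "dunkl N \<kappa> i f = partial_deriv i f + smul \<kappa> (\<Sum>j\<in>{1..N} - {i}. divdiff i j f)"

definition dunkl_U :: "nat \<Rightarrow> rat \<Rightarrow> nat \<Rightarrow> rpoly \<Rightarrow> rpoly" where
  "dunkl_U N \<kappa> i f = dunkl N \<kappa> i (X i * f) - smul \<kappa> (\<Sum>j=1..<i. act (transpose j i) f)"

definition singular :: "nat \<Rightarrow> rat \<Rightarrow> rpoly \<Rightarrow> bool" where
  "singular N \<kappa> p \<longleftrightarrow> p \<in> polys N \<and> p \<noteq> 0 \<and> (\<forall>i\<in>{1..N}. dunkl N \<kappa> i p = 0)"

lemma prod_X_eq_monomial: "(\<Prod>i\<in>keys \<alpha>. X i ^ lookup \<alpha> i) = monomial \<alpha>"
proof -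
  have pow: "X i ^ k = monomial (Poly_Mapping.single i k)" for i k
    by (induction k) (simp_all add: X_def monomial_def mult_single single_add[symmetric])
  have "(\<Prod>i\<in>A. monomial (\<beta> i)) = monomial (\<Sum>i\<in>A. \<beta> i)" if "finite A" for A and \<beta> :: "nat \<Rightarrow> expo"
    using that by induction (simp_all add: monomial_def mult_single)
  moreover have "(\<Sum>i\<in>keys \<alpha>. Poly_Mapping.single i (lookup \<alpha> i)) = \<alpha>"
    by (intro poly_mapping_eqI)
      (auto simp: lookup_sum lookup_single when_def in_keys_iff)
  ultimately show ?thesis
    by (simp add: pow)
qed

lemma subst_X: "subst X f = f"
proof (rule poly_mapping_eqI)
  fix \<beta>
  have "lookup (subst X f) \<beta> = (\<Sum>\<alpha>\<in>keys f. (lookup f \<alpha> when \<alpha> = \<beta>))"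
    by (simp add: subst_def prod_X_eq_monomial lookup_sum smul_def monomial_def mult_single lookup_single)
  then show "lookup (subst X f) \<beta> = lookup f \<beta>"
    by (auto simp: when_def in_keys_iff)
qed

lemma dvd_prod_diff:
  fixes d :: "'a :: comm_ring_1"
  assumes "\<And>i. d dvd s i - t i"
  shows "d dvd (\<Prod>i\<in>A. s i ^ e i) - (\<Prod>i\<in>A. t i ^ e i)"
proof -
  have mult: "d dvd a * b - a' * b'" if "d dvd a - a'" "d dvd b - b'" for a b a' b' :: 'a
  proof -
    have "a * b - a' * b' = (a - a') * b + a' * (b - b')"
      by (simp add: algebra_simps)
    then show ?thesis
      using that by simp
  qed
  have pow: "d dvd s i ^ k - t i ^ k" for i k
    by (induction k) (auto intro: mult assms)
  show ?thesis
    by (induction A rule: infinite_finite_induct) (auto intro: mult pow)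
qed

lemma divdiff_ex1:
  assumes "i \<noteq> j"
  shows "\<exists>!q. (X i - X j) * q = f - act (transpose i j) f"
proof -
  have "(X i - X j) dvd X k - X (transpose i j k)" for k
    using dvd_refl[of "X i - X j"] dvd_minus_iff[of "X i - X j" "X i - X j"]
    by (auto simp: transpose_def simp del: dvd_minus_iff)
  then have "(X i - X j) dvd subst X f - act (transpose i j) f"
    unfolding subst_def act_def sum_subtractf[symmetric] rpoly.scale_right_diff_distrib[symmetric]
    by (intro dvd_sum) (simp add: smul_def dvd_mult dvd_prod_diff)
  then obtain q where "f - act (transpose i j) f = (X i - X j) * q"
    by (auto simp: subst_X)
  moreover have "X i \<noteq> X j"
    using assms by (auto simp: X_def monomial_def dest!: arg_cong[where f = keys])
  ultimately show ?thesis
    by (metis mult_cancel_left right_minus_eq)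
qed


section \<open>Partitions and isotypes\<close>

text \<open>Parts are indexed from 1, and a partition of \<open>N\<close> is padded with zeros to length \<open>N\<close>.\<close>

definition is_partition :: "nat \<Rightarrow> expo \<Rightarrow> bool" where
  "is_partition N \<tau> \<longleftrightarrow>
     \<tau> \<in> expos N \<and> (\<forall>i j. 1 \<le> i \<and> i \<le> j \<and> j \<le> N \<longrightarrow> lookup \<tau> j \<le> lookup \<tau> i)"

definition partition_of :: "nat \<Rightarrow> expo \<Rightarrow> bool" where
  "partition_of N \<tau> \<longleftrightarrow> is_partition N \<tau> \<and> weight N \<tau> = N"

definition part_length :: "expo \<Rightarrow> nat" where
  "part_length \<tau> = Max {j. 1 \<le> j \<and> 1 \<le> lookup \<tau> j}"

definition cells :: "expo \<Rightarrow> (nat \<times> nat) set" where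
  "cells \<tau> = {(r, c). 1 \<le> r \<and> 1 \<le> c \<and> c \<le> lookup \<tau> r}"

definition tableaux :: "nat \<Rightarrow> expo \<Rightarrow> (nat \<times> nat \<Rightarrow> nat) set" where
  "tableaux N \<tau> = {T. bij_betw T (cells \<tau>) {1..N}}"

definition specht_poly :: "expo \<Rightarrow> (nat \<times> nat \<Rightarrow> nat) \<Rightarrow> rpoly" where
  "specht_poly \<tau> T =
     (\<Prod>(r, r', c) \<in> {(r, r', c). r < r' \<and> (r, c) \<in> cells \<tau> \<and> (r', c) \<in> cells \<tau>}.
        X (T (r, c)) - X (T (r', c)))"

text \<open>
  Specht's model of the irreducible representation labeled by \<open>\<tau>\<close>, over the rationals. For
  \<open>\<tau> = (N)\<close> it is spanned by the constant 1, and for \<open>\<tau> = (1, \<dots>, 1)\<close> by the Vandermonde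
  product, so the labels are the standard ones with \<open>(N)\<close> trivial.
\<close>

definition specht_module :: "nat \<Rightarrow> expo \<Rightarrow> rpoly set" where
  "specht_module N \<tau> = rpoly.span (specht_poly \<tau> ` tableaux N \<tau>)"

definition invariant_subspace :: "nat \<Rightarrow> rpoly set \<Rightarrow> bool" where
  "invariant_subspace N M \<longleftrightarrow>
     rpoly.subspace M \<and> (\<forall>w f. w permutes {1..N} \<and> f \<in> M \<longrightarrow> act w f \<in> M)"

definition irreducible_module :: "nat \<Rightarrow> rpoly set \<Rightarrow> bool" where
  "irreducible_module N M \<longleftrightarrow>
     invariant_subspace N M \<and> M \<noteq> {0} \<and>
     (\<forall>K. invariant_subspace N K \<and> K \<subseteq> M \<longrightarrow> K = {0} \<or> K = M)"

definition modules_isomorphic :: "nat \<Rightarrow> rpoly set \<Rightarrow> rpoly set \<Rightarrow> bool" where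
  "modules_isomorphic N M K \<longleftrightarrow>
     (\<exists>\<phi>. bij_betw \<phi> M K \<and>
          (\<forall>f\<in>M. \<forall>g\<in>M. \<phi> (f + g) = \<phi> f + \<phi> g) \<and>
          (\<forall>c. \<forall>f\<in>M. \<phi> (smul c f) = smul c (\<phi> f)) \<and>
          (\<forall>w. \<forall>f\<in>M. w permutes {1..N} \<longrightarrow> \<phi> (act w f) = act w (\<phi> f)))"

definition of_isotype :: "nat \<Rightarrow> expo \<Rightarrow> rpoly \<Rightarrow> bool" where
  "of_isotype N \<tau> f \<longleftrightarrow>
     (\<exists>d M. M \<subseteq> homogeneous N d \<and> irreducible_module N M \<and>
            modules_isomorphic N M (specht_module N \<tau>) \<and> f \<in> M)"


section \<open>Orders on exponents and spectral vectors\<close>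

text \<open>
  The dominance relation is stated for functions on \<open>{1..N}\<close>, so that it applies both to exponent
  vectors and to their rearrangements.
\<close>

definition dominates :: "nat \<Rightarrow> (nat \<Rightarrow> nat) \<Rightarrow> (nat \<Rightarrow> nat) \<Rightarrow> bool" where
  "dominates N a b \<longleftrightarrow>
     (\<exists>i\<in>{1..N}. a i \<noteq> b i) \<and> (\<forall>j\<in>{1..N}. (\<Sum>i=1..j. b i) \<le> (\<Sum>i=1..j. a i))"

definition rearranged :: "nat \<Rightarrow> expo \<Rightarrow> nat \<Rightarrow> nat" where
  "rearranged N \<alpha> i = rev (sort (map (lookup \<alpha>) [1..<N + 1])) ! (i - 1)"

definition below :: "nat \<Rightarrow> expo \<Rightarrow> expo \<Rightarrow> bool" where
  "below N \<beta> \<alpha> \<longleftrightarrow>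
     weight N \<alpha> = weight N \<beta> \<and>
     (dominates N (rearranged N \<alpha>) (rearranged N \<beta>) \<or>
      (\<forall>i\<in>{1..N}. rearranged N \<alpha> i = rearranged N \<beta> i) \<and> dominates N (lookup \<alpha>) (lookup \<beta>))"

definition rank :: "nat \<Rightarrow> expo \<Rightarrow> nat \<Rightarrow> nat" where
  "rank N \<alpha> i =
     card {j \<in> {1..N}. lookup \<alpha> j > lookup \<alpha> i} + card {j \<in> {1..i}. lookup \<alpha> j = lookup \<alpha> i}"

definition spectral :: "nat \<Rightarrow> expo \<Rightarrow> nat \<Rightarrow> rat \<Rightarrow> rat" where
  "spectral N \<alpha> i \<kappa> = (of_nat N - of_nat (rank N \<alpha> i)) * \<kappa> + of_nat (lookup \<alpha> i) + 1"

text \<open>The index set of the sum in the next definition is finite; see \<open>finite_below\<close>.\<close>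

definition has_leading_form :: "nat \<Rightarrow> expo \<Rightarrow> rpoly \<Rightarrow> bool" where
  "has_leading_form N \<alpha> g \<longleftrightarrow>
     (\<exists>A :: expo \<Rightarrow> rat.
        g = monomial \<alpha> + (\<Sum>\<beta>\<in>{\<beta> \<in> expos N. below N \<beta> \<alpha>}. smul (A \<beta>) (monomial \<beta>)))"

lemma finite_below: "finite {\<beta> \<in> expos N. below N \<beta> \<alpha>}"
proof -
  have bound: "lookup \<beta> i \<le> weight N \<alpha>" if "\<beta> \<in> expos N" "below N \<beta> \<alpha>" "i \<in> {1..N}" for \<beta> i
    using that member_le_sum[of i "{1..N}" "lookup \<beta>"] by (simp add: below_def weight_def)
  have "lookup ` {\<beta> \<in> expos N. below N \<beta> \<alpha>} \<subseteq>
          {h. \<forall>i. (i \<in> {1..N} \<longrightarrow> h i \<in> {..weight N \<alpha>}) \<and> (i \<notin> {1..N} \<longrightarrow> h i = 0)}"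
    using bound by (auto simp: expos_def subset_iff in_keys_iff)
  moreover have "finite \<dots>"
    by (rule finite_set_of_finite_funs) simp_all
  ultimately have "finite (lookup ` {\<beta> \<in> expos N. below N \<beta> \<alpha>})"
    by (rule finite_subset)
  then show ?thesis
    by (rule finite_imageD) (simp add: inj_on_def poly_mapping_eqI)
qed

end

theory Submission
  imports Defs
begin

text \<open>
  The orbit \<open>M\<close> of a singular polynomial spans an irreducible module of singular polynomials. Let
  \<open>\<mu>\<close> be an exponent of maximal height occurring in \<open>M\<close>. For \<open>f \<in> M\<close> and \<open>\<alpha>\<close> in the orbit of \<open>\<mu>\<close>,
  the coefficient of \<open>x\<^sup>\<alpha>/x\<^sub>i\<close> in \<open>D\<^sub>i f = 0\<close> involves only that orbit:
  \<open>(\<alpha>\<^sub>i + \<kappa> #{j. \<alpha>\<^sub>j < \<alpha>\<^sub>i}) f\<^sub>\<alpha> = \<kappa> (\<Sum>j | \<alpha>\<^sub>j < \<alpha>\<^sub>i. f\<^sub>(\<^sub>i\<^sub>j\<^sub>)\<^sub>\<alpha>)\<close>. By induction on the values of \<open>\<mu>\<close>, these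
  equations force \<open>f\<close> to be killed by all operators replacing one letter by a smaller one, which
  are the equations of a Specht module inside a permutation module, and they determine each value of
  \<open>\<mu>\<close> from the multiplicities of the smaller ones. A row-invariant and a column-antisymmetric
  vector of the Specht module of \<open>\<tau>\<close> show that the multiplicities are the parts of \<open>\<tau>\<close>. Hence
  \<open>\<mu>\<close> is a rearrangement of \<open>\<lambda>\<close>, and integrality of its entries gives the divisibility.

  On singular polynomials \<open>U\<^sub>i\<close> is \<open>1 + \<kappa>\<close> times a Jucys-Murphy element, and by the same equations
  \<open>f \<mapsto> f\<^sub>\<lambda>\<close> is a simultaneous eigenfunctional of these elements, which yields \<open>g\<^sub>\<lambda>\<close>. A difference of
  two candidates is a row-invariant eigenvector of degree \<open>|\<lambda>|\<close>, so if it were nonzero, the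
  coefficient of \<open>x\<^sup>\<lambda>\<close> in it could not vanish.
\<close>

section \<open>Functions on words satisfying the top-degree equations\<close>

text \<open>The matrix unit E(a,b) of gl acting on tensors: a function on words is a tensor in the
  letters, and E(a,b) sends the letter \<open>b\<close> to \<open>a\<close>.\<close>

definition lower :: "'a set \<Rightarrow> nat \<Rightarrow> nat \<Rightarrow> (('a \<Rightarrow> nat) \<Rightarrow> rat) \<Rightarrow> ('a \<Rightarrow> nat) \<Rightarrow> rat" where
  "lower I a b F w = (\<Sum>i\<in>{i\<in>I. w i = a}. F (w(i := b)))"

lemma upd_upd_transpose:
  assumes "w i = b" "w p = a" "a \<noteq> b"
  shows "w(i := a, p := b) = w \<circ> transpose i p"
  using assms by (auto simp: fun_eq_iff transpose_def)

text \<open>Turning \<open>b\<close> into \<open>a\<close> at \<open>i\<close> and then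
  \<open>a\<close> into \<open>b\<close> at \<open>p\<close> swaps the two positions, and p = i
  restores \<open>w\<close>. This converts the sums over transpositions in the top-degree equations
  into \<open>lower\<close>.\<close>

lemma lower_update:
  assumes "finite I" "i \<in> I" "w i = b" "a \<noteq> b"
  shows "lower I a b F (w(i := a)) = F w + (\<Sum>p\<in>{p\<in>I. w p = a}. F (w \<circ> transpose i p))"
proof -
  have "{p\<in>I. (w(i := a)) p = a} = insert i {p\<in>I. w p = a}"
    using assms by auto
  moreover have "i \<notin> {p\<in>I. w p = a}"
    using assms by auto
  moreover have "F (w(i := a, p := b)) = F (w \<circ> transpose i p)" if "w p = a" for p
    using upd_upd_transpose[of w i b p a] assms that by simp
  moreover have "w(i := b) = w"
    using assms by auto
  ultimately show ?thesis
    using assms by (simp add: lower_def)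
qed

text \<open>The commutator relation [E(a,a'), E(a',b)] = E(a,b): the extra term comes from changing
  the same position twice.\<close>

lemma lower_commute:
  assumes "finite I" "a \<noteq> a'" "a \<noteq> b" "a' \<noteq> b"
  shows "(\<Sum>i\<in>{i\<in>I. w i = a}. lower I a' b F (w(i := a'))) =
    lower I a b F w + (\<Sum>p\<in>{p\<in>I. w p = a'}. lower I a a' F (w(p := b)))"
proof -
  have 1: "lower I a' b F (w(i := a')) = F (w(i := b)) + (\<Sum>p\<in>{p\<in>I. w p = a'}. F (w(i := a', p := b)))"
    if "i \<in> I" "w i = a" for i
  proof -
    have "{p\<in>I. (w(i := a')) p = a'} = insert i {p\<in>I. w p = a'}"
      using that by auto
    then show ?thesis
      using that assms by (simp add: lower_def)
  qed
  have 2: "lower I a a' F (w(p := b)) = (\<Sum>i\<in>{i\<in>I. w i = a}. F (w(i := a', p := b)))"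
    if "p \<in> I" "w p = a'" for p
  proof -
    have "{i\<in>I. (w(p := b)) i = a} = {i\<in>I. w i = a}"
      using that assms by auto
    moreover have "w(p := b, i := a') = w(i := a', p := b)" if "w i = a" for i
      using that \<open>w p = a'\<close> assms by (auto intro: fun_upd_twist)
    ultimately show ?thesis
      by (simp add: lower_def)
  qed
  have "(\<Sum>i\<in>{i\<in>I. w i = a}. lower I a' b F (w(i := a'))) =
     (\<Sum>i\<in>{i\<in>I. w i = a}. F (w(i := b)) + (\<Sum>p\<in>{p\<in>I. w p = a'}. F (w(i := a', p := b))))"
    using 1 by (intro sum.cong) auto
  also have "\<dots> = lower I a b F w + (\<Sum>i\<in>{i\<in>I. w i = a}. \<Sum>p\<in>{p\<in>I. w p = a'}. F (w(i := a', p := b)))"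
    by (simp add: sum.distrib lower_def)
  also have "(\<Sum>i\<in>{i\<in>I. w i = a}. \<Sum>p\<in>{p\<in>I. w p = a'}. F (w(i := a', p := b))) =
    (\<Sum>p\<in>{p\<in>I. w p = a'}. \<Sum>i\<in>{i\<in>I. w i = a}. F (w(i := a', p := b)))"
    by (rule sum.swap)
  also have "\<dots> = (\<Sum>p\<in>{p\<in>I. w p = a'}. lower I a a' F (w(p := b)))"
    using 2 by (intro sum.cong) auto
  finally show ?thesis .
qed

lemma sum_transpose_swap:
  "(\<Sum>p\<in>A. \<Sum>i\<in>B. F (w \<circ> transpose p i)) = (\<Sum>i\<in>B. \<Sum>p\<in>A. F (w \<circ> transpose i p))"
  by (subst sum.swap) (simp add: transpose_commute)

text \<open>
  With \<open>\<Sum>F\<^sup>2\<close> over all words as a norm, \<open>lower I b a\<close> is adjoint to \<open>lower I a b\<close>, and their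
  commutator acts on \<open>F\<close> as \<open>n a - n b\<close>.
\<close>

lemma lower_zero_imp_content_le:
  fixes F :: "('a \<Rightarrow> nat) \<Rightarrow> rat"
  assumes fin: "finite I" and supp: "finite {w. F w \<noteq> 0}" and ab: "a \<noteq> b"
    and cont: "\<And>w x. F w \<noteq> 0 \<Longrightarrow> card {i\<in>I. w i = x} = n x"
    and zero: "\<And>w. lower I a b F w = 0" and w0: "F w0 \<noteq> 0"
  shows "n b \<le> n a"
proof -
  define W where "W = {w. F w \<noteq> 0}"
  define G where "G = lower I b a F"
  \<comment> \<open>A finite set containing the support of \<open>G\<close>, over which the norm of
    \<open>G\<close> is computed.\<close>
  define B where "B = (\<lambda>(w, p). w(p := b)) ` (SIGMA w:W. {p\<in>I. w p = a})"
  have finW: "finite W" and finB: "finite B"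
    using supp fin by (auto simp: W_def B_def intro!: finite_imageI finite_SigmaI)
  \<comment> \<open>The left side is \<open>lower I a b G w\<close>. Exchanging the two operators
    costs the commutator n a - n b, and the exchanged product applies \<open>lower I a b\<close> to
    \<open>F\<close> first, which gives 0.\<close>
  have key: "(\<Sum>p\<in>{p\<in>I. w p = a}. G (w(p := b))) = (of_nat (n a) - of_nat (n b)) * F w"
    if "w \<in> W" for w
  proof -
    have na: "card {p\<in>I. w p = a} = n a" and nb: "card {p\<in>I. w p = b} = n b"
      using cont that by (auto simp: W_def)
    have "(\<Sum>p\<in>{p\<in>I. w p = a}. G (w(p := b))) =
        (\<Sum>p\<in>{p\<in>I. w p = a}. F w + (\<Sum>i\<in>{i\<in>I. w i = b}. F (w \<circ> transpose p i)))"
      unfolding G_def using fin ab by (intro sum.cong refl lower_update) auto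
    also have "\<dots> = of_nat (n a) * F w + (\<Sum>i\<in>{i\<in>I. w i = b}. \<Sum>p\<in>{p\<in>I. w p = a}. F (w \<circ> transpose i p))"
      by (simp add: sum.distrib na sum_transpose_swap)
    also have "(\<Sum>i\<in>{i\<in>I. w i = b}. \<Sum>p\<in>{p\<in>I. w p = a}. F (w \<circ> transpose i p)) =
        (\<Sum>i\<in>{i\<in>I. w i = b}. - F w)"
    proof (intro sum.cong refl)
      fix i assume "i \<in> {i\<in>I. w i = b}"
      then show "(\<Sum>p\<in>{p\<in>I. w p = a}. F (w \<circ> transpose i p)) = - F w"
        using lower_update[OF fin, of i w b a F] ab zero by simp
    qed
    also have "of_nat (n a) * F w + (\<Sum>i\<in>{i\<in>I. w i = b}. - F w) = (of_nat (n a) - of_nat (n b)) * F w"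
      by (simp add: nb algebra_simps)
    finally show ?thesis .
  qed
  have "(of_nat (n a) - of_nat (n b)) * (\<Sum>w\<in>W. F w ^ 2) =
      (\<Sum>w\<in>W. F w * (\<Sum>p\<in>{p\<in>I. w p = a}. G (w(p := b))))"
    by (subst sum_distrib_left, intro sum.cong refl) (simp add: key power2_eq_square del: fun_upd_apply)
  also have "\<dots> = (\<Sum>(w, p)\<in>(SIGMA w:W. {p\<in>I. w p = a}). F w * G (w(p := b)))"
    using finW fin by (simp add: sum.Sigma sum_distrib_left)
  \<comment> \<open>Adjointness: the pairs (w, p) are regrouped by the changed word v, from which w
    is recovered as \<open>v(p := a)\<close>.\<close>
  also have "\<dots> = (\<Sum>(v, p)\<in>(SIGMA v:B. {p\<in>{p\<in>I. v p = b}. v(p := a) \<in> W}). F (v(p := a)) * G v)"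
    by (rule sum.reindex_bij_witness[where
          j = "\<lambda>(w, p). (w(p := b), p)" and i = "\<lambda>(v, p). (v(p := a), p)"])
      (auto simp: B_def fun_upd_idem_iff)
  also have "\<dots> = (\<Sum>v\<in>B. \<Sum>p\<in>{p\<in>{p\<in>I. v p = b}. v(p := a) \<in> W}. F (v(p := a)) * G v)"
    using finB fin by (simp add: sum.Sigma)
  also have "\<dots> = (\<Sum>v\<in>B. \<Sum>p\<in>{p\<in>I. v p = b}. F (v(p := a)) * G v)"
    using fin by (intro sum.cong refl sum.mono_neutral_left) (auto simp: W_def)
  also have "\<dots> = (\<Sum>v\<in>B. G v ^ 2)"
    by (simp add: G_def lower_def sum_distrib_right power2_eq_square)
  also have "\<dots> \<ge> 0"
    by (simp add: sum_nonneg)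
  finally have "(of_nat (n a) - of_nat (n b)) * (\<Sum>w\<in>W. F w ^ 2) \<ge> 0" .
  moreover have "(\<Sum>w\<in>W. F w ^ 2) > 0"
    using w0 finW by (intro sum_pos2[of _ w0]) (auto simp: W_def)
  ultimately have "(of_nat (n b) :: rat) \<le> of_nat (n a)"
    by (simp add: zero_le_mult_iff)
  then show ?thesis by simp
qed

section \<open>The values of the letters forced by the top-degree equations\<close>

definition idx :: "nat set \<Rightarrow> nat \<Rightarrow> nat" where
  "idx V a = card {x\<in>V. x < a}"

text \<open>\<open>F\<close> stands for the coefficients of a singular polynomial on one orbit of
  exponents of maximal height, \<open>n\<close> for the common multiplicities of the letters there,
  and \<open>star\<close> for the equation of \<open>star_top\<close>.\<close>

locale top_function =
  fixes I :: "'a set" and \<kappa> :: rat and F :: "('a \<Rightarrow> nat) \<Rightarrow> rat" and n :: "nat \<Rightarrow> nat" and w0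
  assumes finite_I: "finite I" and \<kappa>_neg: "\<kappa> < 0"
    and finite_support: "finite {w. F w \<noteq> 0}"
    and content: "F w \<noteq> 0 \<Longrightarrow> card {i\<in>I. w i = x} = n x"
    and star: "i \<in> I \<Longrightarrow> (of_nat (w i) + \<kappa> * of_nat (card {j\<in>I. w j < w i})) * F w =
          \<kappa> * (\<Sum>j\<in>{j\<in>I. w j < w i}. F (w \<circ> transpose i j))"
    and nonzero: "F w0 \<noteq> 0"
begin

definition V :: "nat set" where "V = {x. n x \<noteq> 0}"

lemma image_eq_V: "F w \<noteq> 0 \<Longrightarrow> w ` I = V"
proof -
  assume *: "F w \<noteq> 0"
  have "x \<in> w ` I \<longleftrightarrow> card {i\<in>I. w i = x} \<noteq> 0" for x
    using finite_I by auto
  then show ?thesis using content[OF *] by (auto simp: V_def)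
qed

lemma finite_V: "finite V"
  using image_eq_V[OF nonzero] finite_I by (metis finite_imageI)

lemma content_transpose:
  assumes "i \<in> I" "j \<in> I"
  shows "card {p\<in>I. (w \<circ> transpose i j) p = x} = card {p\<in>I. w p = x}"
proof -
  have "bij_betw (transpose i j) {p\<in>I. (w \<circ> transpose i j) p = x} {p\<in>I. w p = x}"
    using assms by (intro bij_betw_byWitness[where f' = "transpose i j"]) (auto simp: transpose_def)
  then show ?thesis by (rule bij_betw_same_card)
qed

text \<open>This is \<open>star\<close> divided by \<kappa>, its sum split by the letter
  \<open>a\<close> at the swapped position. By \<open>lower_update\<close> each part is a value of
  \<open>lower I a b F\<close> minus \<open>F w\<close>, whence the 1 added to
  \<open>n a\<close>.\<close>

lemma sum_lower:
  assumes "i \<in> I" "w i = b" "b \<in> V"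
  shows "(of_nat b / \<kappa> + (\<Sum>a\<in>{a\<in>V. a < b}. of_nat (n a + 1))) * F w =
     (\<Sum>a\<in>{a\<in>V. a < b}. lower I a b F (w(i := a)))"
\<comment> \<open>Transpositions keep the content, so both sides vanish at words of any other
  content than \<open>n\<close>; at words of content \<open>n\<close> the letters can be counted by
  \<open>n\<close>.\<close>
proof (cases "\<forall>x. card {p\<in>I. w p = x} = n x")
  case False
  then obtain x where x: "card {p\<in>I. w p = x} \<noteq> n x" by auto
  then have "F w = 0" using content by blast
  moreover have "F (w \<circ> transpose i j) = 0" if "j \<in> I" for j
    using x content content_transpose[OF assms(1) that, of w] by metis
  ultimately show ?thesis
    using assms finite_I by (simp add: lower_update)
next
  case True
  have img: "w ` I = V"
  proof -
    have "x \<in> w ` I \<longleftrightarrow> card {i\<in>I. w i = x} \<noteq> 0" for x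
      using finite_I by auto
    then show ?thesis using True by (auto simp: V_def)
  qed
  have un: "{j\<in>I. w j < b} = (\<Union>a\<in>{a\<in>V. a < b}. {j\<in>I. w j = a})"
    using img by auto
  have sums: "sum h {j\<in>I. w j < b} = (\<Sum>a\<in>{a\<in>V. a < b}. sum h {j\<in>I. w j = a})" for h :: "'a \<Rightarrow> rat"
    unfolding un using finite_I finite_V by (subst sum.UNION_disjoint) auto
  have c: "of_nat (card {j\<in>I. w j < b}) = (\<Sum>a\<in>{a\<in>V. a < b}. of_nat (n a) :: rat)"
    using sums[of "\<lambda>_. 1"] True by simp
  have "(\<Sum>a\<in>{a\<in>V. a < b}. lower I a b F (w(i := a))) =
     (\<Sum>a\<in>{a\<in>V. a < b}. F w + (\<Sum>p\<in>{p\<in>I. w p = a}. F (w \<circ> transpose i p)))"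
    using assms finite_I by (intro sum.cong refl lower_update) auto
  also have "\<dots> = (\<Sum>a\<in>{a\<in>V. a < b}. F w) + (\<Sum>j\<in>{j\<in>I. w j < b}. F (w \<circ> transpose i j))"
    by (simp add: sum.distrib sums)
  also have "(\<Sum>j\<in>{j\<in>I. w j < b}. F (w \<circ> transpose i j)) =
      (of_nat b / \<kappa> + of_nat (card {j\<in>I. w j < b})) * F w"
    using star[OF assms(1), of w] assms(2) \<kappa>_neg by (simp add: field_simps)
  also have "(\<Sum>a\<in>{a\<in>V. a < b}. F w) + (of_nat b / \<kappa> + of_nat (card {j\<in>I. w j < b})) * F w =
      (of_nat b / \<kappa> + (\<Sum>a\<in>{a\<in>V. a < b}. of_nat (n a + 1))) * F w"
    by (simp add: c sum.distrib algebra_simps)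
  finally show ?thesis by (rule sym)
qed

text \<open>
  The factor of \<open>lower I a b F w\<close> obtained by summing \<open>sum_lower\<close> could vanish only if \<open>b\<close> were at
  most its predecessor \<open>e\<close> in \<open>V\<close>; here \<open>n e \<le> n a\<close> is needed.
\<close>

lemma value_and_lower:
  assumes "b \<in> V"
  shows "of_nat b = - \<kappa> * (\<Sum>a\<in>{a\<in>V. a < b}. of_nat (n a + 1)) \<and>
    (\<forall>a\<in>V. a < b \<longrightarrow> (\<forall>w. lower I a b F w = 0))"
  using assms
proof (induction b rule: less_induct)
  case (less b)
  note outer = less.IH
  \<comment> \<open>The factor of \<open>F w\<close> in \<open>sum_lower\<close>; once all operators
    \<open>lower I a b\<close> vanish on \<open>F\<close>, it must be 0, and that is the formula for
    \<open>b\<close>.\<close>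
  define c where "c = of_nat b / \<kappa> + (\<Sum>a\<in>{a\<in>V. a < b}. of_nat (n a + 1))"
  have low: "lower I a b F w = 0" if "a \<in> V" "a < b" for a w
    using that
  proof (induction a arbitrary: w rule: less_induct)
    case (less a)
    let ?A = "{a'\<in>V. a < a' \<and> a' < b}"
    \<comment> \<open>Letters below \<open>a\<close> drop out by the inner induction. The letter
      \<open>a\<close> itself contributes its multiplicity in \<open>w\<close>. Each letter between
      \<open>a\<close> and \<open>b\<close> contributes \<open>lower I a b F w\<close> once, by the
      commutator relation and the outer induction.\<close>
    have split: "{a'\<in>V. a' < b} = {a'\<in>V. a' < a} \<union> insert a ?A"
      using less.prems by auto
    have fins: "finite {a'\<in>V. a' < a}" "finite ?A"
      using finite_V by auto
    have "c * lower I a b F w = (\<Sum>i\<in>{i\<in>I. w i = a}. c * F (w(i := b)))"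
      by (simp add: lower_def sum_distrib_left)
    also have "\<dots> = (\<Sum>i\<in>{i\<in>I. w i = a}. \<Sum>a'\<in>{a'\<in>V. a' < b}. lower I a' b F (w(i := a')))"
      unfolding c_def using \<open>b \<in> V\<close> by (intro sum.cong refl) (subst sum_lower, auto)
    also have "\<dots> = (\<Sum>a'\<in>{a'\<in>V. a' < b}. \<Sum>i\<in>{i\<in>I. w i = a}. lower I a' b F (w(i := a')))"
      by (rule sum.swap)
    also have "\<dots> = (\<Sum>a'\<in>{a'\<in>V. a' < a}. \<Sum>i\<in>{i\<in>I. w i = a}. lower I a' b F (w(i := a'))) +
        ((\<Sum>i\<in>{i\<in>I. w i = a}. lower I a b F (w(i := a))) +
         (\<Sum>a'\<in>?A. \<Sum>i\<in>{i\<in>I. w i = a}. lower I a' b F (w(i := a'))))"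
      unfolding split using fins by (subst sum.union_disjoint) auto
    also have "(\<Sum>a'\<in>{a'\<in>V. a' < a}. \<Sum>i\<in>{i\<in>I. w i = a}. lower I a' b F (w(i := a'))) = 0"
      using less by (intro sum.neutral ballI) auto
    also have "(\<Sum>i\<in>{i\<in>I. w i = a}. lower I a b F (w(i := a))) =
        of_nat (card {i\<in>I. w i = a}) * lower I a b F w"
    proof -
      have "lower I a b F (w(i := a)) = lower I a b F w" if "w i = a" for i
        using that by (metis fun_upd_triv)
      then show ?thesis by simp
    qed
    also have "(\<Sum>a'\<in>?A. \<Sum>i\<in>{i\<in>I. w i = a}. lower I a' b F (w(i := a'))) =
        of_nat (card ?A) * lower I a b F w"
    proof -
      have "(\<Sum>i\<in>{i\<in>I. w i = a}. lower I a' b F (w(i := a'))) = lower I a b F w" if "a' \<in> ?A" for a'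
        using that finite_I less.prems outer by (subst lower_commute) auto
      then show ?thesis by simp
    qed
    finally have eq: "(c - of_nat (card {i\<in>I. w i = a}) - of_nat (card ?A)) * lower I a b F w = 0"
      by (simp add: algebra_simps)
    show ?case
    proof (rule ccontr)
      assume nz: "lower I a b F w \<noteq> 0"
      then obtain i where i: "i \<in> I" "w i = a" "F (w(i := b)) \<noteq> 0"
        by (auto simp: lower_def elim!: sum.not_neutral_contains_not_neutral)
      \<comment> \<open>The word \<open>w(i := b)\<close> lies in the support, so it has exactly
        \<open>n a\<close> letters \<open>a\<close>, and \<open>w\<close> has one more.\<close>
      have "{p\<in>I. w p = a} = insert i {p\<in>I. (w(i := b)) p = a}"
        using i less.prems by auto
      then have "card {p\<in>I. w p = a} = n a + 1"
        using content[OF i(3), of a] finite_I less.prems by (auto simp: card_insert_if)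
      then have c_eq: "c = of_nat (n a) + 1 + of_nat (card ?A)"
        using eq nz by simp
      \<comment> \<open>The value of the predecessor \<open>e\<close> is known by the outer
        induction; inserting it leaves c = (b - e)/\<kappa> + n e + 1, which is less than n e + 1
        because \<kappa> is negative.\<close>
      define e where "e = Max {x\<in>V. x < b}"
      have e: "e \<in> V" "e < b" "\<And>x. x \<in> V \<Longrightarrow> x < b \<Longrightarrow> x \<le> e"
        using finite_V less.prems Max_in[of "{x\<in>V. x < b}"] by (auto simp: e_def simp del: Max_less_iff)
      have "{x\<in>V. x < b} = insert e {x\<in>V. x < e}"
        using e by force
      then have c2: "c = of_nat b / \<kappa> + of_nat (n e + 1) + (\<Sum>a\<in>{a\<in>V. a < e}. of_nat (n a + 1))"
        using finite_V by (simp add: c_def)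
      have "of_nat e = - \<kappa> * (\<Sum>a\<in>{a\<in>V. a < e}. of_nat (n a + 1))"
        using outer e by blast
      then have "c = (of_nat b - of_nat e) / \<kappa> + of_nat (n e + 1)"
        using c2 \<kappa>_neg by (simp add: field_simps)
      moreover have "(of_nat b - of_nat e) / \<kappa> < 0"
        using e \<kappa>_neg by (simp add: divide_pos_neg)
      ultimately have "of_nat (n a + card ?A) < (of_nat (n e) :: rat)"
        using c_eq by simp
      then have "n a < n e"
        by linarith
      \<comment> \<open>By the outer induction \<open>lower I a e F\<close> vanishes, so the norm
        argument compares the two multiplicities.\<close>
      moreover have "n e \<le> n a"
      proof (cases "a = e")
        case False
        then have "a < e" using e less.prems by force
        show ?thesis
          using finite_I finite_support _ content _ nonzero
          by (rule lower_zero_imp_content_le)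
            (use \<open>a < e\<close> e less.prems outer in auto)
      qed simp
      ultimately show False by simp
    qed
  qed
  obtain i where "i \<in> I" "w0 i = b"
    using image_eq_V[OF nonzero] less.prems by (metis imageE)
  then have "c * F w0 = 0"
    using sum_lower[of i w0 b] low less.prems by (simp add: c_def)
  then have "c = 0" using nonzero by simp
  then have "of_nat b = - \<kappa> * (\<Sum>a\<in>{a\<in>V. a < b}. of_nat (n a + 1))"
    using \<kappa>_neg by (simp add: c_def field_simps)
  then show ?case using low by blast
qed

section \<open>Words in the support of a row-invariant function\<close>

lemma ex_idx_less:
  assumes "b \<in> V" "s < idx V b"
  shows "\<exists>a\<in>V. a < b \<and> idx V a = s"
proof -
  let ?S = "{x\<in>V. x < b}"
  have less: "idx V x < idx V y" if "x \<in> V" "x < y" for x y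
    unfolding idx_def using that finite_V by (intro psubset_card_mono) auto
  have "inj_on (idx V) ?S"
    by (rule inj_onI) (metis (mono_tags, lifting) less less_irrefl linorder_neqE_nat mem_Collect_eq)
  then have "card (idx V ` ?S) = card {..<idx V b}"
    by (simp add: card_image) (simp add: idx_def)
  moreover have "idx V ` ?S \<subseteq> {..<idx V b}"
    using less by auto
  ultimately have "idx V ` ?S = {..<idx V b}"
    by (intro card_subset_eq) auto
  then have "s \<in> idx V ` ?S"
    using assms by simp
  then show ?thesis by auto
qed

lemma idx_less_iff:
  assumes "x \<in> V" "y \<in> V" shows "idx V x < idx V y \<longleftrightarrow> x < y"
proof -
  have less: "idx V x < idx V y" if "x \<in> V" "x < y" for x y
    unfolding idx_def using that finite_V by (intro psubset_card_mono) auto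
  show ?thesis
    by (metis assms less linorder_neqE_nat order_less_asym)
qed

text \<open>Rows are treated in increasing order. Among support words already good on the rows
  before \<open>s\<close>, one takes a word with as many letters of index \<open>s\<close> in row
  \<open>s\<close> as possible. If row \<open>s\<close> had a larger letter \<open>b\<close>, then
  in the equation \<open>lower I a b F = 0\<close> with \<open>a\<close> of index \<open>s\<close> a
  swap within the row gives \<open>F w\<close> and a swap with a later row gives 0 by maximality. A
  positive multiple of \<open>F w\<close> would vanish.\<close>

lemma row_word:
  assumes rows: "\<And>i j w. i \<in> I \<Longrightarrow> j \<in> I \<Longrightarrow> t i = t j \<Longrightarrow> F (w \<circ> transpose i j) = F w"
  shows "\<exists>w. F w \<noteq> 0 \<and> (\<forall>i\<in>I. idx V (w i) \<le> t i)"
proof -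
  have "\<exists>w. F w \<noteq> 0 \<and> (\<forall>i\<in>I. t i < s \<longrightarrow> idx V (w i) \<le> t i)" for s
  proof (induction s)
    case 0
    then show ?case using nonzero by auto
  next
    case (Suc s)
    let ?P = "\<lambda>w. F w \<noteq> 0 \<and> (\<forall>i\<in>I. t i < s \<longrightarrow> idx V (w i) \<le> t i)"
    let ?c = "\<lambda>w. card {i\<in>I. t i = s \<and> idx V (w i) = s}"
    have "\<forall>w. ?P w \<longrightarrow> ?c w \<le> card I"
      using finite_I by (auto intro: card_mono)
    moreover obtain w1 where "?P w1" using Suc by auto
    ultimately have "\<exists>w. ?P w \<and> (\<forall>w'. ?P w' \<longrightarrow> ?c w' \<le> ?c w)"
      using ex_has_greatest_nat[of ?P w1 ?c "Suc (card I)"] by (simp add: less_Suc_eq_le)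
    then obtain w where w: "?P w" and max: "\<And>w'. ?P w' \<Longrightarrow> ?c w' \<le> ?c w"
      by auto
    have "idx V (w i) \<le> s" if i: "i \<in> I" "t i = s" for i
    proof (rule ccontr)
      assume "\<not> idx V (w i) \<le> s"
      define b where "b = w i"
      have "b \<in> V" using i w image_eq_V by (auto simp: b_def)
      obtain a where a: "a \<in> V" "a < b" "idx V a = s"
        using ex_idx_less[OF \<open>b \<in> V\<close>, of s] \<open>\<not> idx V (w i) \<le> s\<close> by (auto simp: b_def)
      have z: "F (w \<circ> transpose i p) = (if t p = s then F w else 0)" if p: "p \<in> I" "w p = a" for p
      proof (cases "t p = s")
        case True
        then show ?thesis using rows p i by simp
      next
        case False
        \<comment> \<open>In a row before \<open>s\<close> the indices are at most the row number,
          whereas \<open>a\<close> has index \<open>s\<close>.\<close>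
        have ps: "\<not> t p < s" using w p a by fastforce
        have "F (w \<circ> transpose i p) = 0"
        proof (rule ccontr)
          assume "F (w \<circ> transpose i p) \<noteq> 0"
          moreover have "idx V ((w \<circ> transpose i p) j) \<le> t j" if "j \<in> I" "t j < s" for j
            using that ps i w by (auto simp: transpose_def)
          ultimately have "?c (w \<circ> transpose i p) \<le> ?c w"
            using max by blast
          moreover have "{j\<in>I. t j = s \<and> idx V (w j) = s} \<subset> {j\<in>I. t j = s \<and> idx V ((w \<circ> transpose i p) j) = s}"
          proof
            show "{j\<in>I. t j = s \<and> idx V (w j) = s} \<subseteq> {j\<in>I. t j = s \<and> idx V ((w \<circ> transpose i p) j) = s}"
              using False p a by (auto simp: transpose_def)
            have "i \<in> {j\<in>I. t j = s \<and> idx V ((w \<circ> transpose i p) j) = s}"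
              using i p a by simp
            moreover have "i \<notin> {j\<in>I. t j = s \<and> idx V (w j) = s}"
              using \<open>\<not> idx V (w i) \<le> s\<close> by simp
            ultimately show "{j\<in>I. t j = s \<and> idx V (w j) = s} \<noteq> {j\<in>I. t j = s \<and> idx V ((w \<circ> transpose i p) j) = s}"
              by metis
          qed
          then have "?c w < ?c (w \<circ> transpose i p)"
            using finite_I by (intro psubset_card_mono) auto
          ultimately show False by simp
        qed
        then show ?thesis using False by simp
      qed
      have "0 = lower I a b F (w(i := a))"
        using value_and_lower[OF \<open>b \<in> V\<close>] a by simp
      also have "\<dots> = F w + (\<Sum>p\<in>{p\<in>I. w p = a}. F (w \<circ> transpose i p))"
        using finite_I i a by (intro lower_update) (auto simp: b_def)
      also have "(\<Sum>p\<in>{p\<in>I. w p = a}. F (w \<circ> transpose i p)) = (\<Sum>p\<in>{p\<in>I. w p = a}. if t p = s then F w else 0)"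
        using z by (intro sum.cong) auto
      also have "\<dots> = of_nat (card {p\<in>I. w p = a \<and> t p = s}) * F w"
        using finite_I by (simp add: sum.If_cases Int_def conj_ac)
      finally have "(1 + of_nat (card {p\<in>I. w p = a \<and> t p = s})) * F w = 0"
        by (simp add: algebra_simps)
      moreover have "1 + of_nat (card {p\<in>I. w p = a \<and> t p = s}) \<noteq> (0 :: rat)"
        by (metis of_nat_Suc of_nat_eq_0_iff nat.distinct(1))
      ultimately show False using w by simp
    qed
    then show ?case
      using w by (metis less_SucE order_refl)
  qed
  from this[of "Suc (Max (t ` I))"] show ?thesis
    using finite_I by (meson Max_ge finite_imageI imageI less_Suc_eq_le)
qed

text \<open>In \<open>value_and_lower\<close> the multiplicities of the smaller letters add up to
  the number of positions carrying them, and the ones add up to the index. In this form the value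
  depends on the pattern of indices only, ready for comparison with
  \<open>row_value\<close>.\<close>

lemma value_eq_idx:
  assumes "F w \<noteq> 0" "i \<in> I"
  shows "of_nat (w i) = - \<kappa> * of_nat (card {j\<in>I. idx V (w j) < idx V (w i)} + idx V (w i))"
proof -
  note img = image_eq_V[OF assms(1)]
  have "{j\<in>I. idx V (w j) < idx V (w i)} = (\<Union>a\<in>{a\<in>V. a < w i}. {j\<in>I. w j = a})"
  proof -
    have "idx V (w j) < idx V (w i) \<longleftrightarrow> w j < w i" "w j \<in> V" if "j \<in> I" for j
      using img assms that idx_less_iff[of "w j" "w i"] by blast+
    then show ?thesis by auto
  qed
  then have "card {j\<in>I. idx V (w j) < idx V (w i)} = (\<Sum>a\<in>{a\<in>V. a < w i}. card {j\<in>I. w j = a})"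
    using finite_I finite_V by (auto intro: card_UN_disjoint)
  then have "card {j\<in>I. idx V (w j) < idx V (w i)} = (\<Sum>a\<in>{a\<in>V. a < w i}. n a)"
    using content[OF assms(1)] by simp
  moreover have "w i \<in> V" using img assms by auto
  ultimately show ?thesis
    using value_and_lower[of "w i"] by (simp add: sum.distrib idx_def sum_distrib_left)
qed

end


section \<open>Coefficients\<close>

text \<open>The value 0 on functions with infinite support makes the coefficient rules below unconditional.\<close>

definition coef :: "rpoly \<Rightarrow> (nat \<Rightarrow> nat) \<Rightarrow> rat" where
  "coef f w = (if finite {i. w i \<noteq> 0} then lookup f (Abs_poly_mapping w) else 0)"

lemma lookup_inverse [simp]: "Abs_poly_mapping (lookup \<alpha>) = \<alpha>"
  by (rule poly_mapping_eqI) simp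

lemma coef_lookup [simp]: "coef f (lookup \<alpha>) = lookup f \<alpha>"
  by (simp add: coef_def)

lemma lookup_smul [simp]: "lookup (smul c f) \<alpha> = c * lookup f \<alpha>"
  by (simp add: smul_def mult_map_scale_conv_mult[symmetric] Poly_Mapping.map.rep_eq when_def)

lemma coef_zero [simp]: "coef 0 w = 0"
  and coef_add [simp]: "coef (f + g) w = coef f w + coef g w"
  and coef_diff [simp]: "coef (f - g) w = coef f w - coef g w"
  and coef_uminus [simp]: "coef (- f) w = - coef f w"
  and coef_smul [simp]: "coef (smul c f) w = c * coef f w"
  by (simp_all add: coef_def lookup_add lookup_minus)

lemma coef_sum [simp]: "coef (\<Sum>x\<in>A. f x) w = (\<Sum>x\<in>A. coef (f x) w)"
  by (induction A rule: infinite_finite_induct) auto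

lemma poly_eqI: "(\<And>w. coef f w = coef g w) \<Longrightarrow> f = g"
  by (rule poly_mapping_eqI) (metis coef_lookup)

lemma poly_expand: "f = (\<Sum>\<alpha>\<in>keys f. smul (lookup f \<alpha>) (monomial \<alpha>))"
  using subst_X[of f] by (simp add: subst_def prod_X_eq_monomial)

lemma coef_monomial: "coef (monomial \<alpha>) w = (if w = lookup \<alpha> then 1 else 0)"
proof (cases "finite {i. w i \<noteq> 0}")
  case True
  then have "\<alpha> = Abs_poly_mapping w \<longleftrightarrow> w = lookup \<alpha>"
    by (metis lookup_Abs_poly_mapping lookup_inverse)
  then show ?thesis
    using True by (simp add: coef_def monomial_def lookup_single when_def)
next
  case False
  then show ?thesis by (auto simp: coef_def)
qed

lemma coef_expand: "coef f w = (\<Sum>\<alpha>\<in>keys f. lookup f \<alpha> * (if w = lookup \<alpha> then 1 else 0))"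
  by (subst poly_expand) (simp add: coef_monomial)

lemma X_mult_monomial: "X i * monomial \<alpha> = monomial (Poly_Mapping.single i 1 + \<alpha>)"
  by (simp add: X_def monomial_def mult_single)

lemma smul_mult_right [simp]: "f * smul c g = smul c (f * g)"
  by (simp add: smul_def mult.left_commute)

lemma coef_X_mult: "coef (X i * f) w = (if w i = 0 then 0 else coef f (w(i := w i - 1)))"
proof -
  have eq: "w = lookup (Poly_Mapping.single i 1 + \<alpha>) \<longleftrightarrow> w i \<noteq> 0 \<and> w(i := w i - 1) = lookup \<alpha>" for \<alpha>
    by (auto simp: fun_eq_iff lookup_add lookup_single when_def split: if_splits)
  have "X i * f = (\<Sum>\<alpha>\<in>keys f. smul (lookup f \<alpha>) (monomial (Poly_Mapping.single i 1 + \<alpha>)))"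
    by (subst poly_expand) (simp add: sum_distrib_left X_mult_monomial)
  then have "coef (X i * f) w = (\<Sum>\<alpha>\<in>keys f. lookup f \<alpha> * (if w i \<noteq> 0 \<and> w(i := w i - 1) = lookup \<alpha> then 1 else 0))"
    by (simp only: coef_sum coef_smul coef_monomial eq)
  then show ?thesis
    by (simp add: coef_expand[of f "w(i := w i - Suc 0)"])
qed

lemma coef_partial_deriv: "coef (partial_deriv i f) w = of_nat (w i + 1) * coef f (w(i := w i + 1))"
proof -
  have eq: "lookup f \<alpha> * of_nat (lookup \<alpha> i) * (if w = lookup (\<alpha> - Poly_Mapping.single i 1) then 1 else 0) =
      of_nat (w i + 1) * (lookup f \<alpha> * (if w(i := w i + 1) = lookup \<alpha> then 1 else 0))" for \<alpha>
  proof (cases "lookup \<alpha> i = 0")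
    case True
    then show ?thesis by (auto simp: fun_eq_iff split: if_splits)
  next
    case False
    then have "w = lookup (\<alpha> - Poly_Mapping.single i 1) \<longleftrightarrow> w(i := w i + 1) = lookup \<alpha>"
      by (auto simp: fun_eq_iff lookup_minus lookup_single when_def split: if_splits)
    then show ?thesis
      by (auto simp: fun_eq_iff split: if_splits)
  qed
  show ?thesis
    unfolding partial_deriv_def coef_sum coef_smul coef_monomial
    by (subst coef_expand) (simp only: eq sum_distrib_left)
qed

lemma partial_deriv_add: "partial_deriv i (f + g) = partial_deriv i f + partial_deriv i g"
  and partial_deriv_smul: "partial_deriv i (smul c f) = smul c (partial_deriv i f)"
  by (rule poly_eqI, simp add: coef_partial_deriv algebra_simps)+

lemma partial_deriv_X_mult: "partial_deriv i (X i * f) = X i * partial_deriv i f + f"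
  by (rule poly_eqI) (auto simp: coef_partial_deriv coef_X_mult distrib_right)


section \<open>Substitution\<close>

definition mon :: "(nat \<Rightarrow> rpoly) \<Rightarrow> expo \<Rightarrow> rpoly" where
  "mon s \<alpha> = (\<Prod>i\<in>keys \<alpha>. s i ^ lookup \<alpha> i)"

lemma mon_superset:
  assumes "finite A" "keys \<alpha> \<subseteq> A"
  shows "mon s \<alpha> = (\<Prod>i\<in>A. s i ^ lookup \<alpha> i)"
  unfolding mon_def using assms by (intro prod.mono_neutral_left) (auto simp: in_keys_iff)

lemma mon_add: "mon s (\<alpha> + \<beta>) = mon s \<alpha> * mon s \<beta>"
proof -
  let ?A = "keys \<alpha> \<union> keys \<beta>"
  have "finite ?A" "keys (\<alpha> + \<beta>) \<subseteq> ?A" "keys \<alpha> \<subseteq> ?A" "keys \<beta> \<subseteq> ?A"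
    using keys_add[of \<alpha> \<beta>] by auto
  then show ?thesis
    by (simp add: mon_superset[of ?A] lookup_add power_add prod.distrib del: Un_upper1 Un_upper2 finite_Un)
qed

lemma subst_superset:
  assumes "finite K" "keys f \<subseteq> K"
  shows "subst s f = (\<Sum>\<alpha>\<in>K. smul (lookup f \<alpha>) (mon s \<alpha>))"
  unfolding subst_def mon_def[symmetric]
  using assms by (intro sum.mono_neutral_left) (auto simp: in_keys_iff)

lemma subst_zero [simp]: "subst s 0 = 0"
  by (simp add: subst_def)

lemma subst_add: "subst s (f + g) = subst s f + subst s g"
proof -
  let ?A = "keys f \<union> keys g"
  have "finite ?A" "keys (f + g) \<subseteq> ?A" "keys f \<subseteq> ?A" "keys g \<subseteq> ?A"
    using keys_add[of f g] by auto
  then show ?thesis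
    by (simp add: subst_superset[of ?A] lookup_add rpoly.scale_left_distrib sum.distrib
        del: Un_upper1 Un_upper2 finite_Un)
qed

lemma subst_smul: "subst s (smul c f) = smul c (subst s f)"
proof -
  have "keys (smul c f) \<subseteq> keys f"
    by (auto simp: in_keys_iff)
  then show ?thesis
    by (simp add: subst_superset[of "keys f"] rpoly.scale_sum_right)
qed

lemma subst_uminus: "subst s (- f) = - subst s f"
  using subst_smul[of s "-1" f] by (simp add: rpoly.scale_minus_left)

lemma subst_diff: "subst s (f - g) = subst s f - subst s g"
  using subst_add[of s f "- g"] by (simp add: subst_uminus)

lemma subst_sum: "subst s (\<Sum>x\<in>A. f x) = (\<Sum>x\<in>A. subst s (f x))"
  by (induction A rule: infinite_finite_induct) (auto simp: subst_add)

lemma subst_monomial: "subst s (monomial \<alpha>) = mon s \<alpha>"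
  by (simp add: subst_def mon_def monomial_def smul_def)

lemma monomial_mult: "monomial \<alpha> * monomial \<beta> = monomial (\<alpha> + \<beta>)"
  by (simp add: monomial_def mult_single)

lemma subst_mult: "subst s (f * g) = subst s f * subst s g"
proof -
  have "f * g = (\<Sum>\<alpha>\<in>keys f. smul (lookup f \<alpha>) (monomial \<alpha>)) * (\<Sum>\<beta>\<in>keys g. smul (lookup g \<beta>) (monomial \<beta>))"
    using poly_expand by metis
  also have "\<dots> = (\<Sum>\<alpha>\<in>keys f. \<Sum>\<beta>\<in>keys g. smul (lookup f \<alpha>) (smul (lookup g \<beta>) (monomial (\<alpha> + \<beta>))))"
    by (simp add: sum_product monomial_mult mult.commute)
  finally have "subst s (f * g) = (\<Sum>\<alpha>\<in>keys f. \<Sum>\<beta>\<in>keys g. smul (lookup f \<alpha>) (smul (lookup g \<beta>) (mon s \<alpha> * mon s \<beta>)))"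
    by (simp only: subst_sum subst_smul subst_monomial mon_add)
  also have "\<dots> = subst s f * subst s g"
    by (simp add: subst_def mon_def[symmetric] sum_product mult.commute)
  finally show ?thesis .
qed

lemma subst_one [simp]: "subst s 1 = 1"
  using subst_monomial[of s 0] by (simp add: monomial_def mon_def)

lemma subst_prod: "subst s (\<Prod>x\<in>A. f x) = (\<Prod>x\<in>A. subst s (f x))"
  by (induction A rule: infinite_finite_induct) (auto simp: subst_mult)

lemma subst_power: "subst s (f ^ k) = subst s f ^ k"
  by (induction k) (auto simp: subst_mult)

lemma subst_of_X [simp]: "subst s (X i) = s i"
  by (simp add: X_def subst_monomial mon_def)

lemma subst_subst: "subst s (subst r f) = subst (\<lambda>i. subst s (r i)) f"
  by (simp add: subst_def[of r] subst_def[of "\<lambda>i. subst s (r i)"] subst_sum subst_smul subst_prod subst_power)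

section \<open>The action of permutations on polynomials\<close>

lemma act_add: "act v (f + g) = act v f + act v g"
  and act_diff: "act v (f - g) = act v f - act v g"
  and act_uminus: "act v (- f) = - act v f"
  and act_smul: "act v (smul c f) = smul c (act v f)"
  and act_sum: "act v (\<Sum>x\<in>A. h x) = (\<Sum>x\<in>A. act v (h x))"
  and act_mult: "act v (f * g) = act v f * act v g"
  and act_prod: "act v (\<Prod>x\<in>A. h x) = (\<Prod>x\<in>A. act v (h x))"
  and act_X [simp]: "act v (X i) = X (v i)"
  and act_act: "act v (act u f) = act (v \<circ> u) f"
  and act_zero [simp]: "act v 0 = 0"
  by (simp_all add: act_def subst_add subst_diff subst_uminus subst_smul subst_sum subst_mult
      subst_prod subst_subst comp_def)

lemma act_id [simp]: "act id f = f"
  by (simp add: act_def subst_X)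

lemma act_transpose_transpose [simp]: "act (transpose i j) (act (transpose i j) f) = f"
  by (simp add: act_act)

text \<open>Acting by \<open>v\<close> composes the exponent of a monomial with
  \<open>inv v\<close>; reading off a coefficient therefore composes with \<open>v\<close>
  itself.\<close>

lemma coef_act:
  assumes "bij v"
  shows "coef (act v f) w = coef f (w \<circ> v)"
proof -
  have fin: "finite {k. (lookup \<alpha> \<circ> inv v) k \<noteq> 0}" for \<alpha> :: expo
  proof -
    have "{k. (lookup \<alpha> \<circ> inv v) k \<noteq> 0} \<subseteq> v ` keys \<alpha>"
    proof
      fix k assume "k \<in> {k. (lookup \<alpha> \<circ> inv v) k \<noteq> 0}"
      then have "inv v k \<in> keys \<alpha>" by (simp add: in_keys_iff)
      then show "k \<in> v ` keys \<alpha>"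
        using assms by (metis bij_inv_eq_iff image_eqI)
    qed
    then show ?thesis by (rule finite_subset) simp
  qed
  have mono: "act v (monomial \<alpha>) = monomial (Abs_poly_mapping (lookup \<alpha> \<circ> inv v))" for \<alpha>
  proof -
    define \<beta> where "\<beta> = Abs_poly_mapping (lookup \<alpha> \<circ> inv v)"
    have l\<beta>: "lookup \<beta> = lookup \<alpha> \<circ> inv v"
      using fin[of \<alpha>] by (simp add: \<beta>_def)
    have k\<beta>: "keys \<beta> = v ` keys \<alpha>"
    proof (intro set_eqI iffI)
      fix k assume "k \<in> keys \<beta>"
      then have "inv v k \<in> keys \<alpha>" by (simp add: in_keys_iff l\<beta>)
      then show "k \<in> v ` keys \<alpha>"
        using assms by (metis bij_inv_eq_iff image_eqI)
    qed (use assms in \<open>auto simp: in_keys_iff l\<beta> bij_is_inj\<close>)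
    have "act v (monomial \<alpha>) = (\<Prod>i\<in>keys \<alpha>. X (v i) ^ lookup \<alpha> i)"
      by (simp add: act_def subst_monomial mon_def)
    also have "\<dots> = (\<Prod>k\<in>keys \<beta>. X k ^ lookup \<beta> k)"
      unfolding k\<beta> using assms by (subst prod.reindex) (auto simp: l\<beta> bij_is_inj intro: inj_on_subset[OF bij_is_inj])
    finally show ?thesis
      by (simp add: prod_X_eq_monomial \<beta>_def)
  qed
  have eq: "w = lookup (Abs_poly_mapping (lookup \<alpha> \<circ> inv v)) \<longleftrightarrow> w \<circ> v = lookup \<alpha>" for \<alpha>
  proof -
    have "w = lookup \<alpha> \<circ> inv v \<longleftrightarrow> w \<circ> v = lookup \<alpha>"
      using assms by (metis bij_is_inj bij_is_surj comp_assoc comp_id inv_o_cancel surj_iff)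
    then show ?thesis using fin[of \<alpha>] by simp
  qed
  have "act v f = (\<Sum>\<alpha>\<in>keys f. smul (lookup f \<alpha>) (act v (monomial \<alpha>)))"
    by (subst poly_expand) (simp only: act_sum act_smul)
  then have "coef (act v f) w = (\<Sum>\<alpha>\<in>keys f. lookup f \<alpha> * (if w \<circ> v = lookup \<alpha> then 1 else 0))"
    by (simp only: coef_sum coef_smul mono coef_monomial eq)
  then show ?thesis by (simp add: coef_expand[of f "w \<circ> v"])
qed


section \<open>Dunkl operators\<close>

lemma divdiff_eq:
  assumes "i \<noteq> j"
  shows "(X i - X j) * divdiff i j f = f - act (transpose i j) f"
  unfolding divdiff_def by (rule theI'[OF divdiff_ex1[OF assms]])

lemma divdiff_eqI:
  assumes "i \<noteq> j" "(X i - X j) * q = f - act (transpose i j) f"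
  shows "divdiff i j f = q"
  using divdiff_ex1[OF assms(1)] divdiff_eq[OF assms(1)] assms(2) by blast

lemma divdiff_add:
  assumes "i \<noteq> j"
  shows "divdiff i j (f + g) = divdiff i j f + divdiff i j g"
  using assms by (intro divdiff_eqI) (auto simp: distrib_left divdiff_eq act_add)

lemma divdiff_smul:
  assumes "i \<noteq> j"
  shows "divdiff i j (smul c f) = smul c (divdiff i j f)"
  using assms by (intro divdiff_eqI) (auto simp: divdiff_eq act_smul rpoly.scale_right_diff_distrib)

lemma divdiff_swap:
  assumes "i \<noteq> j"
  shows "divdiff i j f = - divdiff j i f"
proof (rule divdiff_eqI[OF assms])
  have "(X i - X j) * - divdiff j i f = (X j - X i) * divdiff j i f"
    by (simp add: algebra_simps)
  then show "(X i - X j) * - divdiff j i f = f - act (transpose i j) f"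
    using assms by (simp add: divdiff_eq transpose_commute)
qed

text \<open>A twisted Leibniz rule, from x_i f - x_j s f = x_i (f - s f) + (x_i - x_j) s f with s =
  (i, j).\<close>

lemma divdiff_X_mult:
  assumes "i \<noteq> j"
  shows "divdiff i j (X i * f) = X i * divdiff i j f + act (transpose i j) f"
proof (rule divdiff_eqI[OF assms])
  have "(X i - X j) * (X i * divdiff i j f) = X i * (f - act (transpose i j) f)"
    using divdiff_eq[OF assms, of f] by (simp add: mult.left_commute)
  then show "(X i - X j) * (X i * divdiff i j f + act (transpose i j) f) = X i * f - act (transpose i j) (X i * f)"
    by (simp add: act_mult algebra_simps)
qed

lemma divdiff_act:
  assumes "bij v" "i \<noteq> j"
  shows "divdiff (v i) (v j) (act v f) = act v (divdiff i j f)"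
proof (rule divdiff_eqI)
  show "v i \<noteq> v j"
    using assms by (metis bij_is_inj injD)
  have "v \<circ> transpose i j = transpose (v i) (v j) \<circ> v"
    using assms(1) by (auto simp: fun_eq_iff transpose_def bij_is_inj inj_eq)
  then have "act v (act (transpose i j) f) = act (transpose (v i) (v j)) (act v f)"
    by (simp add: act_act)
  moreover have "act v ((X i - X j) * divdiff i j f) = act v (f - act (transpose i j) f)"
    using assms by (simp add: divdiff_eq)
  ultimately show "(X (v i) - X (v j)) * act v (divdiff i j f) = act v f - act (transpose (v i) (v j)) (act v f)"
    by (simp add: act_mult act_diff)
qed

lemma partial_deriv_act:
  assumes "bij v"
  shows "partial_deriv (v i) (act v f) = act v (partial_deriv i f)"
proof (rule poly_eqI)
  fix w :: "nat \<Rightarrow> nat"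
  have "w(v i := w (v i) + 1) \<circ> v = (w \<circ> v)(i := w (v i) + 1)"
    using assms by (auto simp: fun_eq_iff bij_is_inj inj_eq)
  then show "coef (partial_deriv (v i) (act v f)) w = coef (act v (partial_deriv i f)) w"
    using assms by (simp add: coef_partial_deriv coef_act)
qed

section \<open>Linearity and equivariance of Dunkl operators, and Jucys-Murphy elements\<close>

lemma dunkl_add: "dunkl N \<kappa> i (f + g) = dunkl N \<kappa> i f + dunkl N \<kappa> i g"
proof -
  have "(\<Sum>j\<in>{1..N} - {i}. divdiff i j (f + g)) =
     (\<Sum>j\<in>{1..N} - {i}. divdiff i j f) + (\<Sum>j\<in>{1..N} - {i}. divdiff i j g)"
    unfolding sum.distrib[symmetric] by (intro sum.cong refl divdiff_add) auto
  then show ?thesis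
    by (simp only: dunkl_def partial_deriv_add rpoly.scale_right_distrib) (simp add: algebra_simps)
qed

lemma dunkl_smul: "dunkl N \<kappa> i (smul c f) = smul c (dunkl N \<kappa> i f)"
proof -
  have "(\<Sum>j\<in>{1..N} - {i}. divdiff i j (smul c f)) = smul c (\<Sum>j\<in>{1..N} - {i}. divdiff i j f)"
    unfolding rpoly.scale_sum_right by (intro sum.cong refl divdiff_smul) auto
  then show ?thesis
    by (simp add: dunkl_def partial_deriv_smul rpoly.scale_right_distrib rpoly.scale_left_commute mult.commute)
qed

lemma dunkl_act:
  assumes "v permutes {1..N}" "i \<in> {1..N}"
  shows "dunkl N \<kappa> (v i) (act v f) = act v (dunkl N \<kappa> i f)"
proof -
  have bij: "bij v" using assms permutes_bij by blast
  have "(\<Sum>j\<in>{1..N} - {v i}. divdiff (v i) j (act v f)) = (\<Sum>j\<in>{1..N} - {i}. divdiff (v i) (v j) (act v f))"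
  proof (rule sum.reindex_bij_betw[symmetric])
    have "v ` ({1..N} - {i}) = {1..N} - {v i}"
      using assms bij by (simp add: image_set_diff bij_is_inj permutes_image)
    then show "bij_betw v ({1..N} - {i}) ({1..N} - {v i})"
      using bij by (metis bij_betw_def bij_is_inj inj_on_subset subset_UNIV)
  qed
  also have "\<dots> = (\<Sum>j\<in>{1..N} - {i}. act v (divdiff i j f))"
    using bij by (intro sum.cong refl divdiff_act) auto
  finally show ?thesis
    using bij by (simp add: dunkl_def partial_deriv_act act_add act_smul act_sum)
qed

lemma dunkl_X_mult:
  assumes "i \<in> {1..N}"
  shows "dunkl N \<kappa> i (X i * f) = X i * dunkl N \<kappa> i f + f + smul \<kappa> (\<Sum>j\<in>{1..N} - {i}. act (transpose i j) f)"
proof -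
  have "(\<Sum>j\<in>{1..N} - {i}. divdiff i j (X i * f)) =
      X i * (\<Sum>j\<in>{1..N} - {i}. divdiff i j f) + (\<Sum>j\<in>{1..N} - {i}. act (transpose i j) f)"
    unfolding sum_distrib_left sum.distrib[symmetric] by (intro sum.cong refl divdiff_X_mult) auto
  then show ?thesis
    by (simp add: dunkl_def partial_deriv_X_mult rpoly.scale_right_distrib distrib_left)
qed

text \<open>The usual elements with the order of the indices reversed: the sum over j > i is what
  remains of \<open>dunkl_U\<close> after its terms with j < i are subtracted.\<close>

definition jucys_murphy :: "nat \<Rightarrow> nat \<Rightarrow> rpoly \<Rightarrow> rpoly" where
  "jucys_murphy N i f = (\<Sum>j\<in>{i<..N}. act (transpose i j) f)"

text \<open>On the kernel of the i-th Dunkl operator, \<open>dunkl_X_mult\<close> leaves f plus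
  \<kappa> times all (i, j) f, and \<open>dunkl_U\<close> removes those with j < i.\<close>

lemma dunkl_U_kernel:
  assumes "i \<in> {1..N}" "dunkl N \<kappa> i f = 0"
  shows "dunkl_U N \<kappa> i f = f + smul \<kappa> (jucys_murphy N i f)"
proof -
  have "{1..N} - {i} = {1..<i} \<union> {i<..N}" "{1..<i} \<inter> {i<..N} = {}"
    using assms by auto
  then have "(\<Sum>j\<in>{1..N} - {i}. act (transpose i j) f) = (\<Sum>j=1..<i. act (transpose j i) f) + jucys_murphy N i f"
    by (simp add: sum.union_disjoint jucys_murphy_def transpose_commute)
  then show ?thesis
    using assms by (simp add: dunkl_U_def dunkl_X_mult rpoly.scale_right_distrib)
qed

text \<open>Compares the coefficients of x_i times the monomial of \<open>w\<close> in the equation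
  defining the divided difference. The recursion moves units from \<open>j\<close> to
  \<open>i\<close> and stops when the exponent of x_j is 0.\<close>

lemma coef_divdiff_rec:
  assumes "i \<noteq> j"
  shows "coef (divdiff i j f) w = coef f (w(i := w i + 1)) - coef f (w(i := w i + 1) \<circ> transpose i j)
    + (if w j = 0 then 0 else coef (divdiff i j f) (w(i := w i + 1, j := w j - 1)))"
proof -
  have "coef ((X i - X j) * divdiff i j f) (w(i := w i + 1)) =
      coef (f - act (transpose i j) f) (w(i := w i + 1))"
    using assms by (simp add: divdiff_eq)
  then show ?thesis
    using assms by (simp add: left_diff_distrib coef_X_mult coef_act split: if_splits)
qed

text \<open>Unrolling the recursion meets only the coefficients listed in the hypotheses.\<close>

lemma coef_divdiff_eq_0:
  assumes "i \<noteq> j"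
    and "\<And>s. s \<le> w j \<Longrightarrow> coef f (w(i := w i + 1 + s, j := w j - s)) = 0"
    and "\<And>s. s \<le> w j \<Longrightarrow> coef f (w(i := w i + 1 + s, j := w j - s) \<circ> transpose i j) = 0"
  shows "coef (divdiff i j f) w = 0"
  using assms
proof (induction "w j" arbitrary: w)
  case 0
  have *: "w(i := w i + 1 + 0, j := w j - 0) = w(i := w i + 1)"
    using assms(1) by (auto simp: fun_eq_iff)
  have "coef f (w(i := w i + 1)) = 0" "coef f (w(i := w i + 1) \<circ> transpose i j) = 0"
    using "0.prems"(2,3)[of 0] by (metis * le0)+
  then show ?case
    using coef_divdiff_rec[OF assms(1), of f w] "0.hyps" by simp
next
  case (Suc k)
  let ?w = "w(i := w i + 1, j := w j - 1)"
  have "coef (divdiff i j f) ?w = 0"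
  proof (rule Suc.hyps(1))
    show "k = ?w j" using Suc.hyps(2) by simp
    fix s assume s: "s \<le> ?w j"
    have *: "?w(i := ?w i + 1 + s, j := ?w j - s) = w(i := w i + 1 + Suc s, j := w j - Suc s)"
      using assms(1) by (auto simp: fun_eq_iff)
    show "coef f (?w(i := ?w i + 1 + s, j := ?w j - s)) = 0"
      "coef f (?w(i := ?w i + 1 + s, j := ?w j - s) \<circ> transpose i j) = 0"
      unfolding * using Suc.prems(2,3)[of "Suc s"] s Suc.hyps(2) by auto
  qed (rule assms(1))
  moreover have *: "w(i := w i + 1 + 0, j := w j - 0) = w(i := w i + 1)"
    using assms(1) by (auto simp: fun_eq_iff)
  have "coef f (w(i := w i + 1)) = 0" "coef f (w(i := w i + 1) \<circ> transpose i j) = 0"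
    using Suc.prems(2,3)[of 0] by (metis * le0)+
  ultimately show ?case
    using coef_divdiff_rec[OF assms(1), of f w] by simp
qed


section \<open>Heights and the top-degree equations\<close>

definition spread :: "nat \<Rightarrow> (nat \<Rightarrow> nat) \<Rightarrow> (nat \<Rightarrow> nat) \<Rightarrow> bool" where
  "spread N w w' \<longleftrightarrow> (\<exists>i j s. i \<in> {1..N} \<and> j \<in> {1..N} \<and> i \<noteq> j \<and> 1 \<le> s \<and> s \<le> w j \<and> w j \<le> w i \<and>
      w' = w(i := w i + s, j := w j - s))"

text \<open>An abstract order parameter: besides permutations of \<open>w\<close>, the exponents
  that divided differences relate to \<open>w\<close> are spreads of \<open>w\<close> up to
  permutation, hence strictly higher. Several heights are used, all leading to the same
  exponent.\<close>

definition height :: "nat \<Rightarrow> ((nat \<Rightarrow> nat) \<Rightarrow> nat) \<Rightarrow> bool" where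
  "height N h \<longleftrightarrow> (\<forall>w v. v permutes {1..N} \<longrightarrow> h (w \<circ> v) = h w) \<and> (\<forall>w w'. spread N w w' \<longrightarrow> h w < h w')"

lemma height_transpose:
  assumes "height N h" "i \<in> {1..N}" "j \<in> {1..N}"
  shows "h (w \<circ> transpose i j) = h w"
  using assms permutes_swap_id[of i "{1..N}" j] by (simp add: height_def)

text \<open>Only j with w j < w i contribute to the coefficient of x^w/x_i in the Dunkl operator:
  all other coefficients of \<open>f\<close> that enter belong to spreads of \<open>w\<close> or
  their transposes and vanish by maximality of the height.\<close>

lemma star_top:
  assumes i: "i \<in> {1..N}" and sing: "dunkl N \<kappa> i f = 0"
    and h: "height N h" and top: "\<And>\<beta>. h w < h \<beta> \<Longrightarrow> coef f \<beta> = 0"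
  shows "(of_nat (w i) + \<kappa> * of_nat (card {j\<in>{1..N}. w j < w i})) * coef f w =
     \<kappa> * (\<Sum>j\<in>{j\<in>{1..N}. w j < w i}. coef f (w \<circ> transpose i j))"
proof (cases "w i = 0")
  case False
  define u where "u = w(i := w i - 1)"
  have zero: "coef f (w(p := w p + Suc s, q := w q - Suc s)) = 0"
    "coef f (w(p := w p + Suc s, q := w q - Suc s) \<circ> transpose p q) = 0"
    if "p \<in> {1..N}" "q \<in> {1..N}" "p \<noteq> q" "Suc s \<le> w q" "w q \<le> w p" for p q s
  proof -
    have "spread N w (w(p := w p + Suc s, q := w q - Suc s))"
      unfolding spread_def using that by (intro exI[of _ p] exI[of _ q] exI[of _ "Suc s"]) simp
    then have "h w < h (w(p := w p + Suc s, q := w q - Suc s))"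
      using h by (simp add: height_def)
    then show "coef f (w(p := w p + Suc s, q := w q - Suc s)) = 0"
      "coef f (w(p := w p + Suc s, q := w q - Suc s) \<circ> transpose p q) = 0"
      using top height_transpose[OF h that(1,2), of "w(p := w p + Suc s, q := w q - Suc s)"] by auto
  qed
  have dd: "coef (divdiff i j f) u = (if w j < w i then coef f w - coef f (w \<circ> transpose i j) else 0)"
    if j: "j \<in> {1..N} - {i}" for j
  proof (cases "w j \<le> w i")
    case True
    have ij: "i \<noteq> j" using j by auto
    have w: "u(i := u i + 1) = w"
      using False by (auto simp: u_def fun_eq_iff)
    have uj: "u j = w j" using ij by (simp add: u_def)
    have z: "coef (divdiff i j f) (u(i := u i + 1, j := u j - 1)) = 0" if "w j \<noteq> 0"
      unfolding w uj
    proof (rule coef_divdiff_eq_0[OF ij])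
      fix s assume s: "s \<le> (w(j := w j - 1)) j"
      have *: "(w(j := w j - 1))(i := (w(j := w j - 1)) i + 1 + s, j := (w(j := w j - 1)) j - s)
          = w(i := w i + Suc s, j := w j - Suc s)"
        using ij by (auto simp: fun_eq_iff)
      have "Suc s \<le> w j" using s that by simp
      from zero[OF i _ ij this True] j
      show "coef f ((w(j := w j - 1))(i := (w(j := w j - 1)) i + 1 + s, j := (w(j := w j - 1)) j - s)) = 0"
        "coef f ((w(j := w j - 1))(i := (w(j := w j - 1)) i + 1 + s, j := (w(j := w j - 1)) j - s) \<circ> transpose i j) = 0"
        unfolding * by auto
    qed
    have "coef (divdiff i j f) u = coef f w - coef f (w \<circ> transpose i j)"
      using coef_divdiff_rec[OF ij, of f u] z unfolding w uj by (simp split: if_splits)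
    \<comment> \<open>For equal letters the two remaining coefficients cancel.\<close>
    moreover have "w \<circ> transpose i j = w" if "w i = w j"
      using that by (auto simp: fun_eq_iff transpose_def)
    ultimately show ?thesis using True by auto
  next
    case gr: False
    have ij: "i \<noteq> j" using j by auto
    \<comment> \<open>With the larger letter at \<open>j\<close>, the recursion is run for the
      swapped pair, so that units move from \<open>i\<close> to \<open>j\<close> and every word met
      is a spread of \<open>w\<close> or its transpose.\<close>
    have "coef (divdiff j i f) u = 0"
    proof (rule coef_divdiff_eq_0)
      fix s assume s: "s \<le> u i"
      have *: "u(j := u j + 1 + s, i := u i - s) = w(j := w j + Suc s, i := w i - Suc s)"
        using ij by (auto simp: u_def fun_eq_iff)
      have "Suc s \<le> w i" using s False by (simp add: u_def)
      from zero[of j i, OF _ i _ this] j gr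
      show "coef f (u(j := u j + 1 + s, i := u i - s)) = 0"
        "coef f (u(j := u j + 1 + s, i := u i - s) \<circ> transpose j i) = 0"
        unfolding * by auto
    qed (use ij in auto)
    then show ?thesis using gr divdiff_swap[OF ij] by simp
  qed
  have w: "u(i := u i + 1) = w" "u i + 1 = w i"
    using False by (auto simp: u_def fun_eq_iff)
  have "0 = coef (dunkl N \<kappa> i f) u" by (simp add: sing)
  also have "\<dots> = of_nat (w i) * coef f w + \<kappa> * (\<Sum>j\<in>{1..N} - {i}. coef (divdiff i j f) u)"
    unfolding dunkl_def coef_add coef_smul coef_sum coef_partial_deriv
    unfolding w(1) unfolding w(2) by simp
  also have "(\<Sum>j\<in>{1..N} - {i}. coef (divdiff i j f) u) =
      (\<Sum>j\<in>{1..N} - {i}. if w j < w i then coef f w - coef f (w \<circ> transpose i j) else 0)"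
    using dd by (intro sum.cong refl)
  also have "\<dots> = (\<Sum>j\<in>{j\<in>{1..N}. w j < w i}. coef f w - coef f (w \<circ> transpose i j))"
    by (intro sum.mono_neutral_cong_right) auto
  finally show ?thesis
    by (simp add: sum_subtractf algebra_simps)
next
  case True
  then show ?thesis by simp
qed

section \<open>Two heights: sums of squares and weighted sums of the largest entries\<close>

definition sumsq :: "nat \<Rightarrow> (nat \<Rightarrow> nat) \<Rightarrow> nat" where
  "sumsq N w = (\<Sum>i=1..N. (w i)\<^sup>2)"

text \<open>The sum of the k largest entries, written without sorting. For k > N the maximum would
  be over the empty set, hence the hypotheses k \<le> N below.\<close>

definition topsum :: "nat \<Rightarrow> nat \<Rightarrow> (nat \<Rightarrow> nat) \<Rightarrow> nat" where
  "topsum N k w = Max {sum w S | S. S \<subseteq> {1..N} \<and> card S = k}"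

lemma sumsq_permute: "v permutes {1..N} \<Longrightarrow> sumsq N (w \<circ> v) = sumsq N w"
  unfolding sumsq_def using sum.permute[of v "{1..N}" "\<lambda>i. (w i)\<^sup>2"] by (simp add: comp_def)

lemma sumsq_spread:
  assumes "spread N w w'" shows "sumsq N w < sumsq N w'"
proof -
  obtain i j s where *: "i \<in> {1..N}" "j \<in> {1..N}" "i \<noteq> j" "1 \<le> s" "s \<le> w j" "w j \<le> w i"
      "w' = w(i := w i + s, j := w j - s)"
    using assms by (auto simp: spread_def)
  have split: "sumsq N v = (\<Sum>k\<in>{1..N} - {i} - {j}. (v k)\<^sup>2) + (v i)\<^sup>2 + (v j)\<^sup>2" for v
    using * unfolding sumsq_def by (subst sum.remove[of _ i], simp, simp, subst sum.remove[of _ j], auto)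
  have "(\<Sum>k\<in>{1..N} - {i} - {j}. (w' k)\<^sup>2) = (\<Sum>k\<in>{1..N} - {i} - {j}. (w k)\<^sup>2)"
    using * by (intro sum.cong) auto
  moreover have "(w i)\<^sup>2 + (w j)\<^sup>2 < (w i + s)\<^sup>2 + (w j - s)\<^sup>2"
  proof -
    obtain b where b: "w j = b + s" using \<open>s \<le> w j\<close> by (metis add.commute le_Suc_ex)
    have "(w i)\<^sup>2 + (b + s)\<^sup>2 = (w i)\<^sup>2 + b\<^sup>2 + 2 * s * b + s\<^sup>2"
      by (simp add: power2_eq_square algebra_simps)
    also have "\<dots> < (w i)\<^sup>2 + b\<^sup>2 + 2 * s * w i + s\<^sup>2"
      using * b by simp
    also have "\<dots> = (w i + s)\<^sup>2 + b\<^sup>2"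
      by (simp add: power2_eq_square algebra_simps)
    finally show ?thesis by (simp add: b)
  qed
  ultimately show ?thesis
    using * by (simp add: split)
qed

lemma height_sumsq: "height N (sumsq N)"
  by (simp add: height_def sumsq_permute sumsq_spread)

lemma finite_subset_sums: "finite {sum (w :: nat \<Rightarrow> nat) S | S. S \<subseteq> {1..N} \<and> card S = k}"
proof -
  have "{sum w S | S. S \<subseteq> {1..N} \<and> card S = k} \<subseteq> sum w ` Pow {1..N}"
    by auto
  then show ?thesis by (rule finite_subset) simp
qed

lemma topsum_ge: "S \<subseteq> {1..N} \<Longrightarrow> card S = k \<Longrightarrow> sum w S \<le> topsum N k w"
  for w :: "nat \<Rightarrow> nat"
  unfolding topsum_def by (rule Max_ge[OF finite_subset_sums]) auto

lemma topsum_le: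
  assumes "k \<le> N" "\<And>S. S \<subseteq> {1..N} \<Longrightarrow> card S = k \<Longrightarrow> sum w S \<le> b"
  shows "topsum N k w \<le> b"
proof -
  have "{1..k} \<subseteq> {1..N}" "card {1..k} = k" using assms(1) by auto
  then have "{sum w S | S. S \<subseteq> {1..N} \<and> card S = k} \<noteq> {}" by blast
  then show ?thesis
    unfolding topsum_def using finite_subset_sums assms(2) by (subst Max_le_iff) auto
qed

lemma topsum_permute_le:
  assumes "k \<le> N" "v permutes {1..N}"
  shows "topsum N k (w \<circ> v) \<le> topsum N k w"
proof (rule topsum_le[OF assms(1)])
  fix S assume S: "S \<subseteq> {1..N}" "card S = k"
  have "inj_on v S" using assms(2) permutes_inj_on by blast
  then have "sum (w \<circ> v) S = sum w (v ` S)" "card (v ` S) = k"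
    using S by (simp_all add: sum.reindex card_image)
  moreover have "v ` S \<subseteq> {1..N}"
    using S assms(2) by (metis image_mono permutes_image)
  ultimately show "sum (w \<circ> v) S \<le> topsum N k w"
    using topsum_ge by metis
qed

lemma topsum_permute:
  assumes "k \<le> N" "v permutes {1..N}"
  shows "topsum N k (w \<circ> v) = topsum N k w"
proof (rule antisym)
  have "topsum N k ((w \<circ> v) \<circ> inv v) \<le> topsum N k (w \<circ> v)"
    using assms by (intro topsum_permute_le permutes_inv)
  then show "topsum N k w \<le> topsum N k (w \<circ> v)"
    using assms by (simp add: comp_assoc permutes_inv_o)
qed (rule topsum_permute_le[OF assms])

text \<open>A subset that contains the losing position \<open>j\<close> but not the gaining position
  \<open>i\<close> is changed by putting \<open>i\<close> in place of \<open>j\<close>; on any other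
  subset the sum does not decrease.\<close>

lemma topsum_spread:
  assumes "k \<le> N" "spread N w w'"
  shows "topsum N k w \<le> topsum N k w'"
proof (rule topsum_le[OF assms(1)])
  obtain i j s where *: "i \<in> {1..N}" "j \<in> {1..N}" "i \<noteq> j" "1 \<le> s" "s \<le> w j" "w j \<le> w i"
      "w' = w(i := w i + s, j := w j - s)"
    using assms by (auto simp: spread_def)
  fix S assume S: "S \<subseteq> {1..N}" "card S = k"
  then have fin: "finite S" using finite_subset by blast
  have rest: "sum w' (S - {i} - {j}) = sum w (S - {i} - {j})"
    using * by (intro sum.cong) auto
  have split: "sum v S = sum v (S - {i} - {j}) + (if i \<in> S then v i else 0) + (if j \<in> S then v j else 0)"
    for v :: "nat \<Rightarrow> nat"
  proof -
    have "sum v S = sum v (S - {i}) + (if i \<in> S then v i else 0)"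
      using fin by (simp add: sum.remove[of S i])
    moreover have "sum v (S - {i}) = sum v (S - {i} - {j}) + (if j \<in> S then v j else 0)"
      using fin * by (simp add: sum.remove[of "S - {i}" j])
    ultimately show ?thesis by simp
  qed
  show "sum w S \<le> topsum N k w'"
  proof (cases "j \<in> S \<and> i \<notin> S")
    case False
    then have "sum w S \<le> sum w' S"
      using * split[of w] split[of w'] rest by auto
    also have "\<dots> \<le> topsum N k w'" using S by (rule topsum_ge)
    finally show ?thesis .
  next
    case True
    let ?S = "insert i (S - {j})"
    have "card ?S = k"
      using True S fin by (metis Diff_iff card_Suc_Diff1 card_insert_disjoint finite_Diff)
    moreover have "?S \<subseteq> {1..N}" using S * by auto
    ultimately have "sum w' ?S \<le> topsum N k w'" using topsum_ge by blast
    moreover have "S - {i} - {j} = S - {j}" using True by auto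
    then have "sum w S = sum w' (S - {j}) + w j"
      using split[of w] rest True by simp
    then have "sum w S \<le> sum w' ?S"
      using True fin * by simp
    ultimately show ?thesis by simp
  qed
qed

text \<open>Spreading increases \<open>topsum\<close> only weakly; adding \<open>sumsq\<close> makes
  the growth strict, while a large \<open>B\<close> keeps \<open>topsum\<close> decisive.\<close>

lemma height_topsum:
  assumes "k \<le> N"
  shows "height N (\<lambda>w. B * topsum N k w + sumsq N w)"
  unfolding height_def
proof (intro conjI allI impI)
  fix w w' assume "spread N w w'"
  then show "B * topsum N k w + sumsq N w < B * topsum N k w' + sumsq N w'"
    using topsum_spread[OF assms] sumsq_spread by (intro add_le_less_mono mult_le_mono2)
next
  fix w v :: "nat \<Rightarrow> nat" assume "v permutes {1..N}"
  then show "B * topsum N k (w \<circ> v) + sumsq N (w \<circ> v) = B * topsum N k w + sumsq N w"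
    by (simp only: topsum_permute[OF assms] sumsq_permute)
qed


section \<open>Dominance and leading forms\<close>

definition words :: "nat \<Rightarrow> (nat \<Rightarrow> nat) set" where
  "words N = {w. \<forall>i. i \<notin> {1..N} \<longrightarrow> w i = 0}"

lemma words_expos: "lookup \<alpha> \<in> words N \<longleftrightarrow> \<alpha> \<in> expos N"
  by (auto simp: words_def expos_def in_keys_iff)

text \<open>T and the initial segment have equally many elements outside each other; on those of T
  the values are at most \<open>x k\<close>, on the others at least \<open>x k\<close>.\<close>

lemma sum_le_initial_sum:
  fixes x :: "nat \<Rightarrow> nat"
  assumes anti: "\<And>i j. i \<le> j \<Longrightarrow> j < N \<Longrightarrow> x j \<le> x i" and T: "T \<subseteq> {..<N}" "card T = k"
  shows "sum x T \<le> sum x {..<k}"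
proof -
  let ?K = "{..<k}"
  have fin: "finite T" using T finite_subset by blast
  have c: "card (T - ?K) = card (?K - T)"
    using T fin by (simp add: card_Diff_subset_Int Int_commute[of ?K T])
  have "sum x (T - ?K) \<le> of_nat (card (T - ?K)) * x k"
    using anti T by (intro sum_bounded_above) auto
  \<comment> \<open>An element of T beyond the segment ensures k < N, so that \<open>x k\<close> may
    be compared.\<close>
  moreover have "of_nat (card (?K - T)) * x k \<le> sum x (?K - T)" if "T - ?K \<noteq> {}"
  proof (rule sum_bounded_below)
    obtain b where "b \<in> T - ?K" using \<open>T - ?K \<noteq> {}\<close> by blast
    then have "k \<le> b" "b < N" using T(1) by auto
    then show "x k \<le> x i" if "i \<in> ?K - T" for i
      using that by (intro anti) auto
  qed
  ultimately have "sum x (T - ?K) \<le> sum x (?K - T)"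
    using c by (cases "T - ?K = {}") auto
  moreover have "sum x T = sum x (T \<inter> ?K) + sum x (T - ?K)" "sum x ?K = sum x (T \<inter> ?K) + sum x (?K - T)"
    using fin sum.Int_Diff[of T x ?K] sum.Int_Diff[of ?K x T] by (simp_all add: Int_commute[of ?K T])
  ultimately show ?thesis by simp
qed

text \<open>The first k sorted entries are the entries on some k-subset, and
  \<open>sum_le_initial_sum\<close> shows that no k-subset does better. The shifts by one reconcile
  lists indexed from 0 with positions from 1.\<close>

lemma sum_rearranged:
  assumes "k \<le> N"
  shows "(\<Sum>i=1..k. rearranged N \<alpha> i) = topsum N k (lookup \<alpha>)"
proof -
  let ?ys = "map (lookup \<alpha>) [1..<N + 1]"
  define xs where "xs = rev (sort ?ys)"
  have len: "length xs = N" "length ?ys = N" by (simp_all add: xs_def)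
  obtain p where p: "p permutes {..<N}" "permute_list p ?ys = xs"
    using mset_eq_permutation[of xs ?ys] len by (metis xs_def mset_rev mset_sort)
  have xs: "xs ! i = lookup \<alpha> (Suc (p i))" if "i < N" for i
  proof -
    have "xs ! i = ?ys ! p i"
      using permute_list_nth[of p ?ys i] p that len by simp
    moreover have "p i < N" using p that by (metis lessThan_iff permutes_in_image)
    ultimately show ?thesis by (simp del: upt_Suc)
  qed
  have anti: "xs ! j \<le> xs ! i" if "i \<le> j" "j < N" for i j
    using that len sorted_rev_nth_mono[of xs i j] by (simp add: xs_def)
  have re: "(\<Sum>i=1..k. rearranged N \<alpha> i) = (\<Sum>i<k. xs ! i)"
    by (rule sum.reindex_bij_witness[where i = Suc and j = "\<lambda>i. i - 1"]) (auto simp: rearranged_def xs_def)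
  show ?thesis
  proof (rule antisym)
    have inj: "inj_on (\<lambda>i. Suc (p i)) {..<k}"
      by (rule inj_onI) (simp add: inj_eq[OF permutes_inj[OF p(1)]])
    have "(\<Sum>i<k. xs ! i) = (\<Sum>i<k. lookup \<alpha> (Suc (p i)))"
      using xs assms by (intro sum.cong) auto
    also have "\<dots> = sum (lookup \<alpha>) ((\<lambda>i. Suc (p i)) ` {..<k})"
      using inj by (simp add: sum.reindex)
    also have "\<dots> \<le> topsum N k (lookup \<alpha>)"
    proof (rule topsum_ge)
      show "(\<lambda>i. Suc (p i)) ` {..<k} \<subseteq> {1..N}"
        using assms permutes_in_image[OF p(1)] by (fastforce simp: Suc_le_eq)
    qed (use inj in \<open>simp add: card_image\<close>)
    finally show "(\<Sum>i=1..k. rearranged N \<alpha> i) \<le> topsum N k (lookup \<alpha>)" using re by simp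
    show "topsum N k (lookup \<alpha>) \<le> (\<Sum>i=1..k. rearranged N \<alpha> i)"
    proof (rule topsum_le[OF assms])
      fix S assume S: "S \<subseteq> {1..N}" "card S = k"
      \<comment> \<open>The places of the entries of \<open>S\<close> in the sorted list.\<close>
      define T where "T = (\<lambda>i. inv p (i - 1)) ` S"
      have inj: "inj_on (\<lambda>i. inv p (i - 1)) S"
      proof (rule inj_onI)
        fix x y assume "x \<in> S" "y \<in> S" "inv p (x - 1) = inv p (y - 1)"
        moreover have "inj (inv p)" using p(1) by (metis permutes_inj permutes_inv)
        ultimately have "x - 1 = y - 1" by (simp add: inj_eq)
        moreover have "1 \<le> x" "1 \<le> y" using S \<open>x \<in> S\<close> \<open>y \<in> S\<close> by auto
        ultimately show "x = y" by simp
      qed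
      have "inv p (i - 1) < N" if "i \<in> S" for i
      proof -
        have "i - 1 \<in> {..<N}" using S that by fastforce
        then show ?thesis using permutes_in_image[OF permutes_inv[OF p(1)]] by blast
      qed
      then have T: "T \<subseteq> {..<N}" "card T = k"
        using S inj by (auto simp: T_def card_image)
      have "sum (\<lambda>i. xs ! i) T = (\<Sum>i\<in>S. xs ! (inv p (i - 1)))"
        using inj by (simp add: T_def sum.reindex)
      also have "\<dots> = sum (lookup \<alpha>) S"
      proof (rule sum.cong[OF refl])
        fix i assume i: "i \<in> S"
        then have "inv p (i - 1) < N" using T by (auto simp: T_def)
        then have "xs ! (inv p (i - 1)) = lookup \<alpha> (Suc (p (inv p (i - 1))))" by (rule xs)
        also have "p (inv p (i - 1)) = i - 1" using p(1) by (metis permutes_inverses(1))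
        finally show "xs ! (inv p (i - 1)) = lookup \<alpha> i" using i S by auto
      qed
      finally have "sum (lookup \<alpha>) S = sum (\<lambda>i. xs ! i) T" by simp
      also have "\<dots> \<le> (\<Sum>i<k. xs ! i)"
        using anti T by (intro sum_le_initial_sum) auto
      finally show "sum (lookup \<alpha>) S \<le> (\<Sum>i=1..k. rearranged N \<alpha> i)" using re by simp
    qed
  qed
qed

lemma rearranged_partition:
  assumes "is_partition N lam" "i \<in> {1..N}"
  shows "rearranged N lam i = lookup lam i"
proof -
  have "sort (map (lookup lam) [1..<N + 1]) = rev (map (lookup lam) [1..<N + 1])"
  proof (rule properties_for_sort)
    show "sorted (rev (map (lookup lam) [1..<N + 1]))"
      unfolding sorted_iff_nth_mono
    proof (intro allI impI)
      fix i j assume ij: "i \<le> j" "j < length (rev (map (lookup lam) [1..<N + 1]))"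
      then have "1 \<le> N - j \<and> N - j \<le> N - i \<and> N - i \<le> N"
        by (auto simp del: upt_Suc)
      then have "lookup lam (N - i) \<le> lookup lam (N - j)"
        using assms(1) unfolding is_partition_def by blast
      then show "rev (map (lookup lam) [1..<N + 1]) ! i \<le> rev (map (lookup lam) [1..<N + 1]) ! j"
        using ij by (simp add: rev_nth Suc_diff_Suc del: upt_Suc)
    qed
  qed simp
  moreover have "map (lookup lam) [1..<N + 1] ! (i - 1) = lookup lam i"
    using assms(2) by (subst nth_map) (auto simp del: upt_Suc)
  ultimately show ?thesis
    by (simp add: rearranged_def del: upt_Suc)
qed

text \<open>If the rearrangements differ, the comparison of \<open>topsum\<close> is dominance
  between them. If they agree, an initial sum of \<beta> is at most the corresponding
  \<open>topsum\<close>, which for the partition \<open>lam\<close> is its own initial sum.\<close>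

lemma below_if_topsum_le:
  assumes lam: "is_partition N lam" and \<beta>: "\<beta> \<in> expos N" "\<beta> \<noteq> lam" "weight N \<beta> = weight N lam"
    and le: "\<And>k. k \<le> N \<Longrightarrow> topsum N k (lookup \<beta>) \<le> topsum N k (lookup lam)"
  shows "below N \<beta> lam"
proof (cases "\<forall>i\<in>{1..N}. rearranged N lam i = rearranged N \<beta> i")
  case False
  then show ?thesis
    using \<beta> le by (auto simp: below_def dominates_def sum_rearranged[symmetric])
next
  case True
  have "\<exists>i\<in>{1..N}. lookup lam i \<noteq> lookup \<beta> i"
  proof (rule ccontr)
    assume "\<not> ?thesis"
    moreover have "lam \<in> expos N" using lam by (simp add: is_partition_def)
    moreover have "lookup \<beta> i = 0 \<and> lookup lam i = 0" if "i \<notin> {1..N}" for i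
      using that \<beta>(1) \<open>lam \<in> expos N\<close> words_expos[of \<beta> N] words_expos[of lam N] by (simp add: words_def)
    ultimately have "lookup \<beta> i = lookup lam i" for i
      by metis
    then show False using \<beta>(2) by (simp add: poly_mapping_eqI)
  qed
  moreover have "(\<Sum>i=1..j. lookup \<beta> i) \<le> (\<Sum>i=1..j. lookup lam i)" if j: "j \<in> {1..N}" for j
  proof -
    have "(\<Sum>i=1..j. lookup \<beta> i) \<le> topsum N j (lookup \<beta>)"
      using j by (intro topsum_ge) auto
    also have "\<dots> \<le> topsum N j (lookup lam)" using le j by simp
    also have "\<dots> = (\<Sum>i=1..j. rearranged N lam i)" using j by (subst sum_rearranged) auto
    also have "\<dots> = (\<Sum>i=1..j. lookup lam i)"
      using j lam by (intro sum.cong refl rearranged_partition) auto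
    finally show ?thesis .
  qed
  ultimately show ?thesis
    using True \<beta> by (auto simp: below_def dominates_def)
qed

section \<open>Leading forms read off from coefficients\<close>

lemma not_below_self: "\<not> below N \<alpha> \<alpha>"
  by (simp add: below_def dominates_def)

lemma leading_form_lookup:
  assumes "has_leading_form N \<alpha> g"
  shows "lookup g \<alpha> = 1"
proof -
  obtain A where A: "g = monomial \<alpha> + (\<Sum>\<beta>\<in>{\<beta>\<in>expos N. below N \<beta> \<alpha>}. smul (A \<beta>) (monomial \<beta>))"
    using assms by (auto simp: has_leading_form_def)
  have "(\<Sum>\<beta>\<in>{\<beta>\<in>expos N. below N \<beta> \<alpha>}. A \<beta> * lookup (monomial \<beta>) \<alpha>) = 0"
    using not_below_self[of N \<alpha>] by (intro sum.neutral) (auto simp: monomial_def lookup_single when_def)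
  then show ?thesis
    by (simp add: A lookup_add lookup_sum) (simp add: monomial_def)
qed

lemma leading_formI:
  assumes "g \<in> polys N" "lookup g \<alpha> = 1" "\<And>\<beta>. \<beta> \<in> keys g \<Longrightarrow> \<beta> \<noteq> \<alpha> \<Longrightarrow> below N \<beta> \<alpha>"
  shows "has_leading_form N \<alpha> g"
  unfolding has_leading_form_def
proof (intro exI poly_mapping_eqI)
  fix \<gamma>
  let ?B = "{\<beta>\<in>expos N. below N \<beta> \<alpha>}"
  have "lookup (monomial \<alpha> + (\<Sum>\<beta>\<in>?B. smul (lookup g \<beta>) (monomial \<beta>))) \<gamma> =
      (if \<gamma> = \<alpha> then 1 else 0) + (\<Sum>\<beta>\<in>?B. if \<beta> = \<gamma> then lookup g \<beta> else 0)"
    by (auto simp: lookup_add lookup_sum monomial_def lookup_single when_def intro!: sum.cong)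
  also have "\<dots> = (if \<gamma> = \<alpha> then 1 else 0) + (if \<gamma> \<in> ?B then lookup g \<gamma> else 0)"
    using finite_below[of N \<alpha>] by simp
  also have "\<dots> = lookup g \<gamma>"
  proof (cases "\<gamma> = \<alpha>")
    case False
    then show ?thesis
      using assms(1,3) by (auto simp: polys_def in_keys_iff)
  qed (use not_below_self assms(2) in auto)
  finally show "lookup g \<gamma> = lookup (monomial \<alpha> + (\<Sum>\<beta>\<in>?B. smul (lookup g \<beta>) (monomial \<beta>))) \<gamma>"
    by simp
qed


section \<open>Comparing row words\<close>

lemma sum_lessThan_card_le:
  fixes A :: "nat set"
  assumes "finite A"
  shows "(\<Sum>k<card A. k) \<le> \<Sum>A"
  using assms
proof (induction A rule: finite_linorder_max_induct)
  case (insert b A)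
  then have "A \<subseteq> {..<b}" by auto
  then have "card A \<le> b" using card_mono[of "{..<b}" A] by simp
  moreover have "b \<notin> A" using insert by auto
  ultimately show ?case using insert by simp
qed simp

lemma sum_card_fibre:
  fixes g :: "nat \<Rightarrow> int"
  assumes "finite I" "\<And>i. i \<in> I \<Longrightarrow> x i < L"
  shows "(\<Sum>i\<in>I. g (x i)) = (\<Sum>k<L. int (card {i\<in>I. x i = k}) * g k)"
proof -
  have "(\<Sum>i\<in>I. g (x i)) = (\<Sum>k<L. \<Sum>i\<in>{i\<in>I. x i = k}. g (x i))"
    using assms by (intro sum.group[symmetric]) auto
  then show ?thesis by simp
qed

text \<open>Every ordered pair of positions is increasing, decreasing or tied, and the first two
  kinds are equally many.\<close>

lemma sum_card_less:
  fixes x :: "'a \<Rightarrow> nat"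
  assumes "finite I"
  shows "2 * (\<Sum>i\<in>I. card {j\<in>I. x j < x i}) + (\<Sum>i\<in>I. card {j\<in>I. x j = x i}) = card I * card I"
proof -
  have "(\<Sum>i\<in>I. card {j\<in>I. x j < x i}) = (\<Sum>i\<in>I. \<Sum>j\<in>I. if x j < x i then 1 else 0)"
    using assms by (simp add: sum.If_cases Int_def)
  also have "\<dots> = (\<Sum>j\<in>I. \<Sum>i\<in>I. if x j < x i then 1 else 0)"
    by (rule sum.swap)
  also have "\<dots> = (\<Sum>i\<in>I. card {j\<in>I. x i < x j})"
    using assms by (simp add: sum.If_cases Int_def)
  finally have swap: "(\<Sum>i\<in>I. card {j\<in>I. x j < x i}) = (\<Sum>i\<in>I. card {j\<in>I. x i < x j})" .
  have "card {j\<in>I. x j < x i} + card {j\<in>I. x i < x j} + card {j\<in>I. x j = x i} = card I" for i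
  proof -
    have "I = {j\<in>I. x j < x i} \<union> {j\<in>I. x i < x j} \<union> {j\<in>I. x j = x i}" by auto
    also have "card \<dots> = card ({j\<in>I. x j < x i} \<union> {j\<in>I. x i < x j}) + card {j\<in>I. x j = x i}"
      using assms by (intro card_Un_disjoint) auto
    also have "card ({j\<in>I. x j < x i} \<union> {j\<in>I. x i < x j}) = card {j\<in>I. x j < x i} + card {j\<in>I. x i < x j}"
      using assms by (intro card_Un_disjoint) auto
    finally show ?thesis by simp
  qed
  then have "(\<Sum>i\<in>I. card {j\<in>I. x j < x i} + card {j\<in>I. x i < x j} + card {j\<in>I. x j = x i}) = (\<Sum>i\<in>I. card I)"
    by simp
  then show ?thesis using swap by (simp add: sum.distrib)
qed

lemma pointwise_eq_if_sum_le:
  fixes x t :: "'a \<Rightarrow> nat"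
  assumes "finite I" "\<And>i. i \<in> I \<Longrightarrow> x i \<le> t i" "sum t I \<le> sum x I" "i \<in> I"
  shows "x i = t i"
proof (rule ccontr)
  assume "x i \<noteq> t i"
  then have "sum x I < sum t I"
    using assms by (intro sum_strict_mono_ex1) (auto intro!: bexI[of _ i] simp: order_neq_le_trans)
  then show False using assms(3) by simp
qed

text \<open>Since the fibres of \<open>t\<close> shrink with the row, moving entries to lower rows
  gives nt.nt \<le> nx.nt for the vectors of fibre sizes, hence nt.nt \<le> nx.nx. So
  \<open>x\<close> has at least as many tied pairs, and therefore at most as many strict ones; the
  degree hypothesis then leaves no room in the sum of \<open>x\<close>.\<close>

lemma pointwise_eq_if_degree_le:
  fixes x t :: "'a \<Rightarrow> nat"
  assumes fin: "finite I" and le: "\<And>i. i \<in> I \<Longrightarrow> x i \<le> t i"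
    and anti: "\<And>k l. k \<le> l \<Longrightarrow> card {i\<in>I. t i = l} \<le> card {i\<in>I. t i = k}"
    and deg: "(\<Sum>i\<in>I. card {j\<in>I. t j < t i} + t i) \<le> (\<Sum>i\<in>I. card {j\<in>I. x j < x i} + x i)"
    and "i \<in> I"
  shows "x i = t i"
proof -
  define L where "L = Suc (Max (t ` I))"
  have tL: "t i < L" if "i \<in> I" for i
    using fin that by (simp add: L_def less_Suc_eq_le)
  then have xL: "x i < L" if "i \<in> I" for i
    using le that by fastforce
  define nx nt where "nx k = int (card {i\<in>I. x i = k})" and "nt k = int (card {i\<in>I. t i = k})" for k
  have "(\<Sum>i\<in>I. nt (t i)) \<le> (\<Sum>i\<in>I. nt (x i))"
    using le anti by (intro sum_mono) (simp add: nt_def)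
  then have "(\<Sum>k<L. nt k * nt k) \<le> (\<Sum>k<L. nx k * nt k)"
    using sum_card_fibre[OF fin, of t L nt] sum_card_fibre[OF fin, of x L nt] tL xL
    by (simp add: nt_def nx_def)
  moreover have "0 \<le> (\<Sum>k<L. (nx k - nt k)\<^sup>2)"
    by (simp add: sum_nonneg)
  then have "0 \<le> (\<Sum>k<L. nx k * nx k) + (\<Sum>k<L. nt k * nt k) - 2 * (\<Sum>k<L. nx k * nt k)"
    by (simp add: power2_eq_square algebra_simps sum.distrib sum_subtractf sum_distrib_left)
  ultimately have "(\<Sum>k<L. nt k * nt k) \<le> (\<Sum>k<L. nx k * nx k)"
    by simp
  then have "(\<Sum>i\<in>I. nt (t i)) \<le> (\<Sum>i\<in>I. nx (x i))"
    using sum_card_fibre[OF fin, of t L nt] sum_card_fibre[OF fin, of x L nx] tL xL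
    by (simp add: nt_def nx_def)
  then have "int (\<Sum>i\<in>I. card {j\<in>I. t j = t i}) \<le> int (\<Sum>i\<in>I. card {j\<in>I. x j = x i})"
    by (simp add: nt_def nx_def)
  then have "(\<Sum>i\<in>I. card {j\<in>I. x j < x i}) \<le> (\<Sum>i\<in>I. card {j\<in>I. t j < t i})"
    using sum_card_less[OF fin, of x] sum_card_less[OF fin, of t] by linarith
  then have "sum t I \<le> sum x I"
    using deg by (simp add: sum.distrib)
  then show ?thesis
    using pointwise_eq_if_sum_le fin le \<open>i \<in> I\<close> by metis
qed


section \<open>The row reading tableau\<close>

text \<open>
  The numbers \<open>N, N - 1, \<dots>, 1\<close> are entered row by row, and \<open>row\<close> counts rows from 0.
\<close>

definition row_start :: "expo \<Rightarrow> nat \<Rightarrow> nat" where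
  "row_start \<tau> r = (\<Sum>j=1..<r. lookup \<tau> j)"

definition row_reading :: "nat \<Rightarrow> expo \<Rightarrow> nat \<times> nat \<Rightarrow> nat" where
  "row_reading N \<tau> = (\<lambda>(r, c). N + 1 - (row_start \<tau> r + c))"

definition row :: "nat \<Rightarrow> expo \<Rightarrow> nat \<Rightarrow> nat" where
  "row N \<tau> i = fst (inv_into (cells \<tau>) (row_reading N \<tau>) i) - 1"

locale partition =
  fixes N :: nat and \<tau> :: expo
  assumes part: "partition_of N \<tau>"
begin

abbreviation "T \<equiv> row_reading N \<tau>"
abbreviation "t \<equiv> row N \<tau>"

lemma lookup_antimono: "1 \<le> i \<Longrightarrow> i \<le> j \<Longrightarrow> lookup \<tau> j \<le> lookup \<tau> i"
proof (cases "j \<le> N")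
  case False
  then have "j \<notin> keys \<tau>"
    using part by (auto simp: partition_of_def is_partition_def expos_def)
  then show ?thesis by (simp add: in_keys_iff)
qed (use part in \<open>auto simp: partition_of_def is_partition_def\<close>)

lemma row_start_Suc: "1 \<le> r \<Longrightarrow> row_start \<tau> (Suc r) = row_start \<tau> r + lookup \<tau> r"
  by (simp add: row_start_def)

lemma row_start_mono: "r \<le> s \<Longrightarrow> row_start \<tau> r \<le> row_start \<tau> s"
  unfolding row_start_def by (intro sum_mono2) auto

lemma row_start_end: "row_start \<tau> (Suc N) = N"
  using part by (simp add: row_start_def partition_of_def weight_def atLeastLessThanSuc_atLeastAtMost)

lemma cells_eq: "cells \<tau> = (SIGMA r:{1..N}. {1..lookup \<tau> r})"
proof -
  have "r \<le> N" if "1 \<le> c" "c \<le> lookup \<tau> r" for r c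
  proof -
    have "r \<in> keys \<tau>" using that by (simp add: in_keys_iff)
    moreover have "keys \<tau> \<subseteq> {1..N}"
      using part by (simp add: partition_of_def is_partition_def expos_def)
    ultimately show ?thesis by auto
  qed
  then show ?thesis by (auto simp: cells_def)
qed

lemma finite_cells: "finite (cells \<tau>)"
  by (simp add: cells_eq)

lemma row_start_bound:
  assumes "(r, c) \<in> cells \<tau>"
  shows "1 \<le> row_start \<tau> r + c" "row_start \<tau> r + c \<le> N"
proof -
  have "row_start \<tau> r + c \<le> row_start \<tau> (Suc r)"
    using assms by (simp add: cells_def row_start_Suc)
  also have "\<dots> \<le> row_start \<tau> (Suc N)"
    using assms by (intro row_start_mono) (auto simp: cells_eq)
  finally show "row_start \<tau> r + c \<le> N" by (simp add: row_start_end)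
qed (use assms in \<open>auto simp: cells_def\<close>)

lemma row_le_if_index_le:
  assumes "(r, c) \<in> cells \<tau>" "(r', c') \<in> cells \<tau>" "row_start \<tau> r + c \<le> row_start \<tau> r' + c'"
  shows "r \<le> r'"
proof (rule ccontr)
  assume "\<not> r \<le> r'"
  then have "row_start \<tau> (Suc r') \<le> row_start \<tau> r" by (intro row_start_mono) simp
  moreover have "row_start \<tau> r' + c' \<le> row_start \<tau> (Suc r')"
    using assms by (simp add: cells_def row_start_Suc)
  ultimately show False using assms by (simp add: cells_def)
qed

lemma T_bij: "bij_betw T (cells \<tau>) {1..N}"
proof -
  have inj: "inj_on T (cells \<tau>)"
  proof (rule inj_onI)
    fix x y assume xy: "x \<in> cells \<tau>" "y \<in> cells \<tau>" "T x = T y"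
    obtain r c r' c' where *: "x = (r, c)" "y = (r', c')" by (cases x, cases y)
    then have eq: "row_start \<tau> r + c = row_start \<tau> r' + c'"
      using xy row_start_bound[of r c] row_start_bound[of r' c'] by (simp add: row_reading_def)
    then have "r = r'"
      using xy * row_le_if_index_le[of r c r' c'] row_le_if_index_le[of r' c' r c] by simp
    then show "x = y" using eq * by simp
  qed
  have sub: "T ` cells \<tau> \<subseteq> {1..N}"
  proof
    fix i assume "i \<in> T ` cells \<tau>"
    then obtain r c where "(r, c) \<in> cells \<tau>" "i = N + 1 - (row_start \<tau> r + c)"
      by (auto simp: row_reading_def)
    then show "i \<in> {1..N}" using row_start_bound[of r c] by auto
  qed
  have "card (T ` cells \<tau>) = card (cells \<tau>)" using inj by (rule card_image)
  also have "\<dots> = (\<Sum>r=1..N. lookup \<tau> r)" by (simp add: cells_eq)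
  also have "\<dots> = N" using part by (simp add: partition_of_def weight_def)
  finally have "T ` cells \<tau> = {1..N}"
    using sub by (intro card_subset_eq) auto
  then show ?thesis using inj by (simp add: bij_betw_def)
qed

lemma T_tableaux: "T \<in> tableaux N \<tau>"
  using T_bij by (simp add: tableaux_def)

lemma T_inj: "x \<in> cells \<tau> \<Longrightarrow> y \<in> cells \<tau> \<Longrightarrow> T x = T y \<longleftrightarrow> x = y"
  using T_bij by (auto simp: bij_betw_def inj_on_def)

lemma T_in: "x \<in> cells \<tau> \<Longrightarrow> T x \<in> {1..N}"
  using T_bij by (auto simp: bij_betw_def)

lemma T_cases:
  assumes "i \<in> {1..N}"
  obtains r c where "(r, c) \<in> cells \<tau>" "i = T (r, c)"
  using assms T_bij by (metis bij_betw_imp_surj_on imageE surj_pair)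

lemma t_T: "(r, c) \<in> cells \<tau> \<Longrightarrow> t (T (r, c)) = r - 1"
  using T_bij by (simp add: row_def bij_betw_inv_into_left)

lemma t_antimono:
  assumes "i \<in> {1..N}" "j \<in> {1..N}" "i \<le> j"
  shows "t j \<le> t i"
proof -
  obtain r c r' c' where *: "(r, c) \<in> cells \<tau>" "i = T (r, c)" "(r', c') \<in> cells \<tau>" "j = T (r', c')"
    using T_cases assms by metis
  then have "row_start \<tau> r' + c' \<le> row_start \<tau> r + c"
    using assms(3) row_start_bound[of r c] row_start_bound[of r' c'] by (simp add: row_reading_def)
  then have "r' \<le> r" using * row_le_if_index_le by blast
  then show ?thesis using * by (simp add: t_T)
qed

lemma card_t:
  "card {i\<in>{1..N}. P (t i)} = (\<Sum>r\<in>{r\<in>{1..N}. P (r - 1)}. lookup \<tau> r)"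
proof -
  let ?C = "{x\<in>cells \<tau>. P (fst x - 1)}"
  have "{i\<in>{1..N}. P (t i)} = T ` ?C"
  proof (intro set_eqI iffI)
    fix i assume i: "i \<in> {i\<in>{1..N}. P (t i)}"
    obtain r c where "(r, c) \<in> cells \<tau>" "i = T (r, c)"
      using i T_cases[of i] by auto
    then show "i \<in> T ` ?C" using i by (auto simp: t_T)
  next
    fix i assume "i \<in> T ` ?C"
    then show "i \<in> {i\<in>{1..N}. P (t i)}"
      using T_in by (auto simp: t_T)
  qed
  moreover have "inj_on T ?C"
    using T_bij by (auto simp: bij_betw_def intro: inj_on_subset)
  ultimately have "card {i\<in>{1..N}. P (t i)} = card ?C"
    by (simp add: card_image)
  also have "?C = (SIGMA r:{r\<in>{1..N}. P (r - 1)}. {1..lookup \<tau> r})"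
    by (auto simp: cells_eq)
  finally show ?thesis by simp
qed

lemma card_t_less:
  assumes "r \<in> {1..N}"
  shows "card {i\<in>{1..N}. t i < r - 1} = row_start \<tau> r"
proof -
  have "{s\<in>{1..N}. s - 1 < r - 1} = {1..<r}" using assms by auto
  then show ?thesis using card_t[of "\<lambda>k. k < r - 1"] by (simp add: row_start_def)
qed

lemma card_t_eq: "card {i\<in>{1..N}. t i = k} = (if k < N then lookup \<tau> (Suc k) else 0)"
proof -
  have "{s\<in>{1..N}. s - 1 = k} = (if k < N then {Suc k} else {})" by auto
  then show ?thesis using card_t[of "\<lambda>l. l = k"] by simp
qed

lemma card_t_antimono: "k \<le> l \<Longrightarrow> card {i\<in>{1..N}. t i = l} \<le> card {i\<in>{1..N}. t i = k}"
  unfolding card_t_eq by (auto intro: lookup_antimono)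

text \<open>A column of height h carries h distinct values of \<open>g\<close>, with sum at least 0
  + 1 + ... + (h - 1), and this is the sum of the row numbers in the column.\<close>

lemma sum_t_le_if_columns_distinct:
  fixes g :: "nat \<Rightarrow> nat"
  assumes "\<And>r r' c. (r, c) \<in> cells \<tau> \<Longrightarrow> (r', c) \<in> cells \<tau> \<Longrightarrow> r \<noteq> r' \<Longrightarrow> g (T (r, c)) \<noteq> g (T (r', c))"
  shows "(\<Sum>i\<in>{1..N}. t i) \<le> (\<Sum>i\<in>{1..N}. g i)"
proof -
  define C where "C c = {r. (r, c) \<in> cells \<tau>}" for c
  define D where "D = {1..lookup \<tau> 1}"
  have fin: "finite (C c)" for c
    by (rule finite_subset[of _ "fst ` cells \<tau>"]) (use finite_cells in \<open>force simp: C_def\<close>)+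
  have sums: "(\<Sum>i\<in>{1..N}. h i) = (\<Sum>c\<in>D. \<Sum>r\<in>C c. h (T (r, c)))" for h :: "nat \<Rightarrow> nat"
  proof -
    have "(\<Sum>i\<in>{1..N}. h i) = (\<Sum>x\<in>cells \<tau>. h (T x))"
      using T_bij by (rule sum.reindex_bij_betw[symmetric])
    also have "\<dots> = (\<Sum>(c, r)\<in>(SIGMA c:D. C c). h (T (r, c)))"
    proof (rule sum.reindex_bij_witness[where j = "\<lambda>(r, c). (c, r)" and i = "\<lambda>(c, r). (r, c)"])
      fix x assume x: "x \<in> cells \<tau>"
      then have "snd x \<le> lookup \<tau> 1"
        using lookup_antimono[of 1 "fst x"] by (auto simp: cells_def)
      then show "(case x of (r, c) \<Rightarrow> (c, r)) \<in> (SIGMA c:D. C c)"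
        using x by (auto simp: C_def D_def cells_def)
    qed (auto simp: C_def)
    also have "\<dots> = (\<Sum>c\<in>D. \<Sum>r\<in>C c. h (T (r, c)))"
      using fin by (simp add: sum.Sigma D_def)
    finally show ?thesis .
  qed
  have "(\<Sum>r\<in>C c. t (T (r, c))) \<le> (\<Sum>r\<in>C c. g (T (r, c)))" for c
  proof -
    have down: "s \<in> C c" if "r \<in> C c" "1 \<le> s" "s \<le> r" for r s
      using that lookup_antimono[of s r] by (auto simp: C_def cells_def)
    \<comment> \<open>Parts do not increase, so a column occupies an initial segment of the
      rows.\<close>
    have C: "C c = {1..card (C c)}"
    proof (cases "C c = {}")
      case False
      then have "Max (C c) \<in> C c" using fin by simp
      then have "C c = {1..Max (C c)}"
      proof (intro set_eqI iffI)
        fix r assume r: "r \<in> C c"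
        then have "1 \<le> r" by (simp add: C_def cells_def)
        then show "r \<in> {1..Max (C c)}" using Max_ge[OF fin r] by simp
      next
        fix r assume "r \<in> {1..Max (C c)}"
        then show "r \<in> C c" using down[OF \<open>Max (C c) \<in> C c\<close>] by simp
      qed
      then show ?thesis by (metis card_atLeastAtMost diff_Suc_1)
    qed simp
    have "(\<Sum>r\<in>C c. t (T (r, c))) = (\<Sum>r\<in>C c. r - 1)"
      by (intro sum.cong) (auto simp: C_def t_T)
    also have "\<dots> = (\<Sum>r=1..card (C c). r - 1)" using C by simp
    also have "\<dots> = (\<Sum>k<card (C c). k)"
      by (rule sum.reindex_bij_witness[where i = Suc and j = "\<lambda>r. r - 1"]) auto
    also have "\<dots> = (\<Sum>k<card ((\<lambda>r. g (T (r, c))) ` C c). k)"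
    proof -
      have "inj_on (\<lambda>r. g (T (r, c))) (C c)"
        using assms by (force simp: inj_on_def C_def)
      then show ?thesis by (simp add: card_image)
    qed
    also have "\<dots> \<le> \<Sum>((\<lambda>r. g (T (r, c))) ` C c)"
      using fin by (intro sum_lessThan_card_le) simp
    also have "\<dots> = (\<Sum>r\<in>C c. g (T (r, c)))"
    proof -
      have "inj_on (\<lambda>r. g (T (r, c))) (C c)"
        using assms by (force simp: inj_on_def C_def)
      then show ?thesis by (simp add: sum.reindex)
    qed
    finally show ?thesis .
  qed
  then show ?thesis unfolding sums by (rule sum_mono)
qed

end


section \<open>Two vectors of the Specht module\<close>

lemma act_specht_poly: "act w (specht_poly \<tau> T) = specht_poly \<tau> (w \<circ> T)"
  unfolding specht_poly_def act_prod by (intro prod.cong) (auto simp: act_diff)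

lemma comp_tableaux:
  assumes "T \<in> tableaux N \<tau>" "w permutes {1..N}"
  shows "w \<circ> T \<in> tableaux N \<tau>"
  using assms bij_betw_trans[of T "cells \<tau>" "{1..N}" w "{1..N}"] by (simp add: tableaux_def permutes_imp_bij)

lemma specht_polys_in_module: "T \<in> tableaux N \<tau> \<Longrightarrow> specht_poly \<tau> T \<in> specht_module N \<tau>"
  unfolding specht_module_def by (rule rpoly.span_base) simp

text \<open>Uses (k, l+1) = (l, l+1)(k, l)(l, l+1), whose three factors contribute e * e * e = e. It
  serves columns with e = -1 and rows with e = 1.\<close>

lemma act_transpose_chain:
  assumes step: "\<And>k. a \<le> k \<Longrightarrow> k < b \<Longrightarrow> act (transpose (u k) (u (Suc k))) f = smul e f"
    and e: "e * e = 1" and inj: "inj_on u {a..b}" and "a \<le> k" "k < l" "l \<le> b"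
  shows "act (transpose (u k) (u l)) f = smul e f"
  using \<open>k < l\<close> \<open>l \<le> b\<close>
proof (induction l)
  case (Suc l)
  show ?case
  proof (cases "k = l")
    case True
    then show ?thesis using step Suc \<open>a \<le> k\<close> by simp
  next
    case False
    then have "k < l" using Suc by simp
    then have ne: "u k \<noteq> u l" "u k \<noteq> u (Suc l)"
      using inj Suc \<open>a \<le> k\<close> by (auto simp: inj_on_eq_iff)
    have "transpose (u k) (u (Suc l)) =
       transpose (u l) (u (Suc l)) \<circ> (transpose (u k) (u l) \<circ> transpose (u l) (u (Suc l)))"
      using ne by (auto simp: fun_eq_iff transpose_def)
    then have "act (transpose (u k) (u (Suc l))) f =
        act (transpose (u l) (u (Suc l))) (act (transpose (u k) (u l)) (act (transpose (u l) (u (Suc l))) f))"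
      by (simp only: act_act)
    also have "\<dots> = smul e f"
      using step[of l] Suc \<open>k < l\<close> \<open>a \<le> k\<close> e by (simp add: act_smul)
    finally show ?thesis .
  qed
qed simp

section \<open>Column antisymmetry of the Specht polynomial\<close>

context partition
begin

text \<open>For adjacent rows the swap changes the sign of one factor only and permutes all others:
  no third row lies between the two, so the order of the rows in every other factor is kept.\<close>

lemma act_column_transpose_adjacent:
  assumes "(r, c) \<in> cells \<tau>" "(Suc r, c) \<in> cells \<tau>"
  shows "act (transpose (T (r, c)) (T (Suc r, c))) (specht_poly \<tau> T) = - specht_poly \<tau> T"
proof -
  define S where "S = {(a, b, d). a < b \<and> (a, d) \<in> cells \<tau> \<and> (b, d) \<in> cells \<tau>}"
  define S' where "S' = S - {(r, Suc r, c)}"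
  define f where "f = (\<lambda>(a, b, d). X (T (a, d)) - X (T (b, d)))"
  define sw where "sw d a = (if d = c then transpose r (Suc r) a else a)" for a d
  define \<theta> where "\<theta> = (\<lambda>(a, b, d). (sw d a, sw d b, d))"
  let ?w = "transpose (T (r, c)) (T (Suc r, c))"
  have finS: "finite S"
    by (rule finite_subset[of _ "fst ` cells \<tau> \<times> fst ` cells \<tau> \<times> snd ` cells \<tau>"])
      (use finite_cells in \<open>force simp: S_def\<close>)+
  have S: "S = insert (r, Suc r, c) S'" "(r, Suc r, c) \<notin> S'" "finite S'"
    using assms finS by (auto simp: S_def S'_def)
  have wT: "?w (T (a, d)) = T (sw d a, d)" if "(a, d) \<in> cells \<tau>" for a d
    using that assms T_inj by (auto simp: transpose_def sw_def)
  have act_f: "act ?w (f x) = f (\<theta> x)" if "x \<in> S" for x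
    using that by (auto simp: f_def \<theta>_def S_def act_diff wT)
  have \<theta>S': "\<theta> x \<in> S'" "\<theta> (\<theta> x) = x" if "x \<in> S'" for x
    using that assms by (auto simp: \<theta>_def S'_def S_def sw_def transpose_def split: if_splits)
  have "(\<Prod>x\<in>S'. f (\<theta> x)) = (\<Prod>x\<in>S'. f x)"
    by (rule prod.reindex_bij_witness[where i = \<theta> and j = \<theta>]) (use \<theta>S' in auto)
  moreover have "f (\<theta> (r, Suc r, c)) = - f (r, Suc r, c)"
    by (simp add: f_def \<theta>_def sw_def)
  moreover have "specht_poly \<tau> T = (\<Prod>x\<in>S. f x)"
    by (simp add: specht_poly_def S_def f_def)
  moreover have "act ?w (\<Prod>x\<in>S. f x) = (\<Prod>x\<in>S. f (\<theta> x))"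
    using act_f by (simp add: act_prod)
  ultimately show ?thesis
    using S by simp
qed

lemma act_column_transpose:
  assumes "(r, c) \<in> cells \<tau>" "(r', c) \<in> cells \<tau>" "r \<noteq> r'"
  shows "act (transpose (T (r, c)) (T (r', c))) (specht_poly \<tau> T) = - specht_poly \<tau> T"
proof -
  have *: "act (transpose (T (r, c)) (T (r', c))) (specht_poly \<tau> T) = smul (- 1) (specht_poly \<tau> T)"
    if "(r, c) \<in> cells \<tau>" "(r', c) \<in> cells \<tau>" "r < r'" for r r'
  proof (rule act_transpose_chain[where a = r and b = r' and u = "\<lambda>r. T (r, c)"])
    have mem: "(k, c) \<in> cells \<tau>" if "r \<le> k" "k \<le> r'" for k
      using that \<open>(r, c) \<in> cells \<tau>\<close> \<open>(r', c) \<in> cells \<tau>\<close> lookup_antimono[of k r'] by (auto simp: cells_def)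
    then show "act (transpose (T (k, c)) (T (Suc k, c))) (specht_poly \<tau> T) = smul (- 1) (specht_poly \<tau> T)"
      if "r \<le> k" "k < r'" for k
      using that by (simp add: act_column_transpose_adjacent rpoly.scale_minus_left)
    show "inj_on (\<lambda>r. T (r, c)) {r..r'}"
      using mem T_inj by (auto simp: inj_on_def)
  qed (use that in auto)
  show ?thesis
    using *[of r r'] *[of r' r] assms by (cases "r < r'") (auto simp: transpose_commute rpoly.scale_minus_left)
qed

section \<open>Row symmetrization of the Specht polynomial\<close>

definition row_group :: "(nat \<Rightarrow> nat) set" where
  "row_group = {w. w permutes {1..N} \<and> (\<forall>i. t (w i) = t i)}"

definition row_vector :: rpoly where
  "row_vector = (\<Sum>w\<in>row_group. act w (specht_poly \<tau> T))"

lemma row_vector_in_module: "row_vector \<in> specht_module N \<tau>"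
proof -
  have "act w (specht_poly \<tau> T) \<in> specht_module N \<tau>" if "w \<in> row_group" for w
    using that comp_tableaux[OF T_tableaux] by (simp add: act_specht_poly specht_polys_in_module row_group_def)
  then show ?thesis
    unfolding row_vector_def specht_module_def by (intro rpoly.span_sum)
qed

lemma act_row_vector:
  assumes "i \<in> {1..N}" "j \<in> {1..N}" "t i = t j"
  shows "act (transpose i j) row_vector = row_vector"
proof -
  let ?s = "transpose i j"
  have s: "?s permutes {1..N}" using assms by (intro permutes_swap_id)
  have t: "t (?s k) = t k" for k
    using assms by (simp add: transpose_def)
  have mem: "?s \<circ> w \<in> row_group" if "w \<in> row_group" for w
    using that s t by (auto simp: row_group_def intro: permutes_compose)
  have "act ?s row_vector = (\<Sum>w\<in>row_group. act (?s \<circ> w) (specht_poly \<tau> T))"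
    by (simp add: row_vector_def act_sum act_act)
  also have "\<dots> = row_vector"
    unfolding row_vector_def
    by (rule sum.reindex_bij_witness[where i = "\<lambda>w. ?s \<circ> w" and j = "\<lambda>w. ?s \<circ> w"])
      (use mem in \<open>auto simp: comp_assoc[symmetric]\<close>)
  finally show ?thesis .
qed

text \<open>At a point that is constant on rows, all summands of the row vector take the same value.\<close>

lemma row_vector_nonzero: "row_vector \<noteq> 0"
proof -
  define s :: "nat \<Rightarrow> rpoly" where "s i = Poly_Mapping.single 0 (of_nat (t i))" for i
  have "subst s (act w P) = subst s P" if "w \<in> row_group" for w P
  proof -
    have "(\<lambda>i. s (w i)) = s" using that by (intro ext) (simp add: s_def row_group_def)
    then show ?thesis by (simp add: act_def subst_subst)
  qed
  then have "subst s row_vector = of_nat (card row_group) * subst s (specht_poly \<tau> T)"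
    by (simp add: row_vector_def subst_sum)
  moreover have "subst s (specht_poly \<tau> T) \<noteq> 0"
  proof -
    have ne: "s (T (r, c)) - s (T (r', c)) \<noteq> 0"
      if "(r, c) \<in> cells \<tau>" "(r', c) \<in> cells \<tau>" "r < r'" for r r' c
    proof -
      have "r - 1 \<noteq> r' - 1" using that by (auto simp: cells_def)
      then have "(of_nat (t (T (r, c))) :: rat) \<noteq> of_nat (t (T (r', c)))"
        using that by (simp add: t_T)
      then show ?thesis by (simp add: s_def single_diff[symmetric])
    qed
    have "finite {(r, r', c). r < r' \<and> (r, c) \<in> cells \<tau> \<and> (r', c) \<in> cells \<tau>}"
      by (rule finite_subset[of _ "fst ` cells \<tau> \<times> fst ` cells \<tau> \<times> snd ` cells \<tau>"])
        (use finite_cells in force)+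
    then show ?thesis
      using ne by (auto simp: specht_poly_def subst_prod subst_diff split_def)
  qed
  moreover have "(of_nat (card row_group) :: rpoly) \<noteq> 0"
  proof -
    have "finite row_group"
      by (rule finite_subset[OF _ finite_permutations[of "{1..N}"]]) (auto simp: row_group_def)
    moreover have "id \<in> row_group" by (simp add: row_group_def permutes_id)
    ultimately have "card row_group \<noteq> 0" by auto
    moreover have "lookup (of_nat (card row_group) :: rpoly) 0 = of_nat (card row_group)"
      by (simp add: lookup_of_nat)
    ultimately show ?thesis by (metis lookup_zero of_nat_eq_0_iff)
  qed
  ultimately show ?thesis by (metis mult_eq_0_iff subst_zero)
qed

end


section \<open>Orbits of words\<close>

definition orbit :: "nat \<Rightarrow> (nat \<Rightarrow> nat) \<Rightarrow> (nat \<Rightarrow> nat) set" where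
  "orbit N w = {w \<circ> v | v. v permutes {1..N}}"

lemma orbit_self: "w \<in> orbit N w"
  unfolding orbit_def using permutes_id by (auto intro!: exI[of _ id])

lemma orbit_comp: "u \<in> orbit N w \<Longrightarrow> v permutes {1..N} \<Longrightarrow> u \<circ> v \<in> orbit N w"
  unfolding orbit_def by (auto simp: comp_assoc intro: permutes_compose)

lemma orbit_comp_iff:
  assumes "v permutes {1..N}" shows "u \<circ> v \<in> orbit N w \<longleftrightarrow> u \<in> orbit N w"
proof
  assume "u \<circ> v \<in> orbit N w"
  then have "(u \<circ> v) \<circ> inv v \<in> orbit N w"
    by (rule orbit_comp[OF _ permutes_inv[OF assms]])
  then show "u \<in> orbit N w"
    using permutes_inv_o(1)[OF assms] by (simp add: comp_assoc)
qed (rule orbit_comp[OF _ assms])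

lemma orbit_sum:
  assumes "u \<in> orbit N w" shows "(\<Sum>i\<in>{1..N}. g (u i)) = (\<Sum>i\<in>{1..N}. g (w i))"
proof -
  obtain v where v: "v permutes {1..N}" "u = w \<circ> v" using assms by (auto simp: orbit_def)
  then show ?thesis
    using sum.permute[OF v(1), of "\<lambda>i. g (w i)"] by (simp add: comp_def)
qed

lemma orbit_card:
  assumes "u \<in> orbit N w" shows "card {i\<in>{1..N}. u i = x} = card {i\<in>{1..N}. w i = x}"
  using orbit_sum[OF assms, of "\<lambda>a. if a = x then 1 else 0 :: nat"] by (simp add: sum.If_cases Int_def)

lemma orbit_height:
  assumes "height N h" "u \<in> orbit N w" shows "h u = h w"
  using assms by (auto simp: orbit_def height_def)

lemma transpose_permutes: "i \<in> {1..N} \<Longrightarrow> j \<in> {1..N} \<Longrightarrow> transpose i j permutes {1..N}"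
  by (rule permutes_swap_id)

lemma finite_coef_support: "finite {w. coef f w \<noteq> 0}"
proof -
  have "{w. coef f w \<noteq> 0} \<subseteq> lookup ` keys f"
  proof
    fix w assume "w \<in> {w. coef f w \<noteq> 0}"
    then have "finite {i. w i \<noteq> 0}" "lookup f (Abs_poly_mapping w) \<noteq> 0"
      by (auto simp: coef_def split: if_splits)
    then show "w \<in> lookup ` keys f"
      by (intro image_eqI[of _ _ "Abs_poly_mapping w"]) (auto simp: in_keys_iff)
  qed
  then show ?thesis by (rule finite_subset) simp
qed

lemma homogeneous_word:
  assumes "f \<in> homogeneous N d" "coef f w \<noteq> 0"
  shows "w \<in> words N" "(\<Sum>i\<in>{1..N}. w i) = d"
proof -
  define \<alpha> where "\<alpha> = Abs_poly_mapping w"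
  have "finite {i. w i \<noteq> 0}" "lookup f \<alpha> \<noteq> 0"
    using assms(2) by (auto simp: coef_def \<alpha>_def split: if_splits)
  then have w: "w = lookup \<alpha>" "\<alpha> \<in> keys f"
    by (simp_all add: \<alpha>_def in_keys_iff)
  then show "w \<in> words N" "(\<Sum>i\<in>{1..N}. w i) = d"
    using assms(1) by (auto simp: homogeneous_def polys_def words_expos weight_def)
qed

text \<open>Transpositions preserve the orbit and the height is constant on it, so the equations of
  \<open>star_top\<close> survive the restriction to the orbit. The word \<open>w1\<close> shows
  that this restriction is not zero.\<close>

lemma top_function_coef:
  assumes "\<kappa> < 0" and sing: "\<And>i. i \<in> {1..N} \<Longrightarrow> dunkl N \<kappa> i f = 0"
    and h: "height N h" and top: "\<And>\<beta>. h w0 < h \<beta> \<Longrightarrow> coef f \<beta> = 0"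
    and w1: "w1 \<in> orbit N w0" "coef f w1 \<noteq> 0"
  shows "top_function {1..N} \<kappa> (\<lambda>w. if w \<in> orbit N w0 then coef f w else 0) (\<lambda>x. card {i\<in>{1..N}. w0 i = x}) w1"
proof
  show "finite {w. (if w \<in> orbit N w0 then coef f w else 0) \<noteq> 0}"
    by (rule finite_subset[OF _ finite_coef_support[of f]]) auto
  fix w :: "nat \<Rightarrow> nat" and x
  show "card {i\<in>{1..N}. w i = x} = card {i\<in>{1..N}. w0 i = x}"
    if "(if w \<in> orbit N w0 then coef f w else 0) \<noteq> 0"
    using that orbit_card by (auto split: if_splits)
next
  fix i w assume i: "i \<in> {1..N}"
  have swap: "w \<circ> transpose i j \<in> orbit N w0 \<longleftrightarrow> w \<in> orbit N w0" if "j \<in> {1..N}" for j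
    using orbit_comp_iff transpose_permutes i that by blast
  show "(of_nat (w i) + \<kappa> * of_nat (card {j\<in>{1..N}. w j < w i})) * (if w \<in> orbit N w0 then coef f w else 0) =
    \<kappa> * (\<Sum>j\<in>{j\<in>{1..N}. w j < w i}. if w \<circ> transpose i j \<in> orbit N w0 then coef f (w \<circ> transpose i j) else 0)"
  proof (cases "w \<in> orbit N w0")
    case True
    have "(\<Sum>j\<in>{j\<in>{1..N}. w j < w i}. if w \<circ> transpose i j \<in> orbit N w0 then coef f (w \<circ> transpose i j) else 0) =
        (\<Sum>j\<in>{j\<in>{1..N}. w j < w i}. coef f (w \<circ> transpose i j))"
      using swap True by (intro sum.cong) auto
    moreover have "h w = h w0" using h True by (rule orbit_height)
    ultimately show ?thesis
      using star_top[OF i sing[OF i] h, of w] top True by simp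
  next
    case False
    then have "(\<Sum>j\<in>{j\<in>{1..N}. w j < w i}. if w \<circ> transpose i j \<in> orbit N w0 then coef f (w \<circ> transpose i j) else 0) = 0"
      using swap by (intro sum.neutral) auto
    then show ?thesis using False by simp
  qed
qed (use assms in auto)


section \<open>An invariant inner product\<close>

text \<open>The form for which the monomials are orthonormal; terms outside the support of
  \<open>f\<close> vanish, so the asymmetric range of summation is harmless.\<close>

definition ip :: "rpoly \<Rightarrow> rpoly \<Rightarrow> rat" where
  "ip f g = (\<Sum>w\<in>{w. coef f w \<noteq> 0}. coef f w * coef g w)"

lemma ip_superset:
  assumes "finite W" "{w. coef f w \<noteq> 0} \<subseteq> W \<or> {w. coef g w \<noteq> 0} \<subseteq> W"
  shows "ip f g = (\<Sum>w\<in>W. coef f w * coef g w)"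
proof -
  have "ip f g = (\<Sum>w\<in>{w. coef f w \<noteq> 0} \<inter> {w. coef g w \<noteq> 0}. coef f w * coef g w)"
    unfolding ip_def using finite_coef_support by (intro sum.mono_neutral_right) auto
  also have "\<dots> = (\<Sum>w\<in>W. coef f w * coef g w)"
    using assms by (intro sum.mono_neutral_left) auto
  finally show ?thesis .
qed

lemma ip_commute: "ip f g = ip g f"
  using ip_superset[OF finite_coef_support[of g], of f g] by (simp add: ip_def mult.commute)

lemma ip_diff_right: "ip f (g - h) = ip f g - ip f h"
  by (simp add: ip_def right_diff_distrib sum_subtractf)

lemma ip_smul_right: "ip f (smul c g) = c * ip f g"
  by (simp add: ip_def sum_distrib_left mult.left_commute)

lemma ip_sum_right: "ip f (\<Sum>x\<in>A. g x) = (\<Sum>x\<in>A. ip f (g x))"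
  by (simp add: ip_def sum_distrib_left) (rule sum.swap)

lemma ip_act_transpose: "ip f (act (transpose i j) g) = ip (act (transpose i j) f) g"
proof -
  let ?s = "transpose i j"
  let ?U = "{w. coef f w \<noteq> 0} \<union> {w. coef g w \<noteq> 0}"
  let ?W = "?U \<union> (\<lambda>w. w \<circ> ?s) ` ?U"
  have bij: "bij ?s" by simp
  have fin: "finite ?W" using finite_coef_support by simp
  have inv: "(w \<circ> ?s) \<circ> ?s = w" for w :: "nat \<Rightarrow> nat"
    by (simp add: comp_assoc)
  have W: "w \<circ> ?s \<in> ?W" if "w \<in> ?W" for w
    using that by (auto simp: comp_assoc)
  have "ip f (act ?s g) = (\<Sum>w\<in>?W. coef f w * coef g (w \<circ> ?s))"
    using fin by (subst ip_superset[of ?W]) (auto simp: coef_act[OF bij])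
  also have "\<dots> = (\<Sum>w\<in>?W. coef f (w \<circ> ?s) * coef g w)"
    by (rule sum.reindex_bij_witness[where i = "\<lambda>w. w \<circ> ?s" and j = "\<lambda>w. w \<circ> ?s"])
      (use W inv in simp_all)
  also have "\<dots> = ip (act ?s f) g"
    using fin by (subst ip_superset[of ?W]) (auto simp: coef_act[OF bij])
  finally show ?thesis .
qed

lemma ip_self_eq_0: "ip f f = 0 \<Longrightarrow> f = 0"
proof (rule poly_eqI)
  fix w assume "ip f f = 0"
  then have "coef f w * coef f w = 0" if "coef f w \<noteq> 0"
    using that finite_coef_support[of f] unfolding ip_def by (subst (asm) sum_nonneg_eq_0_iff) auto
  then show "coef f w = coef 0 w" by auto
qed

section \<open>Jucys-Murphy elements as self-adjoint operators\<close>

lemma ip_jucys_murphy: "ip f (jucys_murphy N i g) = ip (jucys_murphy N i f) g"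
proof -
  have "ip f (jucys_murphy N i g) = (\<Sum>j\<in>{i<..N}. ip (act (transpose i j) f) g)"
    by (simp add: jucys_murphy_def ip_sum_right ip_act_transpose)
  also have "\<dots> = ip g (jucys_murphy N i f)"
    by (simp add: jucys_murphy_def ip_sum_right ip_commute[of g])
  finally show ?thesis by (simp add: ip_commute[of g])
qed

text \<open>The degenerate Hecke relation between neighbouring Jucys-Murphy elements; the extra
  \<open>f\<close> is the term j = i + 1, where the transposition acts twice.\<close>

lemma jucys_murphy_act_adjacent:
  assumes "Suc i \<le> N"
  shows "jucys_murphy N i (act (transpose i (Suc i)) f) = act (transpose i (Suc i)) (jucys_murphy N (Suc i) f) + f"
proof -
  let ?s = "transpose i (Suc i)"
  have "{i<..N} = insert (Suc i) {Suc i<..N}" using assms by auto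
  moreover have "act (transpose i j) (act ?s f) = act ?s (act (transpose (Suc i) j) f)" if "j \<in> {Suc i<..N}" for j
  proof -
    have "transpose i j \<circ> ?s = ?s \<circ> transpose (Suc i) j"
      using that by (auto simp: fun_eq_iff transpose_def)
    then show ?thesis by (simp add: act_act)
  qed
  ultimately show ?thesis
    by (simp add: jucys_murphy_def act_sum add.commute)
qed

lemma jucys_murphy_diff: "jucys_murphy N i (f - g) = jucys_murphy N i f - jucys_murphy N i g"
  by (simp add: jucys_murphy_def act_diff sum_subtractf)

lemma jucys_murphy_smul: "jucys_murphy N i (smul c f) = smul c (jucys_murphy N i f)"
  by (simp add: jucys_murphy_def act_smul rpoly.scale_sum_right)

text \<open>
  For \<open>e = s f - f\<close> with \<open>s = (i, i + 1)\<close>, both \<open>e\<close> and \<open>f\<close> are eigenvectors of the same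
  self-adjoint operator with different eigenvalues, hence orthogonal, and \<open>s e = - e\<close>.
\<close>

lemma act_adjacent_eq_self:
  assumes "Suc i \<le> N" and i: "jucys_murphy N i f = smul (c + 1) f" and Si: "jucys_murphy N (Suc i) f = smul c f"
  shows "act (transpose i (Suc i)) f = f"
proof -
  let ?s = "transpose i (Suc i)"
  define e where "e = act ?s f - f"
  have "jucys_murphy N i e = smul c (act ?s f) + f - smul (c + 1) f"
    using jucys_murphy_act_adjacent[OF assms(1), of f] by (simp add: e_def jucys_murphy_diff i Si act_smul)
  also have "\<dots> = smul c e"
    by (simp add: e_def rpoly.scale_left_distrib rpoly.scale_right_diff_distrib)
  finally have "ip (jucys_murphy N i e) f = c * ip e f"
    by (simp add: ip_commute[of _ f] ip_smul_right)
  moreover have "ip (jucys_murphy N i e) f = (c + 1) * ip e f"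
    using ip_jucys_murphy[of e N i f] by (simp add: i ip_smul_right)
  ultimately have orth: "ip e f = 0"
    by (simp add: algebra_simps)
  have "ip e e = ip e (act ?s f) - ip e f"
    by (subst (2) e_def) (simp add: ip_diff_right)
  also have "ip e (act ?s f) = ip (act ?s e) f"
    by (rule ip_act_transpose)
  also have "act ?s e = smul (- 1) e"
    by (simp add: e_def act_diff rpoly.scale_minus_left)
  also have "ip (smul (- 1) e) f = 0"
    using orth by (simp add: ip_commute[of _ f] ip_smul_right del: rpoly.scale_minus_left)
  finally have "ip e e = 0" using orth by simp
  then have "e = 0" by (rule ip_self_eq_0)
  then show ?thesis by (simp add: e_def)
qed


section \<open>The exponent attached to a partition\<close>

context partition
begin

text \<open>The entry of \<lambda> divided by -\<kappa>, in the shape of \<open>value_eq_idx\<close>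
  with row numbers for indices. In row r it is the sum of \<tau>_j + 1 over j < r.\<close>

definition row_value :: "nat \<Rightarrow> nat" where
  "row_value i = card {j\<in>{1..N}. t j < t i} + t i"

lemma row_value_mono:
  assumes "t i \<le> t j" shows "row_value i \<le> row_value j"
proof -
  have "card {k\<in>{1..N}. t k < t i} \<le> card {k\<in>{1..N}. t k < t j}"
    using assms by (intro card_mono) auto
  then show ?thesis using assms by (simp add: row_value_def)
qed

lemma row_value_T:
  assumes "(r, c) \<in> cells \<tau>"
  shows "row_value (T (r, c)) = (\<Sum>j=1..<r. lookup \<tau> j + 1)"
proof -
  have r: "r \<in> {1..N}" using assms by (simp add: cells_eq)
  have "row_value (T (r, c)) = row_start \<tau> r + (r - 1)"
    using card_t_less[OF r] assms by (simp add: row_value_def t_T)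
  then show ?thesis by (simp only: sum.distrib row_start_def) simp
qed

end

text \<open>Here \<open>lam\<close> is the partition \<lambda> of the theorem. That its entries are
  natural numbers is the integrality from which the divisibility is later read off.\<close>

locale row_exponent = partition +
  fixes \<kappa> :: rat and lam :: expo
  assumes \<kappa>_neg: "\<kappa> < 0" and lam_expos: "lam \<in> expos N"
    and lam_value: "i \<in> {1..N} \<Longrightarrow> of_nat (lookup lam i) = - \<kappa> * of_nat (row_value i)"
begin

lemma lam_unique:
  assumes "w \<in> words N" "\<And>i. i \<in> {1..N} \<Longrightarrow> of_nat (w i) = - \<kappa> * of_nat (row_value i)"
  shows "w = lookup lam"
proof
  fix i
  show "w i = lookup lam i"
  proof (cases "i \<in> {1..N}")
    case True
    then have "(of_nat (w i) :: rat) = of_nat (lookup lam i)"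
      using assms(2) lam_value by simp
    then show ?thesis by simp
  next
    case False
    then show ?thesis
      using assms(1) words_expos[of lam N] lam_expos by (simp add: words_def)
  qed
qed

lemma lam_mono:
  assumes "i \<in> {1..N}" "j \<in> {1..N}" "t i \<le> t j" shows "lookup lam i \<le> lookup lam j"
proof -
  have "(of_nat (lookup lam i) :: rat) \<le> of_nat (lookup lam j)"
    using assms row_value_mono[of i j] \<kappa>_neg by (simp add: lam_value mult_left_mono_neg)
  then show ?thesis by simp
qed

lemma lam_antimono: "1 \<le> i \<Longrightarrow> i \<le> j \<Longrightarrow> j \<le> N \<Longrightarrow> lookup lam j \<le> lookup lam i"
  by (intro lam_mono t_antimono) auto

lemma lam_partition: "is_partition N lam"
  using lam_expos lam_antimono by (simp add: is_partition_def)

text \<open>For the number \<open>i\<close> of the cell (r, c) this equals c - r, the content of the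
  cell.\<close>

definition content_value :: "nat \<Rightarrow> rat" where
  "content_value i = of_nat (lookup lam i) / \<kappa> + (of_nat N - of_nat i)"

text \<open>Since \<open>lam\<close> is nonincreasing, the positions counted by the rank of
  \<open>i\<close> are exactly 1, ..., i.\<close>

lemma spectral_lam:
  assumes "i \<in> {1..N}"
  shows "spectral N lam i \<kappa> = 1 + \<kappa> * content_value i"
proof -
  have "{1..i} = {j\<in>{1..N}. lookup lam j > lookup lam i} \<union> {j\<in>{1..i}. lookup lam j = lookup lam i}"
  proof (intro set_eqI iffI)
    fix j assume "j \<in> {1..i}"
    then show "j \<in> {j\<in>{1..N}. lookup lam j > lookup lam i} \<union> {j\<in>{1..i}. lookup lam j = lookup lam i}"
      using lam_antimono[of j i] assms by auto
  next
    fix j assume j: "j \<in> {j\<in>{1..N}. lookup lam j > lookup lam i} \<union> {j\<in>{1..i}. lookup lam j = lookup lam i}"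
    have "j \<le> i"
    proof (rule ccontr)
      assume "\<not> j \<le> i"
      then show False using j lam_antimono[of i j] assms by auto
    qed
    then show "j \<in> {1..i}" using j by auto
  qed
  then have "i = card ({j\<in>{1..N}. lookup lam j > lookup lam i} \<union> {j\<in>{1..i}. lookup lam j = lookup lam i})"
    by (metis card_atLeastAtMost diff_Suc_1)
  also have "\<dots> = rank N lam i"
    unfolding rank_def by (rule card_Un_disjoint) auto
  finally show ?thesis
    using \<kappa>_neg by (simp add: spectral_def content_value_def field_simps)
qed

text \<open>Row neighbours have contents differing by 1, so the eigenvalues alone make
  \<open>d\<close> row-invariant. Then \<open>row_word\<close> applies to the part of maximal
  \<open>sumsq\<close>, and the degree, in place of column antisymmetry, forces the indices to be
  the row numbers. The word obtained is \<open>lam\<close>.\<close>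

lemma eigenvector_leading_coef:
  assumes d: "d \<noteq> 0" and sing: "\<And>i. i \<in> {1..N} \<Longrightarrow> dunkl N \<kappa> i d = 0"
    and hom: "d \<in> homogeneous N (weight N lam)"
    and eig: "\<And>i. i \<in> {1..N} \<Longrightarrow> jucys_murphy N i d = smul (content_value i) d"
  shows "lookup d lam \<noteq> 0"
proof -
  have adj: "act (transpose i (Suc i)) d = d" if i: "i \<in> {1..N}" "Suc i \<in> {1..N}" "t i = t (Suc i)" for i
  proof (rule act_adjacent_eq_self)
    have "lookup lam i = lookup lam (Suc i)"
      using lam_mono[of i "Suc i"] lam_mono[of "Suc i" i] i by simp
    then have "content_value i = content_value (Suc i) + 1"
      by (simp add: content_value_def)
    then show "jucys_murphy N i d = smul (content_value (Suc i) + 1) d"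
      using eig i by simp
  qed (use i eig in auto)
  have less: "act (transpose i j) d = smul 1 d" if ij: "i \<in> {1..N}" "j \<in> {1..N}" "t i = t j" "i < j" for i j
  proof (rule act_transpose_chain[where u = "\<lambda>k. k" and a = i and b = j])
    fix k assume k: "i \<le> k" "k < j"
    have "t k \<le> t i"
      using k ij by (intro t_antimono) auto
    moreover have "t (Suc k) \<le> t k"
      using k ij by (intro t_antimono) auto
    moreover have "t j \<le> t (Suc k)"
      using k ij by (intro t_antimono) auto
    ultimately have "t k = t (Suc k)" using ij by simp
    then show "act (transpose k (Suc k)) d = smul 1 d"
      using adj[of k] k ij by simp
  qed (use ij in auto)
  have inv: "act (transpose i j) d = d" if ij: "i \<in> {1..N}" "j \<in> {1..N}" "t i = t j" for i j
    using less[of i j] less[of j i] ij by (cases i j rule: linorder_cases) (auto simp: transpose_commute)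
  have word: "w \<in> words N \<and> (\<Sum>i\<in>{1..N}. w i) = weight N lam" if "coef d w \<noteq> 0" for w
    using homogeneous_word[OF hom that] by simp
  let ?S = "{w. coef d w \<noteq> 0}"
  have "?S \<noteq> {}" using d poly_eqI[of d 0] by auto
  then have "Max (sumsq N ` ?S) \<in> sumsq N ` ?S"
    using finite_coef_support by (intro Max_in) auto
  then obtain w0 where w0: "coef d w0 \<noteq> 0" "sumsq N w0 = Max (sumsq N ` ?S)" by auto
  have top: "coef d \<beta> = 0" if "sumsq N w0 < sumsq N \<beta>" for \<beta>
  proof (rule ccontr)
    assume "coef d \<beta> \<noteq> 0"
    then have "sumsq N \<beta> \<le> sumsq N w0"
      unfolding w0(2) using finite_coef_support by (intro Max_ge) auto
    then show False using that by simp
  qed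
  interpret F: top_function "{1..N}" \<kappa> "\<lambda>w. if w \<in> orbit N w0 then coef d w else 0"
      "\<lambda>x. card {i\<in>{1..N}. w0 i = x}" w0
    using \<kappa>_neg sing height_sumsq top orbit_self w0(1) by (rule top_function_coef)
  have "\<exists>w. (if w \<in> orbit N w0 then coef d w else 0) \<noteq> 0 \<and> (\<forall>i\<in>{1..N}. idx F.V (w i) \<le> t i)"
  proof (rule F.row_word)
    fix i j w assume ij: "i \<in> {1..N}" "j \<in> {1..N}" "t i = t j"
    have "coef d (w \<circ> transpose i j) = coef d w"
      using inv[OF ij] coef_act[of "transpose i j" d w] by simp
    then show "(if w \<circ> transpose i j \<in> orbit N w0 then coef d (w \<circ> transpose i j) else 0) =
        (if w \<in> orbit N w0 then coef d w else 0)"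
      using orbit_comp_iff[OF transpose_permutes[OF ij(1,2)]] by simp
  qed
  then obtain w where w: "w \<in> orbit N w0" "coef d w \<noteq> 0" and le: "\<And>i. i \<in> {1..N} \<Longrightarrow> idx F.V (w i) \<le> t i"
    by (auto split: if_splits)
  define y where "y i = card {j\<in>{1..N}. idx F.V (w j) < idx F.V (w i)} + idx F.V (w i)" for i
  have val: "of_nat (w i) = - \<kappa> * of_nat (y i)" if "i \<in> {1..N}" for i
    using F.value_eq_idx[of w i] w that by (simp add: y_def)
  \<comment> \<open>Both words have the degree of \<open>d\<close>, so the sums of
    \<open>row_value\<close> and of \<open>y\<close> agree.\<close>
  have "- \<kappa> * of_nat (\<Sum>i\<in>{1..N}. row_value i) = (\<Sum>i\<in>{1..N}. of_nat (lookup lam i))"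
    unfolding of_nat_sum sum_distrib_left using lam_value by (intro sum.cong) auto
  also have "\<dots> = of_nat (\<Sum>i\<in>{1..N}. w i)"
    using word[OF w(2)] by (simp add: weight_def flip: of_nat_sum)
  also have "\<dots> = - \<kappa> * of_nat (\<Sum>i\<in>{1..N}. y i)"
    unfolding of_nat_sum sum_distrib_left using val by (intro sum.cong) auto
  finally have "(of_nat (\<Sum>i\<in>{1..N}. row_value i) :: rat) = of_nat (\<Sum>i\<in>{1..N}. y i)"
    using \<kappa>_neg by simp
  then have "(\<Sum>i\<in>{1..N}. row_value i) = (\<Sum>i\<in>{1..N}. y i)"
    by (simp only: of_nat_eq_iff)
  then have eq: "idx F.V (w i) = t i" if "i \<in> {1..N}" for i
    using that le card_t_antimono by (intro pointwise_eq_if_degree_le[where I = "{1..N}"]) (auto simp: row_value_def y_def)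
  have "w = lookup lam"
  proof (rule lam_unique)
    fix i assume i: "i \<in> {1..N}"
    have "{j\<in>{1..N}. idx F.V (w j) < idx F.V (w i)} = {j\<in>{1..N}. t j < t i}"
      using eq i by auto
    then show "of_nat (w i) = - \<kappa> * of_nat (row_value i)"
      using val[OF i] eq[OF i] by (simp add: row_value_def y_def)
  qed (use word w in blast)
  then show ?thesis using w by simp
qed

end


section \<open>Irreducible modules of singular polynomials\<close>

locale singular_module = partition +
  fixes \<kappa> :: rat and M :: "rpoly set" and d :: nat and \<phi> :: "rpoly \<Rightarrow> rpoly"
  assumes \<kappa>_neg: "\<kappa> < 0"
    and homogeneous: "M \<subseteq> homogeneous N d"
    and irreducible: "irreducible_module N M"
    and kernel: "f \<in> M \<Longrightarrow> i \<in> {1..N} \<Longrightarrow> dunkl N \<kappa> i f = 0"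
    and iso_bij: "bij_betw \<phi> M (specht_module N \<tau>)"
    and iso_smul: "f \<in> M \<Longrightarrow> \<phi> (smul c f) = smul c (\<phi> f)"
    and iso_act: "f \<in> M \<Longrightarrow> w permutes {1..N} \<Longrightarrow> \<phi> (act w f) = act w (\<phi> f)"
begin

lemma subspace_M: "rpoly.subspace M"
  and act_M: "w permutes {1..N} \<Longrightarrow> f \<in> M \<Longrightarrow> act w f \<in> M"
  using irreducible by (auto simp: irreducible_module_def invariant_subspace_def)

lemma coef_word:
  assumes "f \<in> M" "coef f w \<noteq> 0" shows "w \<in> words N" "(\<Sum>i\<in>{1..N}. w i) = d"
  using homogeneous_word assms homogeneous by blast+

lemma ex_preimage:
  assumes "x \<in> specht_module N \<tau>" "x \<noteq> 0"
  obtains y where "y \<in> M" "\<phi> y = x" "y \<noteq> 0"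
proof -
  obtain y where y: "y \<in> M" "\<phi> y = x"
    using assms(1) iso_bij by (metis bij_betw_imp_surj_on imageE)
  have "\<phi> (smul 0 y) = smul 0 (\<phi> y)" using y iso_smul by blast
  then have "y \<noteq> 0" using y assms(2) by auto
  then show thesis using that y by blast
qed

lemma act_preimage:
  assumes "y \<in> M" "w permutes {1..N}" "act w (\<phi> y) = smul c (\<phi> y)"
  shows "act w y = smul c y"
proof -
  have "\<phi> (act w y) = \<phi> (smul c y)"
    using assms iso_act iso_smul by simp
  moreover have "act w y \<in> M" "smul c y \<in> M"
    using assms act_M subspace_M rpoly.subspace_scale by auto
  ultimately show ?thesis
    using iso_bij by (auto simp: bij_betw_def inj_on_def)
qed

text \<open>The elements of \<open>M\<close> whose coefficients vanish on the orbit form an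
  invariant subspace, which is 0 by irreducibility since it misses \<open>g\<close>.\<close>

lemma orbit_component_nonzero:
  assumes g: "g \<in> M" "coef g w0 \<noteq> 0" and f: "f \<in> M" "f \<noteq> 0"
  shows "\<exists>w\<in>orbit N w0. coef f w \<noteq> 0"
proof (rule ccontr)
  assume none: "\<not> ?thesis"
  define K where "K = {f\<in>M. \<forall>w\<in>orbit N w0. coef f w = 0}"
  have "rpoly.subspace K"
    using subspace_M by (auto simp: K_def rpoly.subspace_def)
  moreover have "act v f \<in> K" if "v permutes {1..N}" "f \<in> K" for v f
    using that act_M orbit_comp by (auto simp: K_def coef_act permutes_bij)
  ultimately have "invariant_subspace N K"
    by (simp add: invariant_subspace_def)
  then have "K = {0} \<or> K = M"
    using irreducible by (auto simp: irreducible_module_def K_def)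
  moreover have "f \<in> K" using none f by (auto simp: K_def)
  moreover have "g \<notin> K" using g orbit_self by (auto simp: K_def)
  ultimately show False using f g by auto
qed

text \<open>All words occurring in \<open>M\<close> have entry sum \<open>d\<close>, so there are
  finitely many of them.\<close>

lemma ex_top_word:
  fixes h :: "(nat \<Rightarrow> nat) \<Rightarrow> nat"
  obtains g w0 where "g \<in> M" "coef g w0 \<noteq> 0" "\<And>f w. f \<in> M \<Longrightarrow> coef f w \<noteq> 0 \<Longrightarrow> h w \<le> h w0"
proof -
  let ?S = "{w. \<exists>f\<in>M. coef f w \<noteq> 0}"
  have "?S \<subseteq> {w. \<forall>i. (i \<in> {1..N} \<longrightarrow> w i \<in> {..d}) \<and> (i \<notin> {1..N} \<longrightarrow> w i = 0)}"
  proof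
    fix w assume "w \<in> ?S"
    then have "w \<in> words N" "(\<Sum>i\<in>{1..N}. w i) = d"
      using coef_word by blast+
    then show "w \<in> {w. \<forall>i. (i \<in> {1..N} \<longrightarrow> w i \<in> {..d}) \<and> (i \<notin> {1..N} \<longrightarrow> w i = 0)}"
      using member_le_sum[of _ "{1..N}" w] by (auto simp: words_def)
  qed
  moreover have "finite {w :: nat \<Rightarrow> nat. \<forall>i. (i \<in> {1..N} \<longrightarrow> w i \<in> {..d}) \<and> (i \<notin> {1..N} \<longrightarrow> w i = 0)}"
    by (rule finite_set_of_finite_funs) simp_all
  ultimately have fin: "finite ?S" by (rule finite_subset)
  obtain f where f: "f \<in> M" "f \<noteq> 0"
    using irreducible rpoly.subspace_0[OF subspace_M] by (auto simp: irreducible_module_def)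
  then obtain w where "coef f w \<noteq> 0" using poly_eqI[of f 0] by auto
  then have "?S \<noteq> {}" using f by auto
  then have "Max (h ` ?S) \<in> h ` ?S"
    using fin by (intro Max_in) auto
  then obtain w0 where w0: "h w0 = Max (h ` ?S)" "w0 \<in> ?S"
    by (rule imageE) (rule that, simp_all)
  then obtain g where "g \<in> M" "coef g w0 \<noteq> 0" by auto
  then show thesis
    by (rule that) (use w0(1) fin in \<open>auto intro!: Max_ge\<close>)
qed

text \<open>The row-invariant \<open>p\<close> provides a word in the orbit with indices at most the
  row numbers. The column-antisymmetric \<open>q\<close> provides another with distinct letters in
  every column, so its index sum is at least the sum of the row numbers. Index sums agree on an
  orbit, which forces equality.\<close>

lemma top_orbit:
  assumes p: "p \<in> M" "\<phi> p = row_vector"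
    and h: "height N h" and g: "g \<in> M" "coef g w0 \<noteq> 0"
    and top: "\<And>f w. f \<in> M \<Longrightarrow> coef f w \<noteq> 0 \<Longrightarrow> h w \<le> h w0"
  shows "\<exists>w\<in>orbit N w0. coef p w \<noteq> 0 \<and> (\<forall>i\<in>{1..N}. of_nat (w i) = - \<kappa> * of_nat (row_value i))"
proof -
  have "p \<noteq> 0"
  proof
    assume "p = 0"
    then have "\<phi> (smul 0 p) = smul 0 (\<phi> p)" using p iso_smul by blast
    then show False using \<open>p = 0\<close> p row_vector_nonzero by simp
  qed
  have top': "coef p \<beta> = 0" if "h w0 < h \<beta>" for \<beta>
    using top[OF p(1), of \<beta>] that by force
  obtain w1 where w1: "w1 \<in> orbit N w0" "coef p w1 \<noteq> 0"
    using orbit_component_nonzero[OF g p(1) \<open>p \<noteq> 0\<close>] by auto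
  interpret F: top_function "{1..N}" \<kappa> "\<lambda>w. if w \<in> orbit N w0 then coef p w else 0"
      "\<lambda>x. card {i\<in>{1..N}. w0 i = x}" w1
    using \<kappa>_neg kernel[OF p(1)] h top' w1 by (rule top_function_coef)
  have "\<exists>w. (if w \<in> orbit N w0 then coef p w else 0) \<noteq> 0 \<and> (\<forall>i\<in>{1..N}. idx F.V (w i) \<le> t i)"
  proof (rule F.row_word)
    fix i j w assume ij: "i \<in> {1..N}" "j \<in> {1..N}" "t i = t j"
    have "act (transpose i j) p = smul 1 p"
      using ij by (intro act_preimage[OF p(1)] transpose_permutes) (simp_all add: p(2) act_row_vector)
    then have "coef p (w \<circ> transpose i j) = coef p w"
      using coef_act[of "transpose i j" p w] by simp
    then show "(if w \<circ> transpose i j \<in> orbit N w0 then coef p (w \<circ> transpose i j) else 0) =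
        (if w \<in> orbit N w0 then coef p w else 0)"
      using orbit_comp_iff[OF transpose_permutes[OF ij(1,2)]] by simp
  qed
  then obtain w where w: "w \<in> orbit N w0" "coef p w \<noteq> 0" and le: "\<And>i. i \<in> {1..N} \<Longrightarrow> idx F.V (w i) \<le> t i"
    by (auto split: if_splits)
  have "specht_poly \<tau> T \<noteq> 0"
  proof
    assume "specht_poly \<tau> T = 0"
    then have "row_vector = 0" by (simp add: row_vector_def)
    then show False using row_vector_nonzero by simp
  qed
  then obtain q where q: "q \<in> M" "\<phi> q = specht_poly \<tau> T" "q \<noteq> 0"
    using ex_preimage specht_polys_in_module[OF T_tableaux] by metis
  obtain u where u: "u \<in> orbit N w0" "coef q u \<noteq> 0"
    using orbit_component_nonzero[OF g q(1,3)] by auto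
  have V: "u i \<in> F.V" if "i \<in> {1..N}" for i
  proof -
    have "i \<in> {k\<in>{1..N}. u k = u i}" using that by simp
    then have "card {k\<in>{1..N}. u k = u i} \<noteq> 0" by (auto simp del: atLeastAtMost_iff)
    then show ?thesis unfolding F.V_def orbit_card[OF u(1)] by blast
  qed
  have "(\<Sum>i\<in>{1..N}. t i) \<le> (\<Sum>i\<in>{1..N}. idx F.V (u i))"
  proof (rule sum_t_le_if_columns_distinct)
    fix r r' c assume rc: "(r, c) \<in> cells \<tau>" "(r', c) \<in> cells \<tau>" "r \<noteq> r'"
    let ?s = "transpose (T (r, c)) (T (r', c))"
    have "u (T (r, c)) \<noteq> u (T (r', c))"
    proof
      assume "u (T (r, c)) = u (T (r', c))"
      \<comment> \<open>Equal letters in a column would make the coefficient of \<open>q\<close> at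
        \<open>u\<close> its own negative.\<close>
      then have "u \<circ> ?s = u" by (auto simp: fun_eq_iff transpose_def)
      moreover have "act ?s q = smul (- 1) q"
        using T_in[OF rc(1)] T_in[OF rc(2)] act_column_transpose[OF rc]
        by (intro act_preimage[OF q(1)] transpose_permutes) (simp_all add: q(2))
      ultimately have "coef q u = - coef q u"
        using coef_act[of ?s q u] by simp
      then show False using u by simp
    qed
    then show "idx F.V (u (T (r, c))) \<noteq> idx F.V (u (T (r', c)))"
      using F.idx_less_iff[OF V[OF T_in[OF rc(1)]] V[OF T_in[OF rc(2)]]]
        F.idx_less_iff[OF V[OF T_in[OF rc(2)]] V[OF T_in[OF rc(1)]]] by linarith
  qed
  also have "\<dots> = (\<Sum>i\<in>{1..N}. idx F.V (w i))"
    by (rule trans[OF orbit_sum[OF u(1)] orbit_sum[OF w(1), symmetric]])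
  finally have eq: "idx F.V (w i) = t i" if "i \<in> {1..N}" for i
    using that le by (intro pointwise_eq_if_sum_le[where I = "{1..N}"]) auto
  have "of_nat (w i) = - \<kappa> * of_nat (row_value i)" if i: "i \<in> {1..N}" for i
  proof -
    have "{j\<in>{1..N}. idx F.V (w j) < idx F.V (w i)} = {j\<in>{1..N}. t j < t i}"
      using eq i by auto
    then show ?thesis
      using F.value_eq_idx[of w i] w i eq[OF i] by (simp add: row_value_def)
  qed
  then show ?thesis using w by blast
qed

text \<open>\<open>top_orbit\<close> returns the same word whichever height is maximized. Using
  \<open>sumsq\<close> finds \<open>lam\<close>; using a height dominated by
  \<open>topsum N k\<close>, for each k, shows that \<open>lam\<close> also maximizes that
  quantity.\<close>

lemma ex_row_exponent:
  obtains lam p where "row_exponent N \<tau> \<kappa> lam" "p \<in> M" "lookup p lam \<noteq> 0"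
    "\<And>k f \<beta>. k \<le> N \<Longrightarrow> f \<in> M \<Longrightarrow> \<beta> \<in> keys f \<Longrightarrow> topsum N k (lookup \<beta>) \<le> topsum N k (lookup lam)"
    "\<And>f w. f \<in> M \<Longrightarrow> coef f w \<noteq> 0 \<Longrightarrow> sumsq N w \<le> sumsq N (lookup lam)"
proof -
  obtain p where p: "p \<in> M" "\<phi> p = row_vector"
    using ex_preimage row_vector_in_module row_vector_nonzero by metis
  obtain g w0 where g: "g \<in> M" "coef g w0 \<noteq> 0" "\<And>f w. f \<in> M \<Longrightarrow> coef f w \<noteq> 0 \<Longrightarrow> sumsq N w \<le> sumsq N w0"
    using ex_top_word[of "sumsq N"] by blast
  obtain w where w: "w \<in> orbit N w0" "coef p w \<noteq> 0"
      "\<And>i. i \<in> {1..N} \<Longrightarrow> of_nat (w i) = - \<kappa> * of_nat (row_value i)"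
    using top_orbit[OF p height_sumsq g(1,2)] g(3) by blast
  define lam where "lam = Abs_poly_mapping w"
  have lam: "lookup lam = w"
    using w(2) by (auto simp: lam_def coef_def split: if_splits)
  interpret R: row_exponent N \<tau> \<kappa> lam
  proof
    show "lam \<in> expos N"
      using coef_word[OF p(1) w(2)] by (simp add: words_expos[symmetric] lam)
  qed (use w \<kappa>_neg in \<open>simp_all add: lam\<close>)
  have "topsum N k (lookup \<beta>) \<le> topsum N k (lookup lam)" if k: "k \<le> N" "f \<in> M" "\<beta> \<in> keys f" for k f \<beta>
  proof (rule ccontr)
    assume gr: "\<not> ?thesis"
    \<comment> \<open>With weight \<open>sumsq N w + 1\<close>, gaining one unit of
      \<open>topsum\<close> outweighs all of \<open>sumsq N w\<close>.\<close>
    define h where "h u = (sumsq N w + 1) * topsum N k u + sumsq N u" for u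
    have h: "height N h" unfolding h_def using k(1) by (rule height_topsum)
    obtain g w0 where g: "g \<in> M" "coef g w0 \<noteq> 0" "\<And>f u. f \<in> M \<Longrightarrow> coef f u \<noteq> 0 \<Longrightarrow> h u \<le> h w0"
      using ex_top_word[of h] by blast
    obtain u where u: "u \<in> orbit N w0" "coef p u \<noteq> 0"
        "\<And>i. i \<in> {1..N} \<Longrightarrow> of_nat (u i) = - \<kappa> * of_nat (row_value i)"
      using top_orbit[OF p h g(1,2)] g(3) by blast
    have "u = w"
      using R.lam_unique[OF _ u(3)] coef_word(1)[OF p(1) u(2)] by (simp add: lam)
    then have "h (lookup \<beta>) \<le> h w"
      using g(3)[of f "lookup \<beta>"] k orbit_height[OF h u(1)] by (simp add: in_keys_iff)
    moreover have "Suc (topsum N k w) \<le> topsum N k (lookup \<beta>)"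
      using gr by (simp add: lam)
    then have "(sumsq N w + 1) * Suc (topsum N k w) \<le> (sumsq N w + 1) * topsum N k (lookup \<beta>)"
      by (rule mult_le_mono2)
    ultimately show False by (simp add: h_def)
  qed
  moreover have "sumsq N u \<le> sumsq N (lookup lam)" if "f \<in> M" "coef f u \<noteq> 0" for f u
    using g(3)[OF that] orbit_height[OF height_sumsq w(1)] by (simp add: lam)
  moreover have "lookup p lam \<noteq> 0" using w(2) lam coef_lookup by metis
  ultimately show thesis
    using that R.row_exponent_axioms p(1) by blast
qed

end

section \<open>The eigenvector with leading exponent \<lambda>\<close>

locale singular_module_exponent = singular_module + row_exponent +
  assumes sumsq_le: "f \<in> M \<Longrightarrow> coef f w \<noteq> 0 \<Longrightarrow> sumsq N w \<le> sumsq N (lookup lam)"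
    and topsum_le: "k \<le> N \<Longrightarrow> f \<in> M \<Longrightarrow> \<beta> \<in> keys f \<Longrightarrow> topsum N k (lookup \<beta>) \<le> topsum N k (lookup lam)"
begin

text \<open>As \<open>lam\<close> is nonincreasing, the positions after \<open>i\<close> carry
  smaller or equal letters, and they include all smaller ones. The smaller ones are summed by
  \<open>star_top\<close>; swapping equal ones fixes \<open>lam\<close>. Together they number N -
  i.\<close>

lemma lookup_jucys_murphy:
  assumes f: "f \<in> M" and i: "i \<in> {1..N}"
  shows "lookup (jucys_murphy N i f) lam = content_value i * lookup f lam"
proof -
  let ?w = "lookup lam"
  let ?L = "{j\<in>{1..N}. ?w j < ?w i}" and ?E = "{j\<in>{i<..N}. ?w j = ?w i}"
  have split: "{i<..N} = ?L \<union> ?E" "?L \<inter> ?E = {}"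
  proof -
    have "j \<in> {i<..N}" if "j \<in> ?L" for j
      using that lam_antimono[of j i] i by (cases "j \<le> i") auto
    moreover have "?w j \<le> ?w i" if "j \<in> {i<..N}" for j
      using that lam_antimono[of i j] i by auto
    ultimately show "{i<..N} = ?L \<union> ?E" using i by force
  qed auto
  have "coef f \<beta> = 0" if "sumsq N ?w < sumsq N \<beta>" for \<beta>
    using sumsq_le[OF f, of \<beta>] that by force
  then have "(of_nat (?w i) + \<kappa> * of_nat (card ?L)) * coef f ?w = \<kappa> * (\<Sum>j\<in>?L. coef f (?w \<circ> transpose i j))"
    using star_top[OF i kernel[OF f i] height_sumsq] by blast
  then have L: "(\<Sum>j\<in>?L. coef f (?w \<circ> transpose i j)) = (of_nat (?w i) / \<kappa> + of_nat (card ?L)) * lookup f lam"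
    using \<kappa>_neg by (simp add: field_simps)
  have "?w \<circ> transpose i j = ?w" if "?w j = ?w i" for j
    using that by (auto simp: fun_eq_iff transpose_def)
  then have E: "(\<Sum>j\<in>?E. coef f (?w \<circ> transpose i j)) = of_nat (card ?E) * lookup f lam"
    by simp
  have "card ?L + card ?E = card {i<..N}"
    using card_Un_disjoint[OF _ _ split(2)] arg_cong[OF split(1), of card] by simp
  then have c: "of_nat (card ?L) + of_nat (card ?E) = (of_nat N - of_nat i :: rat)"
    using i by (simp add: of_nat_diff flip: of_nat_add)
  have "lookup (jucys_murphy N i f) lam = (\<Sum>j\<in>{i<..N}. coef f (?w \<circ> transpose i j))"
    by (simp add: jucys_murphy_def coef_act flip: coef_lookup)
  also have "\<dots> = (\<Sum>j\<in>?L. coef f (?w \<circ> transpose i j)) + (\<Sum>j\<in>?E. coef f (?w \<circ> transpose i j))"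
    by (subst split(1), rule sum.union_disjoint) (use split(2) in auto)
  also have "\<dots> = (of_nat (?w i) / \<kappa> + (of_nat (card ?L) + of_nat (card ?E))) * lookup f lam"
    unfolding L E by (simp add: algebra_simps)
  finally show ?thesis unfolding c content_value_def .
qed

text \<open>
  The coefficient of \<open>x\<^sup>\<lambda>\<close> is a simultaneous eigenfunctional of the Jucys-Murphy elements on \<open>M\<close>;
  averaging \<open>w f\<close> against its own coefficient over the group turns it into an eigenvector.
\<close>

lemma ex_eigenvector:
  assumes f: "f \<in> M" "lookup f lam \<noteq> 0"
  obtains g where "g \<in> M" "lookup g lam = 1"
    "\<And>i. i \<in> {1..N} \<Longrightarrow> jucys_murphy N i g = smul (content_value i) g"
proof -
  define G where "G = {w. w permutes {1..N}}"
  define a where "a w = lookup (act w f) lam" for w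
  define g where "g = (\<Sum>w\<in>G. smul (a w) (act w f))"
  have finG: "finite G" by (simp add: G_def finite_permutations)
  have act_f: "act w f \<in> M" if "w \<in> G" for w
    using that f act_M by (simp add: G_def)
  then have g: "g \<in> M"
    unfolding g_def using subspace_M by (intro rpoly.subspace_sum rpoly.subspace_scale) auto
  \<comment> \<open>Reindexing by w \<mapsto> s \<circ> w moves \<open>s\<close> from the polynomial
    to its coefficient, because \<open>s\<close> is its own inverse.\<close>
  have act_g: "act s g = (\<Sum>w\<in>G. smul (lookup (act s (act w f)) lam) (act w f))"
    if s: "s = transpose i j" "i \<in> {1..N}" "j \<in> {1..N}" for s i j
  proof -
    have sG: "s \<circ> w \<in> G" if "w \<in> G" for w
      using permutes_compose[OF _ transpose_permutes[OF s(2,3)], of w] that s(1) by (simp add: G_def)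
    have ss: "s \<circ> (s \<circ> w) = w" for w :: "nat \<Rightarrow> nat"
      using s by (simp add: comp_assoc[symmetric])
    have "act s g = (\<Sum>w\<in>G. smul (a w) (act (s \<circ> w) f))"
      by (simp add: g_def act_sum act_smul act_act)
    also have "\<dots> = (\<Sum>w\<in>G. smul (a (s \<circ> w)) (act w f))"
      by (rule sum.reindex_bij_witness[where i = "\<lambda>w. s \<circ> w" and j = "\<lambda>w. s \<circ> w"])
        (use sG ss in auto)
    finally show ?thesis by (simp add: a_def act_act)
  qed
  have eig: "jucys_murphy N i g = smul (content_value i) g" if i: "i \<in> {1..N}" for i
  proof -
    have "jucys_murphy N i g = (\<Sum>j\<in>{i<..N}. \<Sum>w\<in>G. smul (lookup (act (transpose i j) (act w f)) lam) (act w f))"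
      unfolding jucys_murphy_def using i by (intro sum.cong act_g) auto
    also have "\<dots> = (\<Sum>w\<in>G. \<Sum>j\<in>{i<..N}. smul (lookup (act (transpose i j) (act w f)) lam) (act w f))"
      by (rule sum.swap)
    also have "\<dots> = (\<Sum>w\<in>G. smul (lookup (jucys_murphy N i (act w f)) lam) (act w f))"
      by (simp add: jucys_murphy_def lookup_sum rpoly.scale_sum_left)
    also have "\<dots> = (\<Sum>w\<in>G. smul (content_value i) (smul (a w) (act w f)))"
      using lookup_jucys_murphy[OF act_f i] by (intro sum.cong) (auto simp: a_def)
    finally show ?thesis by (simp add: g_def rpoly.scale_sum_right)
  qed
  \<comment> \<open>A sum of squares, positive because of the summand for the identity.\<close>
  have "lookup g lam = (\<Sum>w\<in>G. a w * a w)"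
    by (simp add: g_def lookup_sum a_def)
  moreover have "(\<Sum>w\<in>G. a w * a w) > 0"
  proof (rule sum_pos2[OF finG])
    show "id \<in> G" by (simp add: G_def permutes_id)
    show "0 < a id * a id" using f by (auto simp: a_def zero_less_mult_iff linorder_neq_iff)
  qed simp
  ultimately have nz: "lookup g lam \<noteq> 0" by simp
  show thesis
  proof (rule that)
    show "smul (1 / lookup g lam) g \<in> M"
      using g subspace_M by (simp add: rpoly.subspace_scale)
    show "lookup (smul (1 / lookup g lam) g) lam = 1" using nz by simp
    fix i assume "i \<in> {1..N}"
    then show "jucys_murphy N i (smul (1 / lookup g lam) g) = smul (content_value i) (smul (1 / lookup g lam) g)"
      by (simp add: jucys_murphy_smul eig mult.commute)
  qed
qed

lemma leading_form:
  assumes g: "g \<in> M" "lookup g lam = 1"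
  shows "has_leading_form N lam g"
proof (rule leading_formI)
  have hom: "g \<in> homogeneous N d" using g homogeneous by auto
  then show "g \<in> polys N" by (simp add: homogeneous_def)
  have "lam \<in> keys g" using g by (simp add: in_keys_iff)
  fix \<beta> assume \<beta>: "\<beta> \<in> keys g" "\<beta> \<noteq> lam"
  then show "below N \<beta> lam"
    using hom \<open>lam \<in> keys g\<close> topsum_le[OF _ g(1) \<beta>(1)]
    by (intro below_if_topsum_le lam_partition) (auto simp: homogeneous_def polys_def)
qed (rule g(2))

end


section \<open>Singular polynomials of a given isotype\<close>

text \<open>By equivariance the common kernel of the Dunkl operators in \<open>M\<close> is an
  invariant subspace; it contains p \<noteq> 0, so it is all of \<open>M\<close>.\<close>

lemma irreducible_module_dunkl_eq_0:
  assumes irr: "irreducible_module N M" and p: "p \<in> M" "p \<noteq> 0" "\<And>i. i \<in> {1..N} \<Longrightarrow> dunkl N \<kappa> i p = 0"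
    and f: "f \<in> M" "i \<in> {1..N}"
  shows "dunkl N \<kappa> i f = 0"
proof -
  define K where "K = {f\<in>M. \<forall>i\<in>{1..N}. dunkl N \<kappa> i f = 0}"
  have M: "rpoly.subspace M" "\<And>w f. w permutes {1..N} \<Longrightarrow> f \<in> M \<Longrightarrow> act w f \<in> M"
    using irr by (auto simp: irreducible_module_def invariant_subspace_def)
  have "dunkl N \<kappa> i 0 = 0" for i
    using dunkl_smul[of N \<kappa> i 0 0] by simp
  then have "rpoly.subspace K"
    using M(1) by (auto simp: K_def rpoly.subspace_def dunkl_add dunkl_smul)
  moreover have "act w f \<in> K" if w: "w permutes {1..N}" and f: "f \<in> K" for w f
  proof -
    have "dunkl N \<kappa> i (act w f) = 0" if i: "i \<in> {1..N}" for i
    proof -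
      have j: "inv w i \<in> {1..N}" "w (inv w i) = i"
        using i w permutes_in_image[OF permutes_inv[OF w]] permutes_inverses(1)[OF w] by auto
      then show ?thesis
        using dunkl_act[OF w j(1), of \<kappa> f] f by (simp add: K_def)
    qed
    then show ?thesis using f M(2)[OF w] by (simp add: K_def)
  qed
  ultimately have "invariant_subspace N K"
    by (simp add: invariant_subspace_def)
  then have "K = {0} \<or> K = M"
    using irr by (auto simp: irreducible_module_def K_def)
  moreover have "p \<in> K" using p by (simp add: K_def)
  ultimately have "f \<in> K" using p(2) f(1) by auto
  then show ?thesis using f(2) by (simp add: K_def)
qed

lemma lookup_pos_if_le_part_length:
  assumes "partition_of N \<tau>" "1 \<le> N" "s \<le> part_length \<tau>" "1 \<le> s"
  shows "1 \<le> lookup \<tau> s"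
proof -
  interpret partition N \<tau> by standard (rule assms(1))
  let ?S = "{j. 1 \<le> j \<and> 1 \<le> lookup \<tau> j}"
  have "?S \<subseteq> keys \<tau>" by (auto simp: in_keys_iff)
  then have fin: "finite ?S" by (rule finite_subset) simp
  have "1 \<in> ?S"
  proof (rule ccontr)
    assume "1 \<notin> ?S"
    then have "lookup \<tau> j = 0" if "1 \<le> j" for j
      using lookup_antimono[of 1 j] that by simp
    then have "weight N \<tau> = 0" by (simp add: weight_def)
    then show False using assms by (simp add: partition_of_def)
  qed
  then have "part_length \<tau> \<in> ?S"
    unfolding part_length_def using fin by (intro Max_in) auto
  then show ?thesis
    using lookup_antimono[of s "part_length \<tau>"] assms by simp
qed

theorem theorem2:
  fixes N m n :: nat and \<kappa>0 :: rat and \<tau> :: expo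
  assumes "m > 0" and "n > 0" and "coprime m n" and "2 \<le> n" and "n \<le> N"
    and "\<kappa>0 = - (of_nat m / of_nat n)"
    and "partition_of N \<tau>"
    and "\<exists>p. singular N \<kappa>0 p \<and> of_isotype N \<tau> p"
  shows "(\<forall>i. 1 \<le> i \<and> i < part_length \<tau> \<longrightarrow> n dvd lookup \<tau> i + 1) \<and>
    (\<exists>lam. is_partition N lam \<and>
      (\<forall>s i. 1 \<le> s \<and> s \<le> part_length \<tau> \<and>
             (\<Sum>j=1..<s. lookup \<tau> j) < i \<and> i \<le> (\<Sum>j=1..s. lookup \<tau> j) \<longrightarrow>
             of_nat (lookup lam (N + 1 - i)) = - \<kappa>0 * (\<Sum>j=1..<s. of_nat (lookup \<tau> j + 1))) \<and>
      (\<exists>!g. singular N \<kappa>0 g \<and> of_isotype N \<tau> g \<and> has_leading_form N lam g \<and>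
            (\<forall>i\<in>{1..N}. dunkl_U N \<kappa>0 i g = smul (spectral N lam i \<kappa>0) g)))"
proof -
  have \<kappa>: "\<kappa>0 < 0" using assms by simp
  obtain p0 d M where p0: "singular N \<kappa>0 p0" "p0 \<in> M" and M: "M \<subseteq> homogeneous N d" "irreducible_module N M"
      "modules_isomorphic N M (specht_module N \<tau>)"
    using assms(8) by (auto simp: of_isotype_def)
  then obtain \<phi> where \<phi>: "bij_betw \<phi> M (specht_module N \<tau>)"
      "\<And>c f. f \<in> M \<Longrightarrow> \<phi> (smul c f) = smul c (\<phi> f)"
      "\<And>w f. f \<in> M \<Longrightarrow> w permutes {1..N} \<Longrightarrow> \<phi> (act w f) = act w (\<phi> f)"
    unfolding modules_isomorphic_def by blast
  interpret singular_module N \<tau> \<kappa>0 M d \<phi>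
  proof
    show "dunkl N \<kappa>0 i f = 0" if "f \<in> M" "i \<in> {1..N}" for f i
    proof (rule irreducible_module_dunkl_eq_0[OF M(2) p0(2)])
      show "p0 \<noteq> 0" using p0(1) by (simp add: singular_def)
      show "dunkl N \<kappa>0 i p0 = 0" if "i \<in> {1..N}" for i
        using p0(1) that by (simp add: singular_def)
    qed (use that in simp_all)
  qed (fact \<kappa> assms(7) M(1,2) \<phi>)+
  obtain lam p where lam: "row_exponent N \<tau> \<kappa>0 lam" and p: "p \<in> M" "lookup p lam \<noteq> 0"
    and topsum: "\<And>k f \<beta>. k \<le> N \<Longrightarrow> f \<in> M \<Longrightarrow> \<beta> \<in> keys f \<Longrightarrow> topsum N k (lookup \<beta>) \<le> topsum N k (lookup lam)"
    and sumsq: "\<And>f w. f \<in> M \<Longrightarrow> coef f w \<noteq> 0 \<Longrightarrow> sumsq N w \<le> sumsq N (lookup lam)"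
    by (rule ex_row_exponent) (rule that)
  interpret row_exponent N \<tau> \<kappa>0 lam by (rule lam)
  interpret singular_module_exponent N \<tau> \<kappa>0 M d \<phi> lam
    by standard (use topsum sumsq in auto)
  have lam_row: "of_nat (lookup lam (N + 1 - i)) = - \<kappa>0 * of_nat (\<Sum>j=1..<s. lookup \<tau> j + 1)"
    if s: "1 \<le> s" "(\<Sum>j=1..<s. lookup \<tau> j) < i" "i \<le> (\<Sum>j=1..s. lookup \<tau> j)" for s i
  proof -
    \<comment> \<open>The column of the cell in row \<open>s\<close> that carries the number N + 1 -
      i.\<close>
    define c where "c = i - row_start \<tau> s"
    have i: "i = row_start \<tau> s + c" "1 \<le> c"
      using s by (auto simp: c_def row_start_def)
    have "(\<Sum>j=1..s. lookup \<tau> j) = row_start \<tau> s + lookup \<tau> s"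
      using row_start_Suc[OF s(1)] by (simp add: row_start_def atLeastLessThanSuc_atLeastAtMost)
    then have cell: "(s, c) \<in> cells \<tau>"
      using s i by (simp add: cells_def)
    then have "of_nat (lookup lam (T (s, c))) = - \<kappa>0 * of_nat (row_value (T (s, c)))"
      by (intro lam_value T_in)
    then show ?thesis
      unfolding row_value_T[OF cell] by (simp add: row_reading_def i)
  qed
  have dvd: "n dvd (\<Sum>j=1..<s. lookup \<tau> j + 1)" if s: "1 \<le> s" "s \<le> part_length \<tau>" for s
  proof -
    have "1 \<le> lookup \<tau> s"
      using lookup_pos_if_le_part_length assms s by simp
    \<comment> \<open>The first cell of row \<open>s\<close> exists because \<open>s\<close> is at
      most the length; integrality of the entry of \<open>lam\<close> there yields the
      divisibility.\<close>
    then have b: "(\<Sum>j=1..<s. lookup \<tau> j) < Suc (row_start \<tau> s)" "Suc (row_start \<tau> s) \<le> (\<Sum>j=1..s. lookup \<tau> j)"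
      using row_start_Suc[OF s(1)] by (simp_all add: row_start_def atLeastLessThanSuc_atLeastAtMost)
    have "of_nat (lookup lam (N + 1 - Suc (row_start \<tau> s))) * of_nat n = (of_nat m * of_nat (\<Sum>j=1..<s. lookup \<tau> j + 1) :: rat)"
      using lam_row[OF s(1) b] assms(2,6) by (simp add: field_simps)
    then have "lookup lam (N + 1 - Suc (row_start \<tau> s)) * n = m * (\<Sum>j=1..<s. lookup \<tau> j + 1)"
      by (metis of_nat_eq_iff of_nat_mult)
    then have "n dvd m * (\<Sum>j=1..<s. lookup \<tau> j + 1)" by (metis dvd_triv_right)
    then show ?thesis
      using assms(3) by (simp add: coprime_commute coprime_dvd_mult_right_iff)
  qed
  have "n dvd lookup \<tau> i + 1" if i: "1 \<le> i" "i < part_length \<tau>" for i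
  proof -
    \<comment> \<open>Two consecutive sums are divisible, hence so is their difference; i <
      \<open>part_length \<tau>\<close> makes row i + 1 available.\<close>
    have "n dvd (\<Sum>j=1..<i. lookup \<tau> j + 1) + (lookup \<tau> i + 1)"
      using dvd[of "Suc i"] i by simp
    moreover have "n dvd (\<Sum>j=1..<i. lookup \<tau> j + 1)"
      using dvd[of i] i by linarith
    ultimately show ?thesis
      by (metis dvd_add_right_iff)
  qed
  moreover have "\<exists>!g. singular N \<kappa>0 g \<and> of_isotype N \<tau> g \<and> has_leading_form N lam g \<and>
            (\<forall>i\<in>{1..N}. dunkl_U N \<kappa>0 i g = smul (spectral N lam i \<kappa>0) g)"
  proof (rule ex_ex1I)
    obtain g where g: "g \<in> M" "lookup g lam = 1"
        and eig: "\<And>i. i \<in> {1..N} \<Longrightarrow> jucys_murphy N i g = smul (content_value i) g"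
      using ex_eigenvector[OF p] by blast
    have "dunkl_U N \<kappa>0 i g = smul (spectral N lam i \<kappa>0) g" if "i \<in> {1..N}" for i
      using that by (simp add: dunkl_U_kernel kernel[OF g(1)] eig spectral_lam rpoly.scale_left_distrib)
    moreover have "singular N \<kappa>0 g"
      using g homogeneous kernel by (auto simp: singular_def homogeneous_def)
    moreover have "of_isotype N \<tau> g"
      using g M by (auto simp: of_isotype_def)
    ultimately show "\<exists>g. singular N \<kappa>0 g \<and> of_isotype N \<tau> g \<and> has_leading_form N lam g \<and>
            (\<forall>i\<in>{1..N}. dunkl_U N \<kappa>0 i g = smul (spectral N lam i \<kappa>0) g)"
      using leading_form[OF g] by blast
  next
    fix g h
    assume g: "singular N \<kappa>0 g \<and> of_isotype N \<tau> g \<and> has_leading_form N lam g \<and>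
            (\<forall>i\<in>{1..N}. dunkl_U N \<kappa>0 i g = smul (spectral N lam i \<kappa>0) g)"
      and h: "singular N \<kappa>0 h \<and> of_isotype N \<tau> h \<and> has_leading_form N lam h \<and>
            (\<forall>i\<in>{1..N}. dunkl_U N \<kappa>0 i h = smul (spectral N lam i \<kappa>0) h)"
    have props: "lookup f lam = 1" "f \<in> homogeneous N (weight N lam)"
        "\<And>i. i \<in> {1..N} \<Longrightarrow> dunkl N \<kappa>0 i f = 0"
        "\<And>i. i \<in> {1..N} \<Longrightarrow> jucys_murphy N i f = smul (content_value i) f"
      if f: "singular N \<kappa>0 f \<and> of_isotype N \<tau> f \<and> has_leading_form N lam f \<and>
            (\<forall>i\<in>{1..N}. dunkl_U N \<kappa>0 i f = smul (spectral N lam i \<kappa>0) f)" for f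
    proof -
      show one: "lookup f lam = 1" using f leading_form_lookup by blast
      \<comment> \<open>The candidate may come from a module other than \<open>M\<close>; its degree
        is recovered from the leading coefficient 1 at \<open>lam\<close>.\<close>
      obtain d where "f \<in> homogeneous N d" using f by (auto simp: of_isotype_def)
      moreover from this have "weight N lam = d"
        using one by (auto simp: homogeneous_def in_keys_iff)
      ultimately show "f \<in> homogeneous N (weight N lam)" by simp
      show ker: "dunkl N \<kappa>0 i f = 0" if "i \<in> {1..N}" for i
        using f that by (simp add: singular_def)
      fix i assume i: "i \<in> {1..N}"
      then have "f + smul \<kappa>0 (jucys_murphy N i f) = smul (1 + \<kappa>0 * content_value i) f"
        using f ker by (simp add: dunkl_U_kernel spectral_lam)
      then have "smul \<kappa>0 (jucys_murphy N i f) = smul \<kappa>0 (smul (content_value i) f)"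
        by (simp add: rpoly.scale_left_distrib)
      then show "jucys_murphy N i f = smul (content_value i) f"
        using \<kappa> rpoly.scale_left_imp_eq[of \<kappa>0] by blast
    qed
    note pg = props[OF g] and ph = props[OF h]
    show "g = h"
    proof (rule ccontr)
      assume "g \<noteq> h"
      \<comment> \<open>The leading terms of the two candidates cancel, while a nonzero eigenvector
        with these eigenvalues must involve the exponent \<open>lam\<close>.\<close>
      have "lookup (g - h) lam \<noteq> 0"
      proof (rule eigenvector_leading_coef)
        show "g - h \<noteq> 0" using \<open>g \<noteq> h\<close> by simp
        show "dunkl N \<kappa>0 i (g - h) = 0" if "i \<in> {1..N}" for i
          using pg(3)[OF that] ph(3)[OF that] dunkl_add[of N \<kappa>0 i "g - h" h] by simp
        show "g - h \<in> homogeneous N (weight N lam)"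
          using pg(2) ph(2) keys_diff[of g h] by (auto simp: homogeneous_def polys_def)
        show "jucys_murphy N i (g - h) = smul (content_value i) (g - h)" if "i \<in> {1..N}" for i
          using pg(4)[OF that] ph(4)[OF that] by (simp add: jucys_murphy_diff rpoly.scale_right_diff_distrib)
      qed
      then show False using pg(1) ph(1) by (simp add: lookup_minus)
    qed
  qed
  moreover have "of_nat (lookup lam (N + 1 - i)) = - \<kappa>0 * (\<Sum>j=1..<s. of_nat (lookup \<tau> j + 1))"
    if "1 \<le> s \<and> s \<le> part_length \<tau> \<and> (\<Sum>j=1..<s. lookup \<tau> j) < i \<and> i \<le> (\<Sum>j=1..s. lookup \<tau> j)" for s i
    using lam_row[of s i] that by simp
  ultimately show ?thesis
    using lam_partition by blast
qed

end
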